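(* Let $n\ge 1$. For any integral lattice $\Lambda\subset\mathbb{R}^n$, $$d(I(\Lambda)/B(\Lambda))\le 2v_2(n).$$ In particular, if $\Lambda$ is strongly modular with squarefree level $\ell$, then $\ell$ is the product of at most $2v_2(n)$ primes. Moreover, this bound is attained in every dimension: for every $n\ge 1$ there exists a strongly modular integral lattice in $\mathbb{R}^n$ with squarefree level $\ell$ that is the product of exactly $2v_2(n)$ primes.
   Context: Lattices in euclidean $\mathbb{R}^n$ have full rank $n$. For a lattice $\Lambda$, $\Lambda^*$ denotes the dual lattice with respect to the euclidean inner product; $\Lambda$ is integral if $\Lambda\subseteq\Lambda^*$. The level of an integral lattice $\Lambda$ is the smallest positive integer $\ell$ with $\ell\Lambda^*\subseteq\Lambda$. For a positive integer $\ell$, $W(\ell)$ is the elementary abelian $2$-group of positive divisors $m\|\ell$ (i.e. $m\mid\ell$ and $\gcd(m,\ell/m)=1$), with multiplication $m*m'=mm'/\gcd(m,m')^2$. For $\Lambda$ integral of level $\ell$ and $m\in W(\ell)$ put $$\Lambda_m=\sqrt{m}\,(\Lambda^*\cap m^{-1}\Lambda).$$ Define the subgroup $$I(\Lambda)=\{m\in W(\ell)\mid \Lambda=\sigma\Lambda_m \text{ for some } \sigma\in \mathrm{O}_n(\mathbb{R})\}$$ of $W(\ell)$, and let $B(\Lambda)=I(\Lambda)\cap\{k^2\mid k=1,2,\ldots\}$, which is a subgroup of $I(\Lambda)$. The lattice $\Lambda$ is called strongly modular if $I(\Lambda)=W(\ell)$. For an elementary abelian $2$-group $A$, $d(A)$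 denotes its dimension over $\mathbb{F}_2$. $v_2$ denotes the $2$-adic exponent valuation. *)

theory Defs
  imports
    "HOL-Analysis.Analysis"
    "HOL-Computational_Algebra.Squarefree"
    "HOL-Number_Theory.Number_Theory"
    "HOL-Algebra.Algebra"
    "Jordan_Normal_Form.Missing_VectorSpace"
begin

section \<open>Lattices in euclidean space\<close>

definition lattice_in :: "(real ^ 'n) set \<Rightarrow> bool" where
  "lattice_in L \<longleftrightarrow>
     (\<exists>B. independent B \<and> span B = UNIV \<and>
          L = {\<Sum>b\<in>B. of_int (c b) *\<^sub>R b | c :: real ^ 'n \<Rightarrow> int. True})"

definition dual_lattice :: "(real ^ 'n) set \<Rightarrow> (real ^ 'n) set" where
  "dual_lattice L = {x. \<forall>y\<in>L. x \<bullet> y \<in> \<int>}"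

definition integral_lattice :: "(real ^ 'n) set \<Rightarrow> bool" where
  "integral_lattice L \<longleftrightarrow> lattice_in L \<and> L \<subseteq> dual_lattice L"

definition lattice_level :: "(real ^ 'n) set \<Rightarrow> nat" where
  "lattice_level L = (LEAST l. l > 0 \<and> (\<lambda>x. real l *\<^sub>R x) ` dual_lattice L \<subseteq> L)"

section \<open>Partial duals and modularities\<close>

definition W_group :: "nat \<Rightarrow> nat monoid" where
  "W_group l =
     \<lparr>carrier = {m. m dvd l \<and> coprime m (l div m)},
      monoid.mult = (\<lambda>m m'. (m * m') div (gcd m m')\<^sup>2),
      one = 1\<rparr>"

definition partial_dual :: "nat \<Rightarrow> (real ^ 'n) set \<Rightarrow> (real ^ 'n) set" where
  "partial_dual m L =
     (\<lambda>x. sqrt (real m) *\<^sub>R x) `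
       (dual_lattice L \<inter> (\<lambda>x. inverse (real m) *\<^sub>R x) ` L)"

definition I_set :: "(real ^ 'n) set \<Rightarrow> nat set" where
  "I_set L = {m \<in> carrier (W_group (lattice_level L)).
                \<exists>\<sigma>. orthogonal_transformation \<sigma> \<and> L = \<sigma> ` partial_dual m L}"

definition B_set :: "(real ^ 'n) set \<Rightarrow> nat set" where
  "B_set L = I_set L \<inter> {k\<^sup>2 | k. k \<ge> 1}"

definition I_group :: "(real ^ 'n) set \<Rightarrow> nat monoid" where
  "I_group L = (W_group (lattice_level L)) \<lparr>carrier := I_set L\<rparr>"

definition strongly_modular :: "(real ^ 'n) set \<Rightarrow> bool" where
  "strongly_modular L \<longleftrightarrow> I_set L = carrier (W_group (lattice_level L))"

section \<open>Dimension of an elementary abelian 2-group\<close>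

text \<open>
  The group \<open>A\<close>, written multiplicatively, as a vector space over the field with two elements:
  vector addition is the group operation and scalars act by exponentiation.  The fields
  \<open>monoid.mult\<close> and \<open>one\<close> of a module record play no role for modules.
\<close>

definition F2_space :: "('a, 'b) monoid_scheme \<Rightarrow> (int, 'a) module" where
  "F2_space A =
     \<lparr>carrier = carrier A, monoid.mult = monoid.mult A, one = one A,
      ring.zero = one A, ring.add = monoid.mult A, smult = (\<lambda>c a. a [^]\<^bsub>A\<^esub> c)\<rparr>"

definition F2_dim :: "('a, 'b) monoid_scheme \<Rightarrow> nat" where
  "F2_dim A = vectorspace.dim (residue_ring 2) (F2_space A)"

lemma vectorspace_F2_space:
  assumes "comm_group A" and inv2: "\<And>a. a \<in> carrier A \<Longrightarrow> a \<otimes>\<^bsub>A\<^esub> a = \<one>\<^bsub>A\<^esub>"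
  shows "vectorspace (residue_ring 2) (F2_space A)"
proof -
  interpret A: comm_group A by fact
  interpret R: residues_prime 2 "residue_ring 2"
    by unfold_locales (simp_all add: residues_prime_def)
  have F: "field (residue_ring 2)" using R.is_field by simp
  have two: "c = 0 \<or> c = 1" if "c \<in> carrier (residue_ring 2)" for c
    using that by (auto simp: residue_ring_def)
  have p1: "a [^]\<^bsub>A\<^esub> (1::int) = a" if "a \<in> carrier A" for a
    using that by simp
  have simps: "carrier (F2_space A) = carrier A" "\<zero>\<^bsub>F2_space A\<^esub> = \<one>\<^bsub>A\<^esub>"
    "x \<oplus>\<^bsub>F2_space A\<^esub> y = x \<otimes>\<^bsub>A\<^esub> y" "c \<odot>\<^bsub>F2_space A\<^esub> x = x [^]\<^bsub>A\<^esub> c" for x y c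
    by (simp_all add: F2_space_def)
  have "abelian_group (F2_space A)"
    by (rule abelian_groupI) (auto simp: simps A.m_ac intro: A.l_inv_ex)
  moreover have "cring (residue_ring 2)" using F by (simp add: field_def domain_def)
  ultimately have "module (residue_ring 2) (F2_space A)"
  proof (intro Module.moduleI)
    fix a b x
    assume *: "a \<in> carrier (residue_ring 2)" "b \<in> carrier (residue_ring 2)"
      "x \<in> carrier (F2_space A)"
    show "(a \<oplus>\<^bsub>residue_ring 2\<^esub> b) \<odot>\<^bsub>F2_space A\<^esub> x =
          a \<odot>\<^bsub>F2_space A\<^esub> x \<oplus>\<^bsub>F2_space A\<^esub> b \<odot>\<^bsub>F2_space A\<^esub> x"
      using two[OF *(1)] two[OF *(2)] *(3)
      by (auto simp: simps residue_ring_def inv2 p1)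
    show "(a \<otimes>\<^bsub>residue_ring 2\<^esub> b) \<odot>\<^bsub>F2_space A\<^esub> x =
          a \<odot>\<^bsub>F2_space A\<^esub> (b \<odot>\<^bsub>F2_space A\<^esub> x)"
      using two[OF *(1)] two[OF *(2)] *(3)
      by (auto simp: simps residue_ring_def p1)
  qed (auto simp: simps A.int_pow_distrib residue_ring_def p1)
  then show ?thesis using F by (simp add: vectorspace_def)
qed

end

theory Submission
  imports Defs
begin

text \<open>
  Upper bound.  The pairs \<open>(m, \<sigma>)\<close> with \<open>\<sigma>\<close> orthogonal and \<open>\<sigma> \<Lambda>\<^sub>m = \<Lambda>\<close> form a finite group mapping onto
  \<open>I(\<Lambda>)\<close>, and \<open>\<surd>m \<sigma>\<close> is a rational matrix, so \<open>\<sigma>\<close> has its trace in \<open>\<surd>m \<rat>\<close>.  A Sylow 2-subgroup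
  still maps onto \<open>I(\<Lambda>)/B(\<Lambda>)\<close>.  For a complex representation of a 2-group whose character values lie on
  lines \<open>\<theta>(g) F\<close> over a field \<open>F\<close>, with \<open>\<theta>(g)\<^sup>2 \<in> F\<close>, one splits the space into the two eigenspaces of an
  element \<open>w\<close> whose square acts as a scalar \<open>\<nu>\<^sup>2\<close>.  Unless both \<open>F\<close> and the group survive unchanged, the
  two halves have equal dimension, while the group of classes of \<open>\<theta>\<close> loses at most two generators: one for
  passing to the centraliser of \<open>w\<close> and one for adjoining \<open>\<theta>(w)/\<nu>\<close> to \<open>F\<close>.  The 2-power roots of unity
  account for at most one further generator, which is never lost while \<open>F\<close> is real.

  Existence.  For suitable primes \<open>p, q\<close> Legendre's equation \<open>z\<^sup>2 = p x\<^sup>2 + q y\<^sup>2\<close> has a solution, which yields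
  anticommuting integral matrices with squares \<open>p\<close> and \<open>q\<close> that are similarities of a binary lattice of
  determinant \<open>p q\<close>.  The lattice wanted is an orthogonal sum of copies of a tensor product of \<open>v\<^sub>2(n)\<close> such
  binary lattices for disjoint pairs of primes.
\<close>

section \<open>Idempotent matrices and quadratic extensions\<close>

text \<open>The induction proves that \<open>2 ^ ((d + e) div 2)\<close> divides the degree, where
  \<open>d\<close> measures the number of classes of \<theta> modulo the field and \<open>e\<close>
  is 1 as long as the field and the values of \<theta> are real. With \<open>e = 0\<close> only
  \<open>d \<le> 2 * v + 1\<close> would follow, because of the roots of unity; starting over the
  rationals with \<open>e = 1\<close> removes this last unit.

  Passing to an eigenspace would change the size of the matrices, which is a type. So
  representations need not send 1 to the identity matrix: the space is the range of the idempotent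
  \<open>\<rho> \<one>\<close>, and its dimension is the trace of that idempotent.

  In the construction, anticommuting matrices with squares \<open>p\<close> and \<open>q\<close>
  realise the quaternion algebra \<open>(p, q)\<close> over the rationals. It is a matrix algebra
  precisely when Legendre's equation has a nontrivial solution, hence the choice of primes that are
  quadratic residues of each other. The products 1, \<open>T\<close>, \<open>U\<close>,
  \<open>T ** U\<close> provide the modularities at 1, \<open>p\<close>, \<open>q\<close>,
  \<open>p * q\<close>.\<close>

definition cscale :: "complex \<Rightarrow> complex ^ 'n ^ 'm \<Rightarrow> complex ^ 'n ^ 'm"  (infixr "*k" 75) where
  "c *k A = (\<chi> i j. c * A $ i $ j)"

lemma cscale_simps [simp]:
  "(c *k A) ** B = c *k (A ** B)" "A ** (c *k B) = c *k (A ** B)" "c *k d *k A = (c * d) *k A"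
  "1 *k A = A" "0 *k A = 0" "c *k 0 = 0" "c *k (A + B) = c *k A + c *k B" "c *k (A - B) = c *k A - c *k B"
  by (simp_all add: cscale_def matrix_matrix_mult_def vec_eq_iff sum_distrib_left mult_ac ring_distribs)

lemma cscale_eq_0_iff [simp]: "c *k A = 0 \<longleftrightarrow> c = 0 \<or> A = 0"
  by (auto simp: cscale_def vec_eq_iff)

lemma trace_cscale [simp]: "trace (c *k A) = c * trace A"
  by (simp add: trace_def cscale_def sum_distrib_left)

lemma matrix_add_rdistrib: "(A + B) ** C = A ** C + B ** (C :: 'a::semiring_1 ^ 'n ^ 'm)"
  by (simp add: matrix_matrix_mult_def vec_eq_iff sum.distrib distrib_right)

lemma matrix_sub_ldistrib: "A ** (B - C) = A ** B - A ** (C :: 'a::ring_1 ^ 'n ^ 'm)"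
  by (simp add: matrix_matrix_mult_def vec_eq_iff sum_subtractf right_diff_distrib)

lemma matrix_sub_rdistrib: "(A - B) ** C = A ** C - B ** (C :: 'a::ring_1 ^ 'n ^ 'm)"
  by (simp add: matrix_matrix_mult_def vec_eq_iff sum_subtractf left_diff_distrib)

text \<open>Induction on the rank: a nonzero entry of \<open>P\<close> yields a rank-one idempotent
  \<open>R\<close> with \<open>P ** R = R ** P = R\<close>, and \<open>P - R\<close> is an
  idempotent of smaller rank. The result gives a dimension to subspaces that are represented only by
  their projections.\<close>

lemma idempotent_trace_nat:
  fixes P :: "'a::field ^ 'n ^ 'n"
  assumes "P ** P = P"
  shows "\<exists>r::nat. trace P = of_nat r \<and> (P \<noteq> 0 \<longrightarrow> r > 0)"
  using assms
proof (induction "vec.dim (range ((*v) P))" arbitrary: P rule: less_induct)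
  case less
  show ?case
  proof (cases "P = 0")
    case True
    then show ?thesis by (intro exI[of _ 0]) (simp add: trace_def)
  next
    case False
    then obtain k i where ki: "P $ k $ i \<noteq> 0" by (auto simp: vec_eq_iff)
    \<comment> \<open>Column \<open>i\<close> of \<open>P\<close>, and row \<open>k\<close> divided
      by the entry where they cross. Since \<open>P\<close> is idempotent, \<open>w\<close> pairs
      with \<open>v\<close> to 1, so the rank-one matrix \<open>R\<close> is idempotent too.\<close>
    define v where "v = (\<chi> j. P $ j $ i)"
    define w where "w = (\<chi> j. P $ k $ j / P $ k $ i)"
    define R where "R = (\<chi> a b. v $ a * w $ b)"
    have PP: "(\<Sum>l\<in>UNIV. P $ a $ l * P $ l $ b) = P $ a $ b" for a b
      using less.prems by (auto simp: matrix_matrix_mult_def vec_eq_iff)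
    have wv: "(\<Sum>l\<in>UNIV. w $ l * v $ l) = 1"
      using ki by (simp add: v_def w_def PP flip: sum_divide_distrib)
    have PR: "P ** R = R"
      by (simp add: R_def matrix_matrix_mult_def vec_eq_iff v_def PP mult.assoc[symmetric] flip: sum_distrib_right)
    have "(\<Sum>l\<in>UNIV. w $ l * P $ l $ b) = w $ b" for b
      by (simp add: w_def PP flip: sum_divide_distrib)
    then have RP: "R ** P = R"
      by (simp add: R_def matrix_matrix_mult_def vec_eq_iff mult.assoc flip: sum_distrib_left)
    have "(\<Sum>l\<in>UNIV. v $ a * w $ l * (v $ l * w $ b)) = v $ a * w $ b" for a b
    proof -
      have "(\<Sum>l\<in>UNIV. v $ a * w $ l * (v $ l * w $ b)) = v $ a * (\<Sum>l\<in>UNIV. w $ l * v $ l) * w $ b"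
        by (simp add: sum_distrib_left sum_distrib_right ac_simps)
      then show ?thesis by (simp add: wv)
    qed
    then have RR: "R ** R = R"
      by (simp add: R_def matrix_matrix_mult_def vec_eq_iff)
    define Q where "Q = P - R"
    have QQ: "Q ** Q = Q"
      by (simp add: Q_def matrix_sub_ldistrib matrix_sub_rdistrib PR RP RR less.prems)
    have Pv: "P *v v = v"
      by (simp add: matrix_vector_mult_def vec_eq_iff v_def PP)
    have "R *v v = v"
      by (simp add: R_def matrix_vector_mult_def vec_eq_iff mult.assoc wv flip: sum_distrib_left)
    then have Qv: "Q *v v = 0" by (simp add: Q_def matrix_vector_mult_diff_rdistrib Pv)
    have "v \<noteq> 0" using ki by (auto simp: v_def vec_eq_iff)
    have "v \<notin> range ((*v) Q)"
    proof
      assume "v \<in> range ((*v) Q)"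
      then obtain y where "v = Q *v y" by auto
      then have "Q *v v = v" by (simp add: matrix_vector_mul_assoc QQ)
      then show False using Qv \<open>v \<noteq> 0\<close> by simp
    qed
    moreover have "v \<in> range ((*v) P)" using Pv by (metis rangeI)
    moreover have "range ((*v) Q) \<subseteq> range ((*v) P)"
    proof -
      have "P ** Q = Q" by (simp add: Q_def matrix_sub_ldistrib PR less.prems)
      then show ?thesis by (metis image_subsetI matrix_vector_mul_assoc rangeI)
    qed
    moreover have "vec.subspace (range ((*v) A))" for A :: "'a ^ 'n ^ 'n"
      using vec.linear_subspace_image[OF matrix_vector_mul_linear_gen vec.subspace_UNIV] by blast
    ultimately have "vec.dim (range ((*v) Q)) < vec.dim (range ((*v) P))"
      by (metis linorder_not_le vec.subspace_dim_equal)
    from less.hyps[OF this QQ] obtain r :: nat where "trace Q = of_nat r" by blast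
    moreover have "trace R = 1"
      using wv by (simp add: trace_def R_def mult.commute)
    ultimately have "trace P = of_nat (Suc r)"
      by (simp add: Q_def trace_sub algebra_simps)
    then show ?thesis by blast
  qed
qed

section \<open>Subfields of the complex numbers and their quadratic extensions\<close>

definition is_subfield :: "complex set \<Rightarrow> bool" where
  "is_subfield F \<longleftrightarrow> 1 \<in> F \<and> (\<forall>a\<in>F. \<forall>b\<in>F. a - b \<in> F \<and> a * b \<in> F) \<and> (\<forall>a\<in>F. inverse a \<in> F)"

lemma is_subfieldD:
  assumes "is_subfield F"
  shows "0 \<in> F" "1 \<in> F" "a \<in> F \<Longrightarrow> b \<in> F \<Longrightarrow> a + b \<in> F" "a \<in> F \<Longrightarrow> b \<in> F \<Longrightarrow> a - b \<in> F"
    "a \<in> F \<Longrightarrow> b \<in> F \<Longrightarrow> a * b \<in> F" "a \<in> F \<Longrightarrow> b \<in> F \<Longrightarrow> a / b \<in> F" "a \<in> F \<Longrightarrow> - a \<in> F"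
    "a \<in> F \<Longrightarrow> inverse a \<in> F" "a \<in> F \<Longrightarrow> a ^ k \<in> F" "of_nat k \<in> F"
proof -
  show 0: "0 \<in> F" and 1: "1 \<in> F" and d: "a \<in> F \<Longrightarrow> b \<in> F \<Longrightarrow> a - b \<in> F"
    and m: "a \<in> F \<Longrightarrow> b \<in> F \<Longrightarrow> a * b \<in> F" and i: "a \<in> F \<Longrightarrow> inverse a \<in> F" for a b
    using assms unfolding is_subfield_def by (force, auto)
  show n: "a \<in> F \<Longrightarrow> - a \<in> F" for a using d[OF 0] by simp
  show p: "a \<in> F \<Longrightarrow> b \<in> F \<Longrightarrow> a + b \<in> F" for a b using d[of a "-b"] n[of b] by simp
  show "a \<in> F \<Longrightarrow> b \<in> F \<Longrightarrow> a / b \<in> F" by (simp add: divide_inverse m i)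
  show "a \<in> F \<Longrightarrow> a ^ k \<in> F" by (induction k) (auto intro: m 1)
  show "of_nat k \<in> F" by (induction k) (auto intro: p 1 0)
qed

text \<open>The \<open>F\<close>-span of 1 and \<open>\<delta>\<close>; it is a field under the
  standing assumption \<open>\<delta>\<^sup>2 \<in> F\<close> of the context below.\<close>

definition adjoin :: "complex set \<Rightarrow> complex \<Rightarrow> complex set" where
  "adjoin F \<delta> = {a + b * \<delta> | a b. a \<in> F \<and> b \<in> F}"

lemma adjoinI: "a \<in> F \<Longrightarrow> b \<in> F \<Longrightarrow> a + b * \<delta> \<in> adjoin F \<delta>"
  by (auto simp: adjoin_def)

context
  fixes F \<delta>
  assumes F: "is_subfield F" and \<delta>: "\<delta>\<^sup>2 \<in> F"
begin

lemma subset_adjoin: "F \<subseteq> adjoin F \<delta>"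
  using adjoinI[of _ F 0] is_subfieldD(1)[OF F] by force

lemma adjoin_self: "\<delta> \<in> F \<Longrightarrow> adjoin F \<delta> = F"
  using subset_adjoin is_subfieldD[OF F] by (auto simp: adjoin_def)

lemma subfield_adjoin: "is_subfield (adjoin F \<delta>)"
proof (cases "\<delta> \<in> F")
  case True
  then show ?thesis using F adjoin_self by simp
next
  case False
  note Fc = is_subfieldD[OF F]
  have inv: "inverse x \<in> adjoin F \<delta>" if "x \<in> adjoin F \<delta>" for x
  proof -
    obtain a b where ab: "a \<in> F" "b \<in> F" and x: "x = a + b * \<delta>"
      using \<open>x \<in> adjoin F \<delta>\<close> unfolding adjoin_def by blast
    show ?thesis
    proof (cases "a = 0 \<and> b = 0")
      case True
      then show ?thesis using Fc(1) subset_adjoin x by auto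
    next
      case nz: False
      have *: "a - b * \<delta> \<noteq> 0" "x \<noteq> 0"
      proof -
        have "\<delta> = a / b" if "a - b * \<delta> = 0" using that nz by (auto simp: field_simps)
        then show "a - b * \<delta> \<noteq> 0" using False Fc(6)[OF ab] by blast
        have "\<delta> = - (a / b)" if "a + b * \<delta> = 0"
        proof -
          have "b \<noteq> 0" using that nz by auto
          moreover have "b * \<delta> = - a" using that by (simp add: eq_neg_iff_add_eq_0 add.commute)
          ultimately show ?thesis by (simp add: field_simps)
        qed
        then show "x \<noteq> 0" using False Fc(6)[OF ab] Fc(7) unfolding x by blast
      qed
      \<comment> \<open>The norm of \<open>x\<close> down to \<open>F\<close>. It is nonzero because
        both conjugate factors are, and it clears \<delta> from the denominator of the
        inverse.\<close>
      define N where "N = a\<^sup>2 - b\<^sup>2 * \<delta>\<^sup>2"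
      have N: "N = x * (a - b * \<delta>)" by (simp add: N_def x algebra_simps power2_eq_square)
      then have "inverse x = (a - b * \<delta>) / N"
        using * by (simp add: inverse_eq_divide)
      then have "inverse x = a / N + (- b / N) * \<delta>"
        by (simp add: diff_divide_distrib)
      moreover have "N \<in> F" unfolding N_def by (intro Fc(4,5,9) ab \<delta>)
      ultimately show ?thesis using ab by (simp only:) (intro adjoinI Fc(6,7))
    qed
  qed
  have "x - y \<in> adjoin F \<delta> \<and> x * y \<in> adjoin F \<delta>" if xy: "x \<in> adjoin F \<delta>" "y \<in> adjoin F \<delta>" for x y
  proof -
    obtain a b c d where ab: "a \<in> F" "b \<in> F" "c \<in> F" "d \<in> F"
      and x: "x = a + b * \<delta>" "y = c + d * \<delta>"
      using xy unfolding adjoin_def by blast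
    have "x * y = (a * c + b * d * \<delta>\<^sup>2) + (a * d + b * c) * \<delta>"
      by (simp add: x algebra_simps power2_eq_square)
    moreover have "x - y = (a - c) + (b - d) * \<delta>"
      by (simp add: x algebra_simps)
    ultimately show ?thesis using ab \<delta> by (simp only:) (intro conjI adjoinI Fc(3,4,5))
  qed
  moreover have "1 \<in> adjoin F \<delta>" using subset_adjoin Fc by auto
  ultimately show ?thesis unfolding is_subfield_def using inv by blast
qed

text \<open>Squaring \<open>a + b * \<delta>\<close> produces the term
  \<open>2 * a * b * \<delta>\<close>, which must vanish if the square is to lie in
  \<open>F\<close>. Thus a quadratic extension makes at most one further class of square roots
  trivial.\<close>

lemma sqrt_in_adjoin:
  assumes "t \<in> adjoin F \<delta>" "t\<^sup>2 \<in> F" "\<delta> \<noteq> 0"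
  shows "t \<in> F \<or> t / \<delta> \<in> F"
proof (cases "\<delta> \<in> F")
  case True
  then show ?thesis using assms adjoin_self by simp
next
  case False
  note Fc = is_subfieldD[OF F]
  obtain a b where ab: "a \<in> F" "b \<in> F" "t = a + b * \<delta>" using assms by (auto simp: adjoin_def)
  have "(2 * a * b) * \<delta> = t\<^sup>2 - a\<^sup>2 - b\<^sup>2 * \<delta>\<^sup>2"
    unfolding ab by (simp add: algebra_simps power2_eq_square)
  then have *: "(2 * a * b) * \<delta> \<in> F" using ab(1,2) assms(2) \<delta> by (simp add: Fc(4,5,9))
  have "2 * a * b \<in> F" using ab Fc(5) Fc(10)[of 2] by simp
  have "a * b = 0"
  proof (rule ccontr)
    assume "a * b \<noteq> 0"
    then have "(2 * a * b) * \<delta> / (2 * a * b) = \<delta>" by simp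
    then show False using Fc(6)[OF * \<open>2 * a * b \<in> F\<close>] False by simp
  qed
  then show ?thesis using ab assms(3) by auto
qed

end

section \<open>Finite 2-groups\<close>

text \<open>Class equation: without a nontrivial central element every conjugacy class other than
  that of \<open>\<one>\<close> would have even size, and the order of the group would be
  odd.\<close>

lemma (in group) two_group_center_nontrivial:
  assumes order: "order G = 2 ^ k" "k > 0"
  shows "\<exists>x\<in>carrier G. x \<noteq> \<one> \<and> (\<forall>g\<in>carrier G. g \<otimes> x = x \<otimes> g)"
proof (rule ccontr)
  assume contra: "\<not> ?thesis"
  define \<phi> where "\<phi> = (\<lambda>g. (\<lambda>h \<in> carrier G. g \<otimes> h \<otimes> (inv g)))"
  interpret act: group_action G "carrier G" \<phi>
    unfolding \<phi>_def by (rule action_by_conjugation)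
  have fin: "finite (carrier G)"
    using order order_gt_0_iff_finite by simp
  let ?O = "orbits G (carrier G) \<phi>"
  have orb1: "orbit G \<phi> \<one> = {\<one>}"
    by (auto simp: orbit_def \<phi>_def intro!: exI[of _ \<one>])
  have one_in: "{\<one>} \<in> ?O" unfolding orbits_def using orb1 by force
  have ev: "even (card C)" if C: "C \<in> ?O - {{\<one>}}" for C
  proof -
    obtain x where x: "x \<in> carrier G" "C = orbit G \<phi> x" using C by (auto simp: orbits_def)
    have "x \<noteq> \<one>" using x C orb1 by auto
    then obtain g where g: "g \<in> carrier G" "g \<otimes> x \<noteq> x \<otimes> g" using contra x by auto
    have "x \<in> C" using x act.orbit_refl by auto
    moreover have "g \<otimes> x \<otimes> inv g \<in> C" using x g by (auto simp: orbit_def \<phi>_def)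
    moreover have "g \<otimes> x \<otimes> inv g \<noteq> x" using g x
      by (metis inv_solve_right m_closed)
    moreover have "finite C" using fin x by (auto simp: orbit_def)
    ultimately have "card C \<noteq> 1" by (auto simp: card_1_singleton_iff)
    moreover have "card C dvd 2 ^ k"
      using act.orbit_stabilizer_theorem[OF x(1)] x(2) order by (metis dvd_triv_left)
    moreover from this obtain i where "card C = 2 ^ i"
      using divides_primepow_nat[OF two_is_prime_nat] by blast
    ultimately show ?thesis by (cases i) auto
  qed
  have "card (carrier G) = (\<Sum>C\<in>?O. card C)"
    using act.disjoint_sum[OF fin, of "\<lambda>_. 1"] by (metis (mono_tags, lifting) card_eq_sum sum.cong)
  also have "\<dots> = card {\<one>} + (\<Sum>C\<in>?O - {{\<one>}}. card C)"
    using one_in fin act.orbits_coverture by (intro sum.remove) (auto intro: finite_UnionD)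
  finally have "order G = 1 + (\<Sum>C\<in>?O - {{\<one>}}. card C)" by (simp add: order_def)
  moreover have "even (\<Sum>C\<in>?O - {{\<one>}}. card C)" using ev by (intro dvd_sum) blast
  ultimately have "odd (order G)" by simp
  then show False using order by simp
qed

text \<open>The quotient by \<open>H\<close> is again a nontrivial 2-group; \<open>x\<close> lifts a
  nontrivial element of its centre.\<close>

lemma (in normal) two_group_central_mod:
  assumes order: "order G = 2 ^ k" and ne: "H \<noteq> carrier G"
  shows "\<exists>x\<in>carrier G - H. \<forall>g\<in>carrier G. \<exists>z\<in>H. g \<otimes> x = z \<otimes> x \<otimes> g"
proof -
  interpret Q: group "G Mod H" by (rule factorgroup_is_group)
  have fin: "finite (carrier G)" using order order_gt_0_iff_finite by simp
  have lag: "order (G Mod H) * card H = 2 ^ k"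
    using lagrange[OF subgroup_axioms] order by (simp add: order_def FactGroup_def)
  have "card H < order G"
    using ne subset fin by (simp add: order_def psubset_card_mono psubset_eq)
  then have "order (G Mod H) \<noteq> 1" using lag order by auto
  moreover obtain j where j: "order (G Mod H) = 2 ^ j"
    using divides_primepow_nat[OF two_is_prime_nat, of "order (G Mod H)" k] lag[symmetric] by force
  ultimately have "j > 0" by (auto intro: gr0I)
  from Q.two_group_center_nontrivial[OF j this] obtain C where C: "C \<in> carrier (G Mod H)" "C \<noteq> H"
    and comm: "\<And>Y. Y \<in> carrier (G Mod H) \<Longrightarrow> Y \<otimes>\<^bsub>G Mod H\<^esub> C = C \<otimes>\<^bsub>G Mod H\<^esub> Y"
    by auto
  from C obtain x where x: "x \<in> carrier G" "C = H #> x" by (auto simp: carrier_FactGroup)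
  have "x \<notin> H" using C x coset_join2 subgroup_axioms by blast
  moreover have "\<exists>z\<in>H. g \<otimes> x = z \<otimes> x \<otimes> g" if g: "g \<in> carrier G" for g
  proof -
    have "(H #> g) <#> (H #> x) = (H #> x) <#> (H #> g)"
      using comm[of "H #> g"] g x by (auto simp: carrier_FactGroup)
    then have "H #> (g \<otimes> x) = H #> (x \<otimes> g)" using g x by (simp add: rcos_sum)
    moreover have "g \<otimes> x \<in> H #> (g \<otimes> x)" using g x by (intro rcos_self subgroup_axioms) auto
    ultimately obtain z where "z \<in> H" "g \<otimes> x = z \<otimes> (x \<otimes> g)" by (auto simp: r_coset_def)
    then show ?thesis using g x subset by (auto simp: m_assoc subset_iff)
  qed
  ultimately show ?thesis using x by blast
qed

text \<open>The iterated squares of \<open>x\<close> stay in \<open>S\<close> and end at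
  \<open>\<one>\<close>, where \<open>P\<close> holds, so the last one violating \<open>P\<close> is
  as required. It serves with \<open>P\<close> expressing that an element acts as a scalar and with
  \<open>P\<close> expressing membership in \<open>repcenter\<close>.\<close>

lemma (in group) two_group_last_square:
  assumes "order G = 2 ^ k" "x \<in> S" "S \<subseteq> carrier G" "\<And>y. y \<in> S \<Longrightarrow> y \<otimes> y \<in> S" "P \<one>" "\<not> P x"
  shows "\<exists>w\<in>S. \<not> P w \<and> P (w \<otimes> w)"
proof (rule ccontr)
  assume contra: "\<not> ?thesis"
  have "x [^] (2 ^ j :: nat) \<in> S \<and> \<not> P (x [^] (2 ^ j :: nat))" for j :: nat
  proof (induction j)
    case (Suc j)
    have "x [^] (2 ^ Suc j :: nat) = x [^] (2 ^ j :: nat) \<otimes> x [^] (2 ^ j :: nat)"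
      using assms by (subst nat_pow_mult) (auto simp: mult_2)
    then show ?case using Suc contra assms by auto
  qed (use assms in auto)
  moreover have "x [^] (2 ^ k :: nat) = \<one>" using pow_order_eq_1[of x] assms by auto
  ultimately have "\<not> P \<one>" by metis
  then show False using assms(5) by simp
qed

section \<open>Representations with traces on prescribed lines\<close>

text \<open>Translation by one element of \<open>A - K\<close> injects \<open>A - K\<close> into
  \<open>K\<close>. This replaces an index computation and applies to sets that are not known to be
  subgroups.\<close>

lemma (in group) card_le_twice:
  assumes fin: "finite K" and sub: "A \<subseteq> carrier G"
    and prod: "\<And>g h. g \<in> A - K \<Longrightarrow> h \<in> A - K \<Longrightarrow> g \<otimes> h \<in> K"
  shows "card A \<le> 2 * card K"
proof (cases "A \<subseteq> K")
  case True
  then have "card A \<le> card K" by (rule card_mono[OF fin])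
  then show ?thesis by simp
next
  case False
  then obtain y where y: "y \<in> A - K" by blast
  have inj: "inj_on (\<lambda>g. y \<otimes> g) (A - K)" using y sub by (intro inj_onI) (auto simp: subset_iff)
  have sub2: "(\<lambda>g. y \<otimes> g) ` (A - K) \<subseteq> K" using prod y by blast
  have "finite (A - K)"
    by (rule finite_imageD[OF finite_subset[OF sub2 fin] inj])
  then have "finite (A - K \<union> K)" using fin by simp
  then have "finite A" by (rule rev_finite_subset) blast
  have "card (A - K) \<le> card K" using inj sub2 fin by (rule card_inj_on_le)
  moreover have "card (A \<inter> K) \<le> card K" using fin by (intro card_mono) auto
  moreover have "card A = card (A - K) + card (A \<inter> K)"
    using card_Int_Diff[OF \<open>finite A\<close>, of K] by simp
  ultimately show ?thesis by simp
qed

text \<open>By Bezout's identity the exponents that lead into \<open>F\<close> are closed under gcd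
  with the least power of two among them, so they are its multiples.\<close>

lemma root_of_unity_exponent:
  fixes F :: "complex set"
  assumes F: "is_subfield F" and \<zeta>: "\<zeta> ^ (2 ^ k) = 1"
  shows "\<exists>t. \<forall>n::nat. \<zeta> ^ n \<in> F \<longleftrightarrow> 2 ^ t dvd n"
proof -
  note Fc = is_subfieldD[OF F]
  define t where "t = (LEAST t. \<zeta> ^ (2 ^ t) \<in> F)"
  have t: "\<zeta> ^ (2 ^ t) \<in> F" unfolding t_def
    by (rule LeastI[of _ k]) (simp add: \<zeta> Fc(2))
  have "\<zeta> \<noteq> 0" using \<zeta> by (auto simp: power_0_left)
  have "2 ^ t dvd n" if n: "\<zeta> ^ n \<in> F" for n
  proof (cases "n = 0")
    case False
    obtain x y where xy: "n * x = 2 ^ t * y + gcd n (2 ^ t)" using bezout_nat[OF False] by blast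
    have "\<zeta> ^ gcd n (2 ^ t) = (\<zeta> ^ n) ^ x / (\<zeta> ^ (2 ^ t)) ^ y"
      using xy \<open>\<zeta> \<noteq> 0\<close> by (simp add: power_add flip: power_mult)
    also have "\<dots> \<in> F" by (intro Fc(6,9) n t)
    finally have g: "\<zeta> ^ gcd n (2 ^ t) \<in> F" .
    obtain s where s: "s \<le> t" "gcd n (2 ^ t) = 2 ^ s"
      using divides_primepow_nat[OF two_is_prime_nat, of "gcd n (2 ^ t)" t] by auto
    have "t \<le> s" using g s unfolding t_def by (simp add: Least_le)
    then show ?thesis using s by (metis gcd_dvd1 le_antisym)
  qed auto
  moreover have "\<zeta> ^ n \<in> F" if "2 ^ t dvd n" for n
    using that t Fc(9) by (auto simp: power_mult elim!: dvdE)
  ultimately show ?thesis by blast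
qed

text \<open>The group of \<open>2 ^ k\<close>-th roots of unity is cyclic, so modulo
  \<open>F\<close> it has at most one class of order two. As powers of a primitive root, both
  \<open>a\<close> and \<open>b\<close> have exponents that are odd multiples of
  \<open>2 ^ s\<close>, where \<open>2 ^ Suc s\<close> is the smallest positive exponent leading
  into \<open>F\<close>.\<close>

lemma roots_of_unity_mod_subfield:
  assumes F: "is_subfield F" and "a ^ (2 ^ k) = 1" "b ^ (2 ^ k) = 1" "a\<^sup>2 \<in> F" "b\<^sup>2 \<in> F" "a \<notin> F" "b \<notin> F"
  shows "a * b \<in> F"
proof -
  define \<zeta> where "\<zeta> = exp (2 * of_real pi * \<i> / of_nat (2 ^ k))"
  have "\<exists>j. z = \<zeta> ^ j" if z: "z ^ (2 ^ k) = 1" for z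
  proof -
    obtain j where "z = exp (2 * of_real pi * \<i> * of_nat j / of_nat (2 ^ k))"
      using z complex_roots_unity[of "2 ^ k"] by auto
    then show ?thesis by (auto simp: \<zeta>_def algebra_simps simp flip: exp_of_nat_mult intro!: exI[of _ j])
  qed
  then obtain u v where uv: "a = \<zeta> ^ u" "b = \<zeta> ^ v" using assms by meson
  have "\<zeta> ^ (2 ^ k) = 1"
    using exp_two_pi_i by (simp add: \<zeta>_def flip: exp_of_nat_mult)
  from root_of_unity_exponent[OF F this] obtain t where t: "\<And>n. \<zeta> ^ n \<in> F \<longleftrightarrow> 2 ^ t dvd n" by blast
  have *: "2 ^ t dvd 2 * u" "2 ^ t dvd 2 * v" "\<not> 2 ^ t dvd u" "\<not> 2 ^ t dvd v"
    using assms by (simp_all add: uv flip: t power_mult mult.commute[of 2])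
  obtain s where s: "t = Suc s" using *(3) by (cases t) auto
  then obtain p q where "u = 2 ^ s * p" "v = 2 ^ s * q" using * by (auto elim!: dvdE)
  then have "odd p" "odd q" using * s by auto
  then have "2 ^ t dvd u + v" using s \<open>u = _\<close> \<open>v = _\<close> by (simp flip: distrib_left)
  then show ?thesis by (simp add: uv t flip: power_add)
qed

section \<open>Matrix representations and the eigenspaces of one element\<close>

locale matrix_rep = group G for G :: "'a monoid" (structure) +
  fixes \<rho> :: "'a \<Rightarrow> complex ^ 'n ^ 'n"
  assumes rep_mult: "g \<in> carrier G \<Longrightarrow> h \<in> carrier G \<Longrightarrow> \<rho> (g \<otimes> h) = \<rho> g ** \<rho> h"
begin

lemma rep_one [simp]:
  assumes "g \<in> carrier G"
  shows "\<rho> \<one> ** \<rho> g = \<rho> g" "\<rho> g ** \<rho> \<one> = \<rho> g"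
  using rep_mult[of \<one> g] rep_mult[of g \<one>] assms by simp_all

lemma rep_nonzero: "g \<in> carrier G \<Longrightarrow> \<rho> \<one> \<noteq> 0 \<Longrightarrow> \<rho> g \<noteq> 0"
proof
  assume "g \<in> carrier G" "\<rho> \<one> \<noteq> 0" "\<rho> g = 0"
  then have "\<rho> \<one> = 0 ** \<rho> (inv g)" using rep_mult[of g "inv g"] by simp
  then show False using \<open>\<rho> \<one> \<noteq> 0\<close> by (simp add: matrix_matrix_mult_def vec_eq_iff)
qed

text \<open>When \<open>\<rho> (w \<otimes> w) = \<nu>\<^sup>2 *k \<rho> \<one>\<close> with \<nu>
  nonzero, this is the projection of the range of \<open>\<rho> \<one>\<close> onto the
  \<nu>-eigenspace of \<open>\<rho> w\<close>; \<open>- \<nu>\<close> gives the other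
  eigenspace.\<close>

definition eigenproj :: "'a \<Rightarrow> complex \<Rightarrow> complex ^ 'n ^ 'n" where
  "eigenproj w \<nu> = (1 / 2) *k (\<rho> \<one> + (1 / \<nu>) *k \<rho> w)"

context
  fixes C w \<nu>
  assumes C: "subgroup C G" and w: "w \<in> carrier G"
    and comm: "\<And>g. g \<in> C \<Longrightarrow> \<rho> (g \<otimes> w) = \<rho> (w \<otimes> g)"
    and sq: "\<rho> (w \<otimes> w) = \<nu>\<^sup>2 *k \<rho> \<one>" and \<nu>: "\<nu> \<noteq> 0"
begin

lemma eigenproj_idem: "eigenproj w \<nu> ** eigenproj w \<nu> = eigenproj w \<nu>"
proof -
  define V where "V = (1 / \<nu>) *k \<rho> w"
  have "\<rho> w ** \<rho> w = \<nu>\<^sup>2 *k \<rho> \<one>" using sq w by (simp add: rep_mult)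
  then have V: "V ** V = \<rho> \<one>" "\<rho> \<one> ** V = V" "V ** \<rho> \<one> = V" "\<rho> \<one> ** \<rho> \<one> = \<rho> \<one>"
    using \<nu> w by (simp_all add: V_def power2_eq_square)
  have "(\<rho> \<one> + V) ** (\<rho> \<one> + V) = (\<rho> \<one> + V) + (V + \<rho> \<one>)"
    by (simp only: matrix_add_ldistrib matrix_add_rdistrib V)
  moreover have "((1 / 2) *k S) ** ((1 / 2) *k S) = (1 / 4) *k (S ** S)" for S :: "complex ^ 'n ^ 'n"
    by simp
  ultimately have "eigenproj w \<nu> ** eigenproj w \<nu> = (1 / 4) *k ((\<rho> \<one> + V) + (V + \<rho> \<one>))"
    unfolding eigenproj_def V_def[symmetric] by metis
  also have "\<dots> = eigenproj w \<nu>"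
    unfolding eigenproj_def V_def[symmetric] by (simp add: cscale_def vec_eq_iff)
  finally show ?thesis .
qed

lemma eigenproj_comm: "g \<in> C \<Longrightarrow> \<rho> g ** eigenproj w \<nu> = eigenproj w \<nu> ** \<rho> g"
  using comm[of g] w subgroup.mem_carrier[OF C, of g]
  by (simp add: eigenproj_def matrix_add_ldistrib matrix_add_rdistrib rep_mult)

lemma eigenproj_rep: "matrix_rep (G\<lparr>carrier := C\<rparr>) (\<lambda>g. \<rho> g ** eigenproj w \<nu>)"
proof -
  interpret H: group "G\<lparr>carrier := C\<rparr>" using C by (rule subgroup_imp_group)
  show ?thesis
  proof
    fix g h assume "g \<in> carrier (G\<lparr>carrier := C\<rparr>)" "h \<in> carrier (G\<lparr>carrier := C\<rparr>)"
    then have gh: "g \<in> C" "h \<in> C" by auto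
    have "\<rho> g ** eigenproj w \<nu> ** (\<rho> h ** eigenproj w \<nu>)
        = \<rho> g ** (eigenproj w \<nu> ** \<rho> h) ** eigenproj w \<nu>"
      by (simp add: matrix_mul_assoc)
    also have "\<dots> = \<rho> g ** \<rho> h ** (eigenproj w \<nu> ** eigenproj w \<nu>)"
      by (simp add: eigenproj_comm[OF gh(2), symmetric] matrix_mul_assoc)
    finally show "\<rho> (g \<otimes>\<^bsub>G\<lparr>carrier := C\<rparr>\<^esub> h) ** eigenproj w \<nu>
        = \<rho> g ** eigenproj w \<nu> ** (\<rho> h ** eigenproj w \<nu>)"
      using gh subgroup.mem_carrier[OF C] by (simp add: eigenproj_idem rep_mult)
  qed
qed

lemma eigenproj_trace:
  "g \<in> C \<Longrightarrow> trace (\<rho> g ** eigenproj w \<nu>) = (trace (\<rho> g) + trace (\<rho> (g \<otimes> w)) / \<nu>) / 2"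
  using w subgroup.mem_carrier[OF C, of g]
  by (simp add: eigenproj_def matrix_add_ldistrib rep_mult trace_add)

lemma eigenproj_trace_one:
  "trace (\<rho> \<one> ** eigenproj w \<nu>) = (trace (\<rho> \<one>) + trace (\<rho> w) / \<nu>) / 2"
  using eigenproj_trace[OF subgroup.one_closed[OF C]] w by simp

end

end

text \<open>In the application \<open>\<theta>\<close> is the square root of the similarity factor.\<close>

definition trace_lines :: "'a monoid \<Rightarrow> ('a \<Rightarrow> complex ^ 'n ^ 'n) \<Rightarrow> complex set \<Rightarrow> ('a \<Rightarrow> complex) \<Rightarrow> bool" where
  "trace_lines G \<rho> F \<theta> \<longleftrightarrow> is_subfield F \<and>
     (\<forall>g\<in>carrier G. \<theta> g \<noteq> 0 \<and> (\<theta> g)\<^sup>2 \<in> F \<and> trace (\<rho> g) / \<theta> g \<in> F) \<and>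
     (\<forall>g\<in>carrier G. \<forall>h\<in>carrier G. \<theta> (g \<otimes>\<^bsub>G\<^esub> h) / (\<theta> g * \<theta> h) \<in> F)"

context matrix_rep
begin

context
  fixes F \<theta>
  assumes tl: "trace_lines G \<rho> F \<theta>"
begin

lemma trace_linesD:
  shows "is_subfield F" "g \<in> carrier G \<Longrightarrow> \<theta> g \<noteq> 0" "g \<in> carrier G \<Longrightarrow> (\<theta> g)\<^sup>2 \<in> F"
    "g \<in> carrier G \<Longrightarrow> trace (\<rho> g) / \<theta> g \<in> F"
    "g \<in> carrier G \<Longrightarrow> h \<in> carrier G \<Longrightarrow> \<theta> (g \<otimes> h) / (\<theta> g * \<theta> h) \<in> F"
  using tl by (auto simp: trace_lines_def)

lemma theta_mult:
  assumes "g \<in> carrier G" "h \<in> carrier G" "\<theta> g * \<theta> h \<in> F"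
  shows "\<theta> (g \<otimes> h) \<in> F"
proof -
  note Fc = is_subfieldD[OF trace_linesD(1)]
  have "\<theta> (g \<otimes> h) = \<theta> (g \<otimes> h) / (\<theta> g * \<theta> h) * (\<theta> g * \<theta> h)" using assms trace_linesD(2) by simp
  then show ?thesis using Fc(5) trace_linesD(5) assms by metis
qed

text \<open>Compare traces: that of \<open>\<rho> (w \<otimes> w)\<close> is
  \<open>\<mu> * r\<close> and lies on the line through \<open>\<theta> (w \<otimes> w)\<close>,
  which belongs to \<open>F\<close> because \<open>(\<theta> w)\<^sup>2\<close> does.\<close>

lemma square_scalar_in_field:
  assumes "w \<in> carrier G" "\<rho> (w \<otimes> w) = \<mu> *k \<rho> \<one>" "trace (\<rho> \<one>) = of_nat r" "r > 0"
  shows "\<mu> \<in> F"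
proof -
  note Fc = is_subfieldD[OF trace_linesD(1)]
  have th: "\<theta> (w \<otimes> w) \<in> F" using theta_mult[of w w] assms trace_linesD(3)[of w] by (simp add: power2_eq_square)
  have "\<mu> = trace (\<rho> (w \<otimes> w)) / \<theta> (w \<otimes> w) * \<theta> (w \<otimes> w) / of_nat r"
    using assms trace_linesD(2)[of "w \<otimes> w"] by simp
  also have "\<dots> \<in> F" using assms th by (intro Fc(5,6,10) trace_linesD(4)) auto
  finally show ?thesis .
qed

text \<open>Every element newly captured by the extension has its \<theta>-value in
  \<open>\<delta> F\<close>, so the product of two of them is among the old ones: enlarging the
  field costs at most one generator.\<close>

lemma card_theta_adjoin:
  assumes fin: "finite (carrier G)" and C: "C \<subseteq> carrier G" and \<delta>: "\<delta>\<^sup>2 \<in> F" "\<delta> \<noteq> 0"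
  shows "card {g \<in> C. \<theta> g \<in> adjoin F \<delta>} \<le> 2 * card {g \<in> carrier G. \<theta> g \<in> F}"
proof (rule card_le_twice)
  note Fc = is_subfieldD[OF trace_linesD(1)]
  fix g h assume gh: "g \<in> {g \<in> C. \<theta> g \<in> adjoin F \<delta>} - {g \<in> carrier G. \<theta> g \<in> F}"
    "h \<in> {g \<in> C. \<theta> g \<in> adjoin F \<delta>} - {g \<in> carrier G. \<theta> g \<in> F}"
  have "\<theta> g / \<delta> \<in> F" "\<theta> h / \<delta> \<in> F"
    using sqrt_in_adjoin[OF trace_linesD(1) \<delta>(1) _ trace_linesD(3) \<delta>(2)] gh C by blast+
  then have "\<theta> g / \<delta> * (\<theta> h / \<delta>) * \<delta>\<^sup>2 \<in> F" using Fc(5) \<delta> by blast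
  then have "\<theta> g * \<theta> h \<in> F" using \<delta> by (simp add: power2_eq_square)
  then show "g \<otimes> h \<in> {g \<in> carrier G. \<theta> g \<in> F}" using theta_mult gh C by auto
qed (use fin C in auto)

text \<open>On the eigenspace the trace of \<open>g\<close> is the mean of the trace of
  \<open>g\<close> and that of \<open>g \<otimes> w\<close> divided by \<nu>. The first lies on the
  line \<open>\<theta> g F\<close>, the second on this line multiplied by
  \<open>\<theta> w / \<nu>\<close>, which is why exactly this quotient is adjoined.\<close>

lemma trace_lines_eigenproj:
  assumes C: "subgroup C G" and w: "w \<in> carrier G"
    and comm: "\<And>g. g \<in> C \<Longrightarrow> \<rho> (g \<otimes> w) = \<rho> (w \<otimes> g)"
    and sq: "\<rho> (w \<otimes> w) = \<nu>\<^sup>2 *k \<rho> \<one>" and \<nu>: "\<nu> \<noteq> 0" "\<nu>\<^sup>2 \<in> F"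
  shows "trace_lines (G\<lparr>carrier := C\<rparr>) (\<lambda>g. \<rho> g ** eigenproj w \<nu>) (adjoin F (\<theta> w / \<nu>)) \<theta>"
proof -
  note Fc = is_subfieldD[OF trace_linesD(1)]
  have mem: "g \<in> carrier G" if "g \<in> C" for g using that subgroup.mem_carrier[OF C] by blast
  have \<delta>: "(\<theta> w / \<nu>)\<^sup>2 \<in> F" using Fc(6) trace_linesD(3) w \<nu> by (simp add: power_divide)
  note sub = subset_adjoin[OF trace_linesD(1) \<delta>]
  have "trace (\<rho> g ** eigenproj w \<nu>) / \<theta> g \<in> adjoin F (\<theta> w / \<nu>)" if g: "g \<in> C" for g
  proof -
    have tr: "trace (\<rho> g ** eigenproj w \<nu>) = (trace (\<rho> g) + trace (\<rho> (g \<otimes> w)) / \<nu>) / 2"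
      by (rule eigenproj_trace[OF C w _ sq \<nu>(1) g]) (rule comm)
    have "trace (\<rho> g ** eigenproj w \<nu>) / \<theta> g
      = trace (\<rho> g) / \<theta> g / of_nat 2 + (trace (\<rho> (g \<otimes> w)) / \<theta> (g \<otimes> w)) * (\<theta> (g \<otimes> w) / (\<theta> g * \<theta> w)) / of_nat 2 * (\<theta> w / \<nu>)"
      using g w mem trace_linesD(2)[of g] trace_linesD(2)[of w] trace_linesD(2)[of "g \<otimes> w"] \<nu>
      by (simp add: tr field_simps)
    then show ?thesis using g w mem
      by (simp only:) (intro adjoinI Fc(5,6,10) trace_linesD(4,5), auto)
  qed
  then show ?thesis unfolding trace_lines_def
    using subfield_adjoin[OF trace_linesD(1) \<delta>] mem trace_linesD(2,3,5) sub by auto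
qed

end

end

section \<open>Dimensions of eigenspaces, central elements and scalar representations\<close>

context matrix_rep
begin

text \<open>The two eigenprojections add up to \<open>\<rho> \<one>\<close> and differ by
  \<open>\<rho> w\<close> divided by \<nu>; \<open>idempotent_trace_nat\<close> makes their traces
  natural numbers. The difference \<open>r1 - r2\<close> decides whether the two halves have the
  same dimension.\<close>

lemma eigenproj_traces:
  assumes w: "w \<in> carrier G" and sq: "\<rho> (w \<otimes> w) = \<nu>\<^sup>2 *k \<rho> \<one>" and \<nu>: "\<nu> \<noteq> 0"
    and r: "trace (\<rho> \<one>) = of_nat r"
  shows "\<exists>r1 r2. trace (\<rho> \<one> ** eigenproj w \<nu>) = of_nat r1 \<and> trace (\<rho> \<one> ** eigenproj w (- \<nu>)) = of_nat r2
     \<and> r1 + r2 = r \<and> of_nat r1 - of_nat r2 = trace (\<rho> w) / \<nu>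
     \<and> (eigenproj w \<nu> \<noteq> 0 \<longrightarrow> r1 > 0) \<and> (eigenproj w (- \<nu>) \<noteq> 0 \<longrightarrow> r2 > 0)"
proof -
  have triv: "subgroup {\<one>} G" by (rule triv_subgroup)
  have comm: "\<rho> (g \<otimes> w) = \<rho> (w \<otimes> g)" if "g \<in> {\<one>}" for g using that w by simp
  have sq': "\<rho> (w \<otimes> w) = (- \<nu>)\<^sup>2 *k \<rho> \<one>" and \<nu>': "- \<nu> \<noteq> 0" using sq \<nu> by simp_all
  have E: "\<rho> \<one> ** eigenproj w \<mu> = eigenproj w \<mu>" for \<mu>
    using w by (simp add: eigenproj_def matrix_add_ldistrib)
  obtain r1 where r1: "trace (eigenproj w \<nu>) = of_nat r1" "eigenproj w \<nu> \<noteq> 0 \<longrightarrow> r1 > 0"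
    using idempotent_trace_nat[OF eigenproj_idem[OF triv w comm sq \<nu>]] by blast
  obtain r2 where r2: "trace (eigenproj w (- \<nu>)) = of_nat r2" "eigenproj w (- \<nu>) \<noteq> 0 \<longrightarrow> r2 > 0"
    using idempotent_trace_nat[OF eigenproj_idem[OF triv w comm sq' \<nu>']] by blast
  have t1: "of_nat r1 = (of_nat r + trace (\<rho> w) / \<nu>) / 2"
    using eigenproj_trace_one[OF triv w comm sq \<nu>] r1 r by (simp add: E)
  have t2: "of_nat r2 = (of_nat r - trace (\<rho> w) / \<nu>) / 2"
    using eigenproj_trace_one[OF triv w comm sq' \<nu>'] r2 r by (simp add: E)
  have "(of_nat (r1 + r2) :: complex) = of_nat r" by (simp add: t1 t2 field_simps)
  then have "r1 + r2 = r" using of_nat_eq_iff by blast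
  moreover have "of_nat r1 - of_nat r2 = trace (\<rho> w) / \<nu>" by (simp add: t1 t2 field_simps)
  ultimately show ?thesis using r1 r2 by (intro exI[of _ r1] exI[of _ r2]) (simp add: E)
qed

text \<open>The preimage of the centre of the image of \<rho>, not the centre of \<open>G\<close>:
  restriction to an eigenspace need not be faithful.\<close>

definition repcenter :: "'a set" where
  "repcenter = {z \<in> carrier G. \<forall>g\<in>carrier G. \<rho> g ** \<rho> z = \<rho> z ** \<rho> g}"

text \<open>Stated for a set \<open>S\<close> because two cases occur: the whole group, for
  \<open>repcenter\<close>, and a single element, for a centraliser.\<close>

lemma commutant_subgroup:
  assumes S: "S \<subseteq> carrier G"
  shows "subgroup {g \<in> carrier G. \<forall>h\<in>S. \<rho> h ** \<rho> g = \<rho> g ** \<rho> h} G"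
proof (rule subgroupI)
  fix a assume a: "a \<in> {g \<in> carrier G. \<forall>h\<in>S. \<rho> h ** \<rho> g = \<rho> g ** \<rho> h}"
  then have aG: "a \<in> carrier G" by simp
  have "\<rho> g ** \<rho> (inv a) = \<rho> (inv a) ** \<rho> g" if g: "g \<in> S" for g
  proof -
    have gG: "g \<in> carrier G" using g S by blast
    have 1: "\<rho> (inv a) ** \<rho> a = \<rho> \<one>" "\<rho> a ** \<rho> (inv a) = \<rho> \<one>"
      using aG rep_mult[of "inv a" a] rep_mult[of a "inv a"] by simp_all
    have "\<rho> g ** \<rho> (inv a) = \<rho> (inv a) ** (\<rho> a ** \<rho> g) ** \<rho> (inv a)"
      using gG aG by (simp add: matrix_mul_assoc 1)
    also have "\<dots> = \<rho> (inv a) ** (\<rho> g ** \<rho> a) ** \<rho> (inv a)" using a g by simp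
    also have "\<dots> = \<rho> (inv a) ** \<rho> g ** (\<rho> a ** \<rho> (inv a))" by (simp only: matrix_mul_assoc)
    also have "\<dots> = \<rho> (inv a) ** \<rho> g" using gG aG by (simp add: 1 flip: matrix_mul_assoc)
    finally show ?thesis .
  qed
  then show "inv a \<in> {g \<in> carrier G. \<forall>h\<in>S. \<rho> h ** \<rho> g = \<rho> g ** \<rho> h}" using aG by simp
next
  fix a b assume ab: "a \<in> {g \<in> carrier G. \<forall>h\<in>S. \<rho> h ** \<rho> g = \<rho> g ** \<rho> h}"
    "b \<in> {g \<in> carrier G. \<forall>h\<in>S. \<rho> h ** \<rho> g = \<rho> g ** \<rho> h}"
  have "\<rho> g ** (\<rho> a ** \<rho> b) = \<rho> a ** \<rho> b ** \<rho> g" if "g \<in> S" for g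
  proof -
    have "\<rho> g ** \<rho> a = \<rho> a ** \<rho> g" "\<rho> g ** \<rho> b = \<rho> b ** \<rho> g" using ab that by blast+
    then show ?thesis by (metis matrix_mul_assoc)
  qed
  moreover have "a \<in> carrier G" "b \<in> carrier G" using ab by blast+
  ultimately show "a \<otimes> b \<in> {g \<in> carrier G. \<forall>h\<in>S. \<rho> h ** \<rho> g = \<rho> g ** \<rho> h}" by (simp add: rep_mult)
next
  have "\<one> \<in> {g \<in> carrier G. \<forall>h\<in>S. \<rho> h ** \<rho> g = \<rho> g ** \<rho> h}" using S by (simp add: subset_iff)
  then show "{g \<in> carrier G. \<forall>h\<in>S. \<rho> h ** \<rho> g = \<rho> g ** \<rho> h} \<noteq> {}" by blast
qed blast

lemma repcenter_subgroup: "subgroup repcenter G"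
  unfolding repcenter_def by (rule commutant_subgroup) simp

lemma repcenter_normal: "repcenter \<lhd> G"
  unfolding normal_inv_iff
proof (intro conjI ballI repcenter_subgroup)
  fix x z assume x: "x \<in> carrier G" and z: "z \<in> repcenter"
  then have zG: "z \<in> carrier G" by (simp add: repcenter_def)
  have "\<rho> (x \<otimes> z \<otimes> inv x) = \<rho> x ** \<rho> z ** \<rho> (inv x)" using x zG by (simp add: rep_mult)
  also have "\<dots> = \<rho> z ** (\<rho> x ** \<rho> (inv x))" using x z by (simp add: repcenter_def matrix_mul_assoc)
  also have "\<dots> = \<rho> z" using x zG by (simp flip: rep_mult)
  finally show "x \<otimes> z \<otimes> inv x \<in> repcenter" using x z zG by (simp add: repcenter_def)
qed

text \<open>Base case of the induction. The scalars \<open>\<nu> g\<close> form a character with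
  values in the 2-power roots of unity, and \<open>\<nu> g\<close> differs from
  \<open>\<theta> g\<close> by a factor in \<open>F\<close>; so the classes of \<theta> modulo
  \<open>F\<close>, which have order at most two, are those of roots of unity. At most one of them
  is nontrivial, and none if everything is real, since then \<open>\<nu> g\<close> is 1 or
  -1.\<close>

lemma scalar_rep_bound:
  assumes order: "order G = 2 ^ k" and tl: "trace_lines G \<rho> F \<theta>"
    and r: "trace (\<rho> \<one>) = of_nat r" and r0: "r > 0"
    and e: "e = 0 \<or> (e = 1 \<and> F \<subseteq> \<real> \<and> \<theta> ` carrier G \<subseteq> \<real>)"
    and card: "2 ^ d * card {g \<in> carrier G. \<theta> g \<in> F} \<le> order G"
    and scal: "\<And>g. g \<in> carrier G \<Longrightarrow> \<exists>c. \<rho> g = c *k \<rho> \<one>"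
  shows "(d + e) div 2 = 0"
proof -
  note tlD = trace_linesD[OF tl]
  note Fc = is_subfieldD[OF tlD(1)]
  let ?P = "\<rho> \<one>"
  let ?K = "{g \<in> carrier G. \<theta> g \<in> F}"
  have fin: "finite (carrier G)" using order order_gt_0_iff_finite by simp
  have P0: "?P \<noteq> 0" using r0 r by (auto simp: trace_def)
  define \<nu> where "\<nu> g = trace (\<rho> g) / of_nat r" for g
  have rho: "\<rho> g = \<nu> g *k ?P" if "g \<in> carrier G" for g
  proof -
    obtain c where "\<rho> g = c *k ?P" using scal[OF \<open>g \<in> carrier G\<close>] by blast
    then show ?thesis using r r0 by (simp add: \<nu>_def)
  qed
  have \<nu>m: "\<nu> (g \<otimes> h) = \<nu> g * \<nu> h" if "g \<in> carrier G" "h \<in> carrier G" for g h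
  proof -
    have "\<rho> (g \<otimes> h) = (\<nu> g * \<nu> h) *k ?P" using that rho[OF that(1)] rho[OF that(2)]
      by (metis rep_mult cscale_simps(1,2,3) rep_one(1) one_closed mult.commute)
    then show ?thesis using r r0 by (simp add: \<nu>_def)
  qed
  have \<nu>0: "\<nu> g \<noteq> 0" if "g \<in> carrier G" for g
    using rho[OF that] rep_nonzero[OF that P0] by auto
  have \<nu>1: "\<nu> \<one> = 1" using r r0 by (simp add: \<nu>_def)
  have \<nu>pow: "\<nu> (g [^] (j::nat)) = \<nu> g ^ j" if "g \<in> carrier G" for g j
    by (induction j) (use that in \<open>simp_all add: \<nu>1 \<nu>m\<close>)
  have root: "\<nu> g ^ (2 ^ k) = 1" if "g \<in> carrier G" for g
    using pow_order_eq_1[OF that] \<nu>pow[OF that, of "2 ^ k"] order by (simp add: \<nu>1)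
  have q: "\<nu> g / \<theta> g \<in> F" if "g \<in> carrier G" for g
  proof -
    have "\<nu> g / \<theta> g = trace (\<rho> g) / \<theta> g / of_nat r" by (simp add: \<nu>_def)
    then show ?thesis using tlD(4)[OF that] Fc(6,10) by metis
  qed
  have iff: "\<theta> g \<in> F \<longleftrightarrow> \<nu> g \<in> F" if "g \<in> carrier G" for g
  proof -
    have "\<nu> g = \<nu> g / \<theta> g * \<theta> g" "\<theta> g = \<nu> g / (\<nu> g / \<theta> g)" using \<nu>0[OF that] tlD(2)[OF that] by simp_all
    then show ?thesis using q[OF that] Fc(5,6) by metis
  qed
  show ?thesis
  proof (cases "e = 0")
    case True
    have GK: "card (carrier G) \<le> 2 * card ?K"
    proof (rule card_le_twice)
      fix g h assume gh: "g \<in> carrier G - ?K" "h \<in> carrier G - ?K"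
      have sq: "(\<nu> g)\<^sup>2 \<in> F" if "g \<in> carrier G" for g
      proof -
        have "(\<nu> g)\<^sup>2 = (\<nu> g / \<theta> g)\<^sup>2 * (\<theta> g)\<^sup>2" using tlD(2)[OF that] by (simp add: power_divide)
        then show ?thesis using q[OF that] tlD(3)[OF that] Fc(5,9) by metis
      qed
      have "\<nu> g * \<nu> h \<in> F"
        by (rule roots_of_unity_mod_subfield[OF tlD(1) root root]) (use gh sq iff in auto)
      then show "g \<otimes> h \<in> ?K" using gh iff[of "g \<otimes> h"] by (simp add: \<nu>m)
    qed (use fin in auto)
    have "2 ^ d * card (carrier G) \<le> 2 ^ d * (2 * card ?K)" by (rule mult_le_mono2[OF GK])
    also have "\<dots> = 2 * (2 ^ d * card ?K)" by simp
    also have "\<dots> \<le> 2 * card (carrier G)" using card by (simp add: order_def)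
    finally have "2 ^ d * card (carrier G) \<le> 2 * card (carrier G)" .
    moreover have "card (carrier G) > 0" using order by (simp add: order_def)
    ultimately have "(2::nat) ^ d \<le> 2 ^ 1" by simp
    then have "d \<le> 1" using power_increasing_iff[of "2::nat" d 1] by simp
    then show ?thesis using True by simp
  next
    case False
    then have re: "e = 1" "F \<subseteq> \<real>" "\<theta> ` carrier G \<subseteq> \<real>" using e by auto
    have "\<theta> g \<in> F" if g: "g \<in> carrier G" for g
    proof -
      have "\<nu> g = \<nu> g / \<theta> g * \<theta> g" using tlD(2)[OF g] by simp
      then have "\<nu> g \<in> \<real>" using q[OF g] re g by (metis Reals_mult image_subset_iff subsetD)
      then obtain x where x: "\<nu> g = of_real x" by (auto elim: Reals_cases)
      have "x ^ (2 ^ k) = 1" using root[OF g] by (simp add: x flip: of_real_power)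
      then have "\<bar>x\<bar> ^ (2 ^ k) = 1 ^ (2 ^ k)" by (simp flip: power_abs)
      then have "\<bar>x\<bar> = 1" by (rule power_eq_imp_eq_base) auto
      then have "x = 1 \<or> x = - 1" by linarith
      then have "\<nu> g \<in> F" using x Fc(2,7) by auto
      then show ?thesis using iff[OF g] by simp
    qed
    then have "?K = carrier G" by blast
    then have "2 ^ d * card (carrier G) \<le> 1 * card (carrier G)" using card by (simp add: order_def)
    moreover have "card (carrier G) > 0" using order by (simp add: order_def)
    ultimately have "(2::nat) ^ d \<le> 1" by simp
    then have "d = 0" using power_increasing_iff[of "2::nat" d 0] by simp
    then show ?thesis using re by simp
  qed
qed

text \<open>Modulo \<open>repcenter\<close> there is a nontrivial central element, and its
  commutators act as scalars. Squaring it until the next square lies in \<open>repcenter\<close>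
  forces each such scalar \<open>c\<close> to satisfy \<open>c * c = 1\<close>.\<close>

lemma noncentral_element:
  assumes order: "order G = 2 ^ k" and P0: "\<rho> \<one> \<noteq> 0"
    and scal: "\<And>z. z \<in> repcenter \<Longrightarrow> \<exists>c. \<rho> z = c *k \<rho> \<one>" and noncomm: "repcenter \<noteq> carrier G"
  shows "\<exists>x\<in>carrier G. x \<notin> repcenter \<and> x \<otimes> x \<in> repcenter \<and>
    (\<forall>g\<in>carrier G. \<rho> g ** \<rho> x = \<rho> x ** \<rho> g \<or> \<rho> g ** \<rho> x = (- 1) *k (\<rho> x ** \<rho> g))"
proof -
  have central: "\<rho> (g \<otimes> z) = \<rho> (z \<otimes> g)" if "g \<in> carrier G" "z \<in> repcenter" for g z
    using that by (simp add: repcenter_def rep_mult)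
  have Zsub: "repcenter \<subseteq> carrier G" by (auto simp: repcenter_def)
  \<comment> \<open>Elements that commute with the whole group up to a scalar. The set is closed
    under squaring, so the last square outside \<open>repcenter\<close> can be chosen inside
    it.\<close>
  define S where "S = {x \<in> carrier G. \<forall>g\<in>carrier G. \<exists>c. \<rho> (g \<otimes> x) = c *k \<rho> (x \<otimes> g)}"
  have S_sq: "y \<otimes> y \<in> S" if y: "y \<in> S" for y
  proof -
    have "\<exists>c. \<rho> (g \<otimes> (y \<otimes> y)) = c *k \<rho> (y \<otimes> y \<otimes> g)" if g: "g \<in> carrier G" for g
    proof -
      obtain c where c: "\<rho> (g \<otimes> y) = c *k \<rho> (y \<otimes> g)" using y g by (auto simp: S_def)
      have yG: "y \<in> carrier G" using y by (simp add: S_def)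
      have "\<rho> (g \<otimes> (y \<otimes> y)) = \<rho> (g \<otimes> y) ** \<rho> y" using g yG by (simp add: rep_mult matrix_mul_assoc)
      also have "\<dots> = (c *k \<rho> (y \<otimes> g)) ** \<rho> y" by (simp only: c)
      also have "\<dots> = c *k (\<rho> y ** \<rho> (g \<otimes> y))" using g yG by (simp add: rep_mult matrix_mul_assoc)
      also have "\<dots> = (c * c) *k \<rho> (y \<otimes> y \<otimes> g)" using g yG by (simp add: c) (simp add: rep_mult matrix_mul_assoc)
      finally show ?thesis by blast
    qed
    then show ?thesis using y by (simp add: S_def)
  qed
  obtain x0 where x0: "x0 \<in> carrier G - repcenter"
    "\<And>g. g \<in> carrier G \<Longrightarrow> \<exists>z\<in>repcenter. g \<otimes> x0 = z \<otimes> x0 \<otimes> g"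
    using normal.two_group_central_mod[OF repcenter_normal order noncomm] by blast
  have "x0 \<in> S"
  proof -
    have "\<exists>c. \<rho> (g \<otimes> x0) = c *k \<rho> (x0 \<otimes> g)" if g: "g \<in> carrier G" for g
    proof -
      obtain z where z: "z \<in> repcenter" "g \<otimes> x0 = z \<otimes> x0 \<otimes> g" using x0(2)[OF g] by blast
      obtain c where c: "\<rho> z = c *k \<rho> \<one>" using scal[OF z(1)] by blast
      have "\<rho> (g \<otimes> x0) = \<rho> z ** \<rho> (x0 \<otimes> g)" using z x0(1) g Zsub
        by (simp add: m_assoc subset_iff rep_mult)
      then show ?thesis using c x0(1) g by auto
    qed
    then show ?thesis using x0(1) by (simp add: S_def)
  qed
  moreover have "S \<subseteq> carrier G" by (auto simp: S_def)
  ultimately obtain x where x: "x \<in> S" "x \<notin> repcenter" "x \<otimes> x \<in> repcenter"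
    using two_group_last_square[OF order _ _ S_sq, where P = "\<lambda>x. x \<in> repcenter"]
      x0(1) subgroup.one_closed[OF repcenter_subgroup] by blast
  have xG: "x \<in> carrier G" using x by (simp add: S_def)
  have "\<rho> g ** \<rho> x = \<rho> x ** \<rho> g \<or> \<rho> g ** \<rho> x = (- 1) *k (\<rho> x ** \<rho> g)" if g: "g \<in> carrier G" for g
  proof -
    obtain c where c: "\<rho> g ** \<rho> x = c *k (\<rho> x ** \<rho> g)" using x(1) g xG
      by (auto simp: S_def rep_mult)
    \<comment> \<open>Moving \<open>g\<close> past \<open>x\<close> twice multiplies by
      \<open>c * c\<close>, whereas \<open>x \<otimes> x\<close> commutes with \<open>g\<close>
      under \<rho>.\<close>
    have "\<rho> (x \<otimes> x \<otimes> g) = \<rho> (g \<otimes> (x \<otimes> x))" by (rule central[OF g x(3), symmetric])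
    also have "\<dots> = (\<rho> g ** \<rho> x) ** \<rho> x" using g xG by (simp add: rep_mult matrix_mul_assoc)
    also have "\<dots> = (c *k (\<rho> x ** \<rho> g)) ** \<rho> x" by (simp only: c)
    also have "\<dots> = c *k (\<rho> x ** (\<rho> g ** \<rho> x))" by (simp add: matrix_mul_assoc)
    also have "\<dots> = (c * c) *k \<rho> (x \<otimes> x \<otimes> g)" using g xG by (simp add: c) (simp add: rep_mult matrix_mul_assoc)
    finally have "(1 - c * c) *k \<rho> (x \<otimes> x \<otimes> g) = 0" by (simp add: cscale_def vec_eq_iff algebra_simps)
    moreover have "\<rho> (x \<otimes> x \<otimes> g) \<noteq> 0" using rep_nonzero[OF _ P0] g xG by simp
    ultimately have "c * c = 1" by simp
    then have "c = 1 \<or> c = - 1" by (simp add: square_eq_1_iff)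
    then show ?thesis using c by auto
  qed
  then show ?thesis using x xG by blast
qed

text \<open>Conjugation by \<open>y\<close> turns \<open>\<rho> x\<close> into its negative and
  preserves the trace.\<close>

lemma trace_anticommuting:
  assumes xG: "x \<in> carrier G" and y: "y \<in> carrier G" "\<rho> y ** \<rho> x = (- 1) *k (\<rho> x ** \<rho> y)"
  shows "trace (\<rho> x) = 0"
proof -
  have "\<rho> (inv y) ** (\<rho> y ** \<rho> x) = \<rho> (inv y \<otimes> y) ** \<rho> x"
    using y(1) xG rep_mult[of "inv y" y] by (simp add: matrix_mul_assoc)
  then have "\<rho> x = (- 1) *k (\<rho> (inv y) ** (\<rho> x ** \<rho> y))" using y xG by simp
  then have "trace (\<rho> x) = trace ((- 1) *k (\<rho> (inv y) ** (\<rho> x ** \<rho> y)))" by (rule arg_cong)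
  then have "trace (\<rho> x) = - trace (\<rho> (inv y) ** (\<rho> x ** \<rho> y))" by simp
  also have "trace (\<rho> (inv y) ** (\<rho> x ** \<rho> y)) = trace (\<rho> x ** (\<rho> y ** \<rho> (inv y)))"
    by (subst trace_mul_sym) (simp add: matrix_mul_assoc)
  also have "\<rho> x ** (\<rho> y ** \<rho> (inv y)) = \<rho> x" using y xG by (simp flip: rep_mult)
  finally show ?thesis by simp
qed

end

section \<open>The divisibility bound for representations of 2-groups\<close>

lemma pow2_half_le: "d \<ge> 1 \<Longrightarrow> 2 ^ d * (x::nat) \<le> y \<Longrightarrow> x' \<le> 2 * x \<Longrightarrow> 2 ^ (d - 1) * x' \<le> y"
  by (cases d) (auto intro: order.trans[OF mult_le_mono2])

text \<open>\<open>IH\<close> is a premise because the locale fixes \<open>G\<close> and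
  \<open>\<rho>\<close>, whereas the step passes to a subgroup and another representation. The
  measure decreases through \<open>r\<close>, since only proper eigenspaces are used. Either both
  parts inherit \<open>d\<close> and \<open>e\<close>, or they have equal dimension and
  \<open>d + e\<close> drops by at most two: by two units of \<open>d\<close>, or by one unit of
  \<open>d\<close> and the reality flag \<open>e\<close>.\<close>

lemma (in matrix_rep) two_group_degree_step:
  assumes IH: "\<And>(G' :: 'a monoid) (\<rho>' :: 'a \<Rightarrow> complex ^ 'n ^ 'n) F' e' d' k' r'.
      order G' + r' < order G + r \<Longrightarrow> matrix_rep G' \<rho>' \<Longrightarrow> order G' = 2 ^ k' \<Longrightarrow> trace_lines G' \<rho>' F' \<theta> \<Longrightarrow>
      trace (\<rho>' \<one>\<^bsub>G'\<^esub>) = of_nat r' \<Longrightarrow> e' = 0 \<or> (e' = 1 \<and> F' \<subseteq> \<real> \<and> \<theta> ` carrier G' \<subseteq> \<real>) \<Longrightarrow>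
      2 ^ d' * card {g \<in> carrier G'. \<theta> g \<in> F'} \<le> order G' \<Longrightarrow> 2 ^ ((d' + e') div 2) dvd r'"
    and order: "order G = 2 ^ k" and tl: "trace_lines G \<rho> F \<theta>"
    and r: "trace (\<rho> \<one>) = of_nat r" and e: "e = 0 \<or> (e = 1 \<and> F \<subseteq> \<real> \<and> \<theta> ` carrier G \<subseteq> \<real>)"
    and card: "2 ^ d * card {g \<in> carrier G. \<theta> g \<in> F} \<le> order G"
  shows "2 ^ ((d + e) div 2) dvd r"
proof -
  note tlD = trace_linesD[OF tl]
  note Fc = is_subfieldD[OF tlD(1)]
  let ?P = "\<rho> \<one>"
  let ?K = "{g \<in> carrier G. \<theta> g \<in> F}"
  have fin: "finite (carrier G)" using order order_gt_0_iff_finite by simp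
  have e1: "e \<le> 1" using e by auto
  have P0: "?P \<noteq> 0" if "r > 0" using that r by (auto simp: trace_def)
  define scal where "scal g \<longleftrightarrow> (\<exists>c. \<rho> g = c *k ?P)" for g
  have step: "2 ^ ((d' + e') div 2) dvd r'"
    if C: "subgroup C G" and w: "w \<in> carrier G" and comm: "\<And>g. g \<in> C \<Longrightarrow> \<rho> (g \<otimes> w) = \<rho> (w \<otimes> g)"
      and sq: "\<rho> (w \<otimes> w) = \<nu>\<^sup>2 *k ?P" and \<nu>: "\<nu> \<noteq> 0" and r': "trace (?P ** eigenproj w \<nu>) = of_nat r'"
      and less': "r' < r" and e': "e' = 0 \<or> (e' = 1 \<and> adjoin F (\<theta> w / \<nu>) \<subseteq> \<real> \<and> \<theta> ` C \<subseteq> \<real>)"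
      and card': "2 ^ d' * card {g \<in> C. \<theta> g \<in> adjoin F (\<theta> w / \<nu>)} \<le> card C"
    for C w \<nu> r' e' d'
  proof -
    have "\<nu>\<^sup>2 \<in> F" by (rule square_scalar_in_field[OF tl w sq r]) (use less' in simp)
    obtain k' where k': "card C = 2 ^ k'"
    proof -
      have "card C dvd 2 ^ k" using lagrange[OF C] order by (metis dvd_triv_right)
      then show thesis using divides_primepow_nat[OF two_is_prime_nat] that by blast
    qed
    have "card C \<le> order G" unfolding order_def using fin subgroup.subset[OF C] by (rule card_mono)
    show ?thesis
    proof (rule IH[OF _ eigenproj_rep[OF C w comm sq \<nu>] _ trace_lines_eigenproj[OF tl C w comm sq \<nu> \<open>\<nu>\<^sup>2 \<in> F\<close>]])
      show "order (G\<lparr>carrier := C\<rparr>) + r' < order G + r"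
        using \<open>card C \<le> order G\<close> less' by (simp add: order_def)
      show "order (G\<lparr>carrier := C\<rparr>) = 2 ^ k'" using k' by (simp add: order_def)
    qed (use r' e' card' in \<open>simp_all add: order_def\<close>)
  qed
  show ?thesis
  proof (cases "r = 0")
    case False
    then have r0: "r > 0" by simp
    note P0 = P0[OF r0]
    have get_sqrt: "\<exists>\<nu>. \<nu> \<noteq> 0 \<and> \<rho> (w \<otimes> w) = \<nu>\<^sup>2 *k ?P \<and> \<nu>\<^sup>2 \<in> F \<and> (\<theta> w / \<nu>)\<^sup>2 \<in> F \<and> \<theta> w / \<nu> \<noteq> 0"
      if w: "w \<in> carrier G" and s: "scal (w \<otimes> w)" for w
    proof -
      obtain \<mu> where \<mu>: "\<rho> (w \<otimes> w) = \<mu> *k ?P" using s by (auto simp: scal_def)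
      have "\<mu> \<noteq> 0" using \<mu> rep_nonzero[OF _ P0, of "w \<otimes> w"] w by auto
      have "\<mu> \<in> F" by (rule square_scalar_in_field[OF tl w \<mu> r r0])
      then have "(\<theta> w / csqrt \<mu>)\<^sup>2 \<in> F" using w by (simp add: power_divide Fc(6) tlD(3))
      then show ?thesis using \<mu> \<open>\<mu> \<noteq> 0\<close> \<open>\<mu> \<in> F\<close> tlD(2)[OF w] by (intro exI[of _ "csqrt \<mu>"]) simp
    qed
    have central: "\<rho> (g \<otimes> z) = \<rho> (z \<otimes> g)" if "g \<in> carrier G" "z \<in> repcenter" for g z
      using that by (simp add: repcenter_def rep_mult)
    have Zsub: "repcenter \<subseteq> carrier G" by (auto simp: repcenter_def)
    have one_scal: "scal \<one>" unfolding scal_def by (intro exI[of _ 1]) simp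
    show ?thesis
    proof (cases "\<exists>z\<in>repcenter. \<not> scal z")
      case True
      then obtain z where z: "z \<in> repcenter" "\<not> scal z" by blast
      \<comment> \<open>An element that commutes with everything under \<rho> and is not scalar,
        while its square is: both eigenspaces are proper and stable under the whole group.\<close>
      obtain w where wZ: "w \<in> repcenter" "\<not> scal w" "scal (w \<otimes> w)"
        using two_group_last_square[OF order z(1) Zsub subgroup.m_closed[OF repcenter_subgroup], where P = scal]
          one_scal z(2) by blast
      have w: "w \<in> carrier G" using wZ Zsub by blast
      note comm = central[OF _ wZ(1)]
      obtain \<nu> where \<nu>: "\<nu> \<noteq> 0" "\<rho> (w \<otimes> w) = \<nu>\<^sup>2 *k ?P" "\<nu>\<^sup>2 \<in> F" "(\<theta> w / \<nu>)\<^sup>2 \<in> F" "\<theta> w / \<nu> \<noteq> 0"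
        using get_sqrt[OF w wZ(3)] by blast
      have \<nu>': "- \<nu> \<noteq> 0" "\<rho> (w \<otimes> w) = (- \<nu>)\<^sup>2 *k ?P" using \<nu> by simp_all
      obtain r1 r2 where r12: "trace (?P ** eigenproj w \<nu>) = of_nat r1"
        "trace (?P ** eigenproj w (- \<nu>)) = of_nat r2" "r1 + r2 = r"
        "of_nat r1 - of_nat r2 = trace (\<rho> w) / \<nu>"
        "eigenproj w \<nu> \<noteq> 0 \<longrightarrow> r1 > 0" "eigenproj w (- \<nu>) \<noteq> 0 \<longrightarrow> r2 > 0"
        using eigenproj_traces[OF w \<nu>(2,1) r] by blast
      have "eigenproj w \<mu> \<noteq> 0" if "\<mu> \<noteq> 0" for \<mu>
      proof
        assume 0: "eigenproj w \<mu> = 0"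
        have "\<rho> w = (- \<mu>) *k ?P"
          using 0 that by (auto simp: eigenproj_def cscale_def vec_eq_iff field_simps eq_neg_iff_add_eq_0)
        then show False using wZ(2) by (auto simp: scal_def)
      qed
      then have pos: "r1 > 0" "r2 > 0" using r12 \<nu> by auto
      show ?thesis
      proof (cases "\<theta> w / \<nu> \<in> F")
        case True
        have adj: "adjoin F (\<theta> w / \<nu>) = F" by (rule adjoin_self[OF tlD(1) \<nu>(4) True])
        have True': "\<theta> w / (- \<nu>) \<in> F" using Fc(7)[OF True] by simp
        have adj': "adjoin F (\<theta> w / (- \<nu>)) = F" by (rule adjoin_self[OF tlD(1) _ True']) (use \<nu>(4) in simp)
        \<comment> \<open>Neither the field nor the group changes, so both parts inherit the bound
          although their dimensions may differ.\<close>
        have "2 ^ ((d + e) div 2) dvd r1"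
          by (rule step[OF subgroup_self w comm \<nu>(2,1) r12(1)])
            (use pos r12(3) e card in \<open>simp_all add: adj order_def\<close>)
        moreover have "2 ^ ((d + e) div 2) dvd r2"
          by (rule step[OF subgroup_self w comm \<nu>'(2,1) r12(2)])
            (use pos r12(3) e card adj' in \<open>simp_all add: order_def\<close>)
        ultimately show ?thesis using r12(3) by (metis dvd_add)
      next
        case False
        have "trace (\<rho> w) / \<theta> w \<in> F" by (rule tlD(4)[OF w])
        moreover have "trace (\<rho> w) / \<theta> w = (of_nat r1 - of_nat r2) / (\<theta> w / \<nu>)"
          using r12(4) \<nu>(1) by simp
        ultimately have q: "(of_nat r1 - of_nat r2) / (\<theta> w / \<nu>) \<in> F" by simp
        \<comment> \<open>Otherwise \<open>\<theta> w / \<nu>\<close> would be a quotient of two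
          elements of \<open>F\<close>, contrary to the case assumption.\<close>
        have "r1 = r2"
        proof (rule ccontr)
          assume "r1 \<noteq> r2"
          then have "(of_nat r1 - of_nat r2 :: complex) \<noteq> 0" by simp
          then have "\<theta> w / \<nu> = (of_nat r1 - of_nat r2) / ((of_nat r1 - of_nat r2) / (\<theta> w / \<nu>))"
            by simp
          also have "\<dots> \<in> F" by (intro Fc(6) Fc(4) Fc(10) q)
          finally show False using False by simp
        qed
        then have rr: "r = 2 * r1" using r12(3) by simp
        have cK: "card {g \<in> carrier G. \<theta> g \<in> adjoin F (\<theta> w / \<nu>)} \<le> 2 * card ?K"
          by (rule card_theta_adjoin[OF tl fin _ \<nu>(4,5)]) simp
        have "2 ^ (d - 1) * card {g \<in> carrier G. \<theta> g \<in> adjoin F (\<theta> w / \<nu>)} \<le> card (carrier G)"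
        proof (cases "d = 0")
          case True
          then show ?thesis using fin by (auto intro: card_mono)
        next
          case False
          then show ?thesis using pow2_half_le[OF _ card cK] by (simp add: order_def)
        qed
        \<comment> \<open>The new field may fail to be real, so the flag is given up. For
          \<open>d = 0\<close> the truncated subtraction is harmless because
          \<open>e \<le> 1\<close>.\<close>
        then have "2 ^ ((d - 1 + 0) div 2) dvd r1"
          by (intro step[OF subgroup_self w comm \<nu>(2,1) r12(1)]) (use pos rr in auto)
        then have "2 ^ Suc ((d - 1) div 2) dvd r" using rr by simp
        moreover have "(d + e) div 2 \<le> Suc ((d - 1) div 2)" using e1 by linarith
        ultimately show ?thesis using power_le_dvd by blast
      qed
    next
      case False
      then have Zscal: "scal z" if "z \<in> repcenter" for z using that by blast
      show ?thesis
      proof (cases "repcenter = carrier G")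
        case True
        then have "\<exists>c. \<rho> g = c *k ?P" if "g \<in> carrier G" for g using Zscal that unfolding scal_def by blast
        then have "(d + e) div 2 = 0" by (rule scalar_rep_bound[OF order tl r r0 e card])
        then show ?thesis by simp
      next
        case noncomm: False
        obtain x where x: "x \<in> carrier G" "x \<notin> repcenter" "x \<otimes> x \<in> repcenter"
          and pm: "\<And>g. g \<in> carrier G \<Longrightarrow> \<rho> g ** \<rho> x = \<rho> x ** \<rho> g \<or> \<rho> g ** \<rho> x = (- 1) *k (\<rho> x ** \<rho> g)"
          using noncentral_element[OF order P0 _ noncomm] Zscal unfolding scal_def by blast
        note xG = x(1)
        obtain \<nu> where \<nu>: "\<nu> \<noteq> 0" "\<rho> (x \<otimes> x) = \<nu>\<^sup>2 *k ?P" "\<nu>\<^sup>2 \<in> F" "(\<theta> x / \<nu>)\<^sup>2 \<in> F" "\<theta> x / \<nu> \<noteq> 0"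
          using get_sqrt[OF xG Zscal[OF x(3)]] by blast
        define C where "C = {g \<in> carrier G. \<rho> g ** \<rho> x = \<rho> x ** \<rho> g}"
        have CG: "C \<subseteq> carrier G" by (auto simp: C_def)
        have "subgroup {g \<in> carrier G. \<forall>h\<in>{x}. \<rho> h ** \<rho> g = \<rho> g ** \<rho> h} G"
          by (rule commutant_subgroup) (use xG in simp)
        moreover have "C = {g \<in> carrier G. \<forall>h\<in>{x}. \<rho> h ** \<rho> g = \<rho> g ** \<rho> h}"
          by (auto simp: C_def)
        ultimately have C: "subgroup C G" by (simp only:)
        have comm: "\<rho> (g \<otimes> x) = \<rho> (x \<otimes> g)" if "g \<in> C" for g
          using that xG by (simp add: C_def rep_mult)
        have cC: "order G \<le> 2 * card C" unfolding order_def
        proof (rule card_le_twice)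
          fix g h assume gh: "g \<in> carrier G - C" "h \<in> carrier G - C"
          then have *: "\<rho> g ** \<rho> x = (- 1) *k (\<rho> x ** \<rho> g)" "\<rho> h ** \<rho> x = (- 1) *k (\<rho> x ** \<rho> h)"
            using pm by (auto simp: C_def)
          have "\<rho> g ** \<rho> h ** \<rho> x = \<rho> g ** (\<rho> h ** \<rho> x)" by (simp add: matrix_mul_assoc)
          also have "\<dots> = (- 1) *k ((\<rho> g ** \<rho> x) ** \<rho> h)" by (simp add: *(2) matrix_mul_assoc)
          also have "\<dots> = \<rho> x ** (\<rho> g ** \<rho> h)" by (simp add: *(1) matrix_mul_assoc)
          finally show "g \<otimes> h \<in> C" using gh by (simp add: C_def rep_mult)
        qed (use fin CG finite_subset in auto)
        obtain y where y: "y \<in> carrier G" "\<rho> y ** \<rho> x = (- 1) *k (\<rho> x ** \<rho> y)"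
          using pm x(2) xG by (auto simp: repcenter_def)
        have trx: "trace (\<rho> x) = 0" by (rule trace_anticommuting[OF xG y])
        obtain r1 r2 where r12: "trace (?P ** eigenproj x \<nu>) = of_nat r1" "r1 + r2 = r"
          "of_nat r1 - of_nat r2 = trace (\<rho> x) / \<nu>"
          using eigenproj_traces[OF xG \<nu>(2,1) r] by blast
        have "r1 = r2" using r12(3) trx by simp
        then have rr: "r = 2 * r1" "r1 < r" using r12 r0 by auto
        let ?K' = "{g \<in> C. \<theta> g \<in> adjoin F (\<theta> x / \<nu>)}"
        have K'C: "card ?K' \<le> card C" using fin CG finite_subset by (intro card_mono) auto
        show ?thesis
        \<comment> \<open>If the flag can be kept, up to two generators are lost, one to the index
          of \<open>C\<close> and one to the field. If not, a nonreal
          \<open>\<theta> x / \<nu>\<close> adds no real numbers to the real field \<open>F\<close>,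
          so only the index of \<open>C\<close> costs a generator, and the flag is the second
          unit.\<close>
        proof (cases "e = 0 \<or> \<theta> x / \<nu> \<in> \<real>")
          case True
          have cK: "card ?K' \<le> 2 * card ?K"
            by (rule card_theta_adjoin[OF tl fin CG \<nu>(4,5)])
          have "2 ^ (d - 2) * card ?K' \<le> card C"
          proof (cases "d < 2")
            case True
            then show ?thesis using K'C by simp
          next
            case False
            then obtain d2 where d2: "d = Suc (Suc d2)" by (metis add_2_eq_Suc le_Suc_ex not_less)
            have "2 ^ d2 * card ?K' \<le> 2 ^ d2 * (2 * card ?K)" using cK by (rule mult_le_mono2)
            moreover have "4 * (2 ^ d2 * card ?K) \<le> 2 * card C" using card cC d2 by simp
            ultimately have "2 ^ d2 * card ?K' \<le> card C" by linarith
            then show ?thesis using d2 by simp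
          qed
          moreover have "e = 0 \<or> (e = 1 \<and> adjoin F (\<theta> x / \<nu>) \<subseteq> \<real> \<and> \<theta> ` C \<subseteq> \<real>)"
            using True e CG unfolding adjoin_def by (auto intro!: Reals_add Reals_mult simp del: times_divide_eq_right)
          ultimately have "2 ^ ((d - 2 + e) div 2) dvd r1"
            by (intro step[OF C xG comm \<nu>(2,1) r12(1) rr(2)])
          then have "2 ^ Suc ((d - 2 + e) div 2) dvd r" using rr by simp
          moreover have "(d + e) div 2 \<le> Suc ((d - 2 + e) div 2)" using e1 by linarith
          ultimately show ?thesis using power_le_dvd by blast
        next
          case False
          then have re: "e = 1" "F \<subseteq> \<real>" "\<theta> ` carrier G \<subseteq> \<real>" "\<theta> x / \<nu> \<notin> \<real>" using e by auto
          have "?K' \<subseteq> ?K"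
          proof
            fix g assume g: "g \<in> ?K'"
            then obtain a b where ab: "a \<in> F" "b \<in> F" "\<theta> g = a + b * (\<theta> x / \<nu>)"
              unfolding adjoin_def by blast
            have "b = 0"
            proof (rule ccontr)
              assume "b \<noteq> 0"
              then have "\<theta> x / \<nu> = (\<theta> g - a) / b" using ab by simp
              also have "\<dots> \<in> \<real>"
              proof (intro Reals_divide Reals_diff)
                show "\<theta> g \<in> \<real>" using re(3) g CG by blast
              qed (use ab re(2) in blast)+
              finally show False using re by simp
            qed
            then show "g \<in> ?K" using g CG ab by auto
          qed
          then have cK: "card ?K' \<le> card ?K" using fin by (intro card_mono) auto
          have "2 ^ (d - 1) * card ?K' \<le> card C"
          proof (cases d)
            case 0
            then show ?thesis using K'C by simp
          next
            case (Suc d1)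
            have "2 ^ d1 * card ?K' \<le> 2 ^ d1 * card ?K" using cK by (rule mult_le_mono2)
            moreover have "2 * (2 ^ d1 * card ?K) \<le> 2 * card C" using card cC Suc by simp
            ultimately have "2 ^ d1 * card ?K' \<le> card C" by linarith
            then show ?thesis using Suc by simp
          qed
          then have "2 ^ ((d - 1 + 0) div 2) dvd r1"
            by (intro step[OF C xG comm \<nu>(2,1) r12(1) rr(2)]) auto
          then have "2 ^ Suc ((d - 1) div 2) dvd r" using rr by simp
          moreover have "(d + e) div 2 \<le> Suc ((d - 1) div 2)" using e1 by linarith
          ultimately show ?thesis using power_le_dvd by blast
        qed
      qed
    qed
  qed simp
qed

theorem two_group_degree:
  fixes \<rho> :: "'a \<Rightarrow> complex ^ 'n ^ 'n" and G :: "'a monoid"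
  assumes "matrix_rep G \<rho>" "order G = 2 ^ k" "trace_lines G \<rho> F \<theta>"
    "trace (\<rho> \<one>\<^bsub>G\<^esub>) = of_nat r" "e = 0 \<or> (e = 1 \<and> F \<subseteq> \<real> \<and> \<theta> ` carrier G \<subseteq> \<real>)"
    "2 ^ d * card {g \<in> carrier G. \<theta> g \<in> F} \<le> order G"
  shows "2 ^ ((d + e) div 2) dvd r"
  using assms
proof (induction "order G + r" arbitrary: G \<rho> F e d k r rule: less_induct)
  case less
  show ?case
    by (rule matrix_rep.two_group_degree_step[OF less.prems(1) less.hyps less.prems(2-)])
qed

section \<open>Lattices and their duals\<close>

definition int_vectors :: "(real ^ 'n) set" where
  "int_vectors = {x. \<forall>i. x $ i \<in> \<int>}"

text \<open>Replaces a basis given as a set of vectors by an invertible matrix, after which duals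
  and levels are matrix computations.\<close>

lemma lattice_in_matrix:
  assumes "lattice_in (L :: (real ^ 'n) set)"
  obtains M N :: "real ^ 'n ^ 'n" where "M ** N = mat 1" "N ** M = mat 1" "L = (*v) M ` int_vectors"
proof -
  obtain B where B: "independent B" "span B = UNIV"
    "L = {\<Sum>b\<in>B. of_int (c b) *\<^sub>R b | c :: real ^ 'n \<Rightarrow> int. True}"
    using assms unfolding lattice_in_def by blast
  have finB: "finite B" using B(1) by (rule independent_imp_finite)
  have "card B = CARD('n)"
    using B(1,2) by (metis dim_eq_card_independent dim_span dim_UNIV DIM_cart DIM_real mult.right_neutral)
  then obtain f :: "'n \<Rightarrow> real ^ 'n" where f: "bij_betw f UNIV B"
    using finite_same_card_bij[of "UNIV :: 'n set" B] finB by auto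
  define M where "M = (\<chi> i j. f j $ i)"
  have col: "column j M = f j" for j by (simp add: M_def column_def vec_eq_iff)
  have Mx: "M *v x = (\<Sum>j\<in>UNIV. x $ j *\<^sub>R f j)" for x
    by (simp add: matrix_mult_sum col scalar_mult_eq_scaleR)
  have "columns M = B" using f by (auto simp: columns_def col bij_betw_def)
  then have "\<exists>N. M ** N = mat 1"
    using B(2) by (simp add: matrix_right_invertible_span_columns span_vec_eq)
  then obtain N where N: "M ** N = mat 1" by blast
  then have "N ** M = mat 1" by (simp add: matrix_left_right_inverse)
  moreover have "L = (*v) M ` int_vectors"
  proof (intro equalityI subsetI)
    fix x assume "x \<in> L"
    then obtain c :: "real ^ 'n \<Rightarrow> int" where "x = (\<Sum>b\<in>B. of_int (c b) *\<^sub>R b)" using B(3) by blast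
    also have "\<dots> = (\<Sum>j\<in>UNIV. of_int (c (f j)) *\<^sub>R f j)" by (rule sum.reindex_bij_betw[OF f, symmetric])
    also have "\<dots> = M *v (\<chi> j. of_int (c (f j)))" by (simp add: Mx)
    finally show "x \<in> (*v) M ` int_vectors" by (auto simp: int_vectors_def)
  next
    fix x assume "x \<in> (*v) M ` int_vectors"
    then obtain z where z: "x = M *v z" "z \<in> int_vectors" by blast
    define c where "c b = \<lfloor>z $ (inv_into UNIV f b)\<rfloor>" for b
    have "of_int (c (f j)) = z $ j" for j
      using z(2) f by (simp add: c_def int_vectors_def bij_betw_def inv_into_f_f)
    then have "x = (\<Sum>j\<in>UNIV. of_int (c (f j)) *\<^sub>R f j)" by (simp add: z(1) Mx)
    also have "\<dots> = (\<Sum>b\<in>B. of_int (c b) *\<^sub>R b)" by (rule sum.reindex_bij_betw[OF f])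
    finally show "x \<in> L" using B(3) by blast
  qed
  ultimately show thesis using that N by blast
qed

lemma int_vectors_dot: "x \<in> int_vectors \<Longrightarrow> y \<in> int_vectors \<Longrightarrow> x \<bullet> y \<in> \<int>"
  by (auto simp: int_vectors_def inner_vec_def intro!: Ints_sum Ints_mult)

lemma int_vectors_dual: "x \<in> int_vectors \<longleftrightarrow> (\<forall>y\<in>int_vectors. x \<bullet> y \<in> \<int>)"
proof
  assume *: "\<forall>y\<in>int_vectors. x \<bullet> y \<in> \<int>"
  have "axis i 1 \<in> int_vectors" for i by (simp add: int_vectors_def axis_def)
  then have "x \<bullet> axis i 1 \<in> \<int>" for i using * by blast
  then show "x \<in> int_vectors" by (simp add: int_vectors_def inner_axis)
qed (simp add: int_vectors_dot)

lemma mem_dual_lattice_matrix: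
  "x \<in> dual_lattice ((*v) M ` int_vectors) \<longleftrightarrow> x v* M \<in> int_vectors"
  by (simp add: dual_lattice_def int_vectors_dual[of "x v* M"] dot_lmul_matrix)

lemma dual_lattice_matrix:
  assumes "M ** N = mat 1" "N ** M = mat 1"
  shows "dual_lattice ((*v) M ` int_vectors) = (\<lambda>z. z v* N) ` int_vectors"
proof (intro equalityI subsetI)
  fix x assume "x \<in> dual_lattice ((*v) M ` int_vectors)"
  then have "x v* M \<in> int_vectors" by (simp only: mem_dual_lattice_matrix)
  moreover have "x = (x v* M) v* N" by (simp add: vector_matrix_mul_assoc assms)
  ultimately show "x \<in> (\<lambda>z. z v* N) ` int_vectors" by blast
qed (auto simp: mem_dual_lattice_matrix vector_matrix_mul_assoc assms)

text \<open>In coordinates, membership on either side says that \<open>N *v y\<close> is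
  integral.\<close>

lemma dual_dual_lattice:
  assumes "lattice_in (L :: (real ^ 'n) set)"
  shows "dual_lattice (dual_lattice L) = L"
proof -
  obtain M N :: "real ^ 'n ^ 'n" where M: "M ** N = mat 1" "N ** M = mat 1" "L = (*v) M ` int_vectors"
    by (rule lattice_in_matrix[OF assms])
  have "y \<in> dual_lattice (dual_lattice L) \<longleftrightarrow> (\<forall>z\<in>int_vectors. (z v* N) \<bullet> y \<in> \<int>)" for y
    unfolding M(3) dual_lattice_matrix[OF M(1,2)]
    by (simp only: dual_lattice_def mem_Collect_eq ball_simps inner_commute[of y])
  then have "y \<in> dual_lattice (dual_lattice L) \<longleftrightarrow> N *v y \<in> int_vectors" for y
    by (simp only: int_vectors_dual[of "N *v y"] dot_lmul_matrix inner_commute[of "N *v y"])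
  moreover have "y \<in> L \<longleftrightarrow> N *v y \<in> int_vectors" for y
  proof
    assume "y \<in> L"
    then show "N *v y \<in> int_vectors" by (auto simp: M matrix_vector_mul_assoc)
  next
    assume "N *v y \<in> int_vectors"
    moreover have "y = M *v (N *v y)" by (simp add: M matrix_vector_mul_assoc)
    ultimately show "y \<in> L" unfolding M(3) by blast
  qed
  ultimately show ?thesis by blast
qed

section \<open>Additive subgroups, existence of the level, finiteness\<close>

definition is_Zmodule :: "'a::real_vector set \<Rightarrow> bool" where
  "is_Zmodule L \<longleftrightarrow> 0 \<in> L \<and> (\<forall>x\<in>L. \<forall>y\<in>L. x - y \<in> L)"

lemma is_ZmoduleD:
  assumes "is_Zmodule L"
  shows "0 \<in> L" "x \<in> L \<Longrightarrow> y \<in> L \<Longrightarrow> x - y \<in> L" "x \<in> L \<Longrightarrow> y \<in> L \<Longrightarrow> x + y \<in> L"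
    "x \<in> L \<Longrightarrow> - x \<in> L" "x \<in> L \<Longrightarrow> c \<in> \<int> \<Longrightarrow> c *\<^sub>R x \<in> L"
proof -
  show 0: "0 \<in> L" and d: "x \<in> L \<Longrightarrow> y \<in> L \<Longrightarrow> x - y \<in> L" for x y
    using assms by (auto simp: is_Zmodule_def)
  show m: "x \<in> L \<Longrightarrow> - x \<in> L" for x using d[OF 0, of x] by simp
  show a: "x \<in> L \<Longrightarrow> y \<in> L \<Longrightarrow> x + y \<in> L" for x y using d[OF _ m, of x y] by simp
  have n: "x \<in> L \<Longrightarrow> real n *\<^sub>R x \<in> L" for x n
    by (induction n) (auto intro: 0 a simp: scaleR_add_left)
  show "x \<in> L \<Longrightarrow> c \<in> \<int> \<Longrightarrow> c *\<^sub>R x \<in> L" for x c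
  proof (elim Ints_cases, goal_cases)
    case (1 z)
    then show ?case using n[of x "nat z"] m[OF n[of x "nat (- z)"]] by (cases "z \<ge> 0") auto
  qed
qed

lemma Zmodule_int_vectors: "is_Zmodule int_vectors"
  by (simp add: is_Zmodule_def int_vectors_def)

lemma Zmodule_image: "is_Zmodule L \<Longrightarrow> is_Zmodule ((*v) (M :: real ^ 'n ^ 'm) ` L)"
proof -
  assume L: "is_Zmodule L"
  have "M *v x - M *v y \<in> (*v) M ` L" if "x \<in> L" "y \<in> L" for x y
    using L that unfolding matrix_vector_mult_diff_distrib[symmetric] is_Zmodule_def by blast
  moreover have "M *v 0 \<in> (*v) M ` L" using L unfolding is_Zmodule_def by blast
  ultimately show ?thesis unfolding is_Zmodule_def by auto
qed

lemma Zmodule_lattice: "lattice_in L \<Longrightarrow> is_Zmodule L"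
  by (elim lattice_in_matrix) (simp add: Zmodule_image Zmodule_int_vectors)

lemma Zmodule_dual: "is_Zmodule (dual_lattice L)"
  by (simp add: is_Zmodule_def dual_lattice_def inner_diff_left)

text \<open>Bezout's identity. It is applied to lattices, to their duals and to the set of vectors
  having integral product with a fixed vector, hence the generality of
  \<open>is_Zmodule\<close>.\<close>

lemma Zmodule_gcd:
  assumes L: "is_Zmodule L" and ab: "real a *\<^sub>R x \<in> L" "real b *\<^sub>R x \<in> L"
  shows "real (gcd a b) *\<^sub>R x \<in> L"
proof (cases "a = 0")
  case False
  then obtain u v where "a * u = b * v + gcd a b" using bezout_nat by blast
  then have "real (gcd a b) = real u * real a - real v * real b"
    by (metis add_diff_cancel_left' mult.commute of_nat_add of_nat_mult)
  then have "real (gcd a b) *\<^sub>R x = real u *\<^sub>R (real a *\<^sub>R x) - real v *\<^sub>R (real b *\<^sub>R x)"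
    by (simp add: scaleR_diff_left)
  then show ?thesis
    using is_ZmoduleD(2)[OF L is_ZmoduleD(5)[OF L ab(1), of "real u"] is_ZmoduleD(5)[OF L ab(2), of "real v"]]
    by simp
qed (use ab in simp)

lemma Zmodule_dvd:
  assumes "is_Zmodule L" "real a *\<^sub>R x \<in> L" "a dvd b"
  shows "real b *\<^sub>R x \<in> L"
proof -
  obtain c where "b = a * c" using assms(3) by blast
  then have "real b *\<^sub>R x = real c *\<^sub>R (real a *\<^sub>R x)" by (simp add: mult.commute)
  then show ?thesis using is_ZmoduleD(5)[OF assms(1,2), of "real c"] by (simp only:) simp
qed

lemma det_Ints: "(\<And>i j. A $ i $ j \<in> \<int>) \<Longrightarrow> det (A :: real ^ 'n ^ 'n) \<in> \<int>"
  unfolding det_def by (intro Ints_sum Ints_mult Ints_prod) auto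

text \<open>The minimum that defines the level exists: by Cramer's rule, multiplication by the
  absolute value of the determinant of the Gram matrix carries the dual lattice into
  \<open>L\<close>.\<close>

lemma lattice_level:
  assumes "integral_lattice (L :: (real ^ 'n) set)"
  shows "lattice_level L > 0" "x \<in> dual_lattice L \<Longrightarrow> real (lattice_level L) *\<^sub>R x \<in> L"
proof -
  have lat: "lattice_in L" and sub: "L \<subseteq> dual_lattice L" using assms by (auto simp: integral_lattice_def)
  obtain M N :: "real ^ 'n ^ 'n" where MN: "M ** N = mat 1" "N ** M = mat 1" and M: "L = (*v) M ` int_vectors"
    by (rule lattice_in_matrix[OF lat])
  define G :: "real ^ 'n ^ 'n" where "G = transpose M ** M"
  have ax: "axis i 1 \<in> int_vectors" for i by (simp add: int_vectors_def axis_def)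
  have Gint: "G $ i $ j \<in> \<int>" for i j
  proof -
    have "M *v axis j 1 \<in> dual_lattice L" using sub M ax by blast
    then have "G *v axis j 1 \<in> int_vectors" unfolding M mem_dual_lattice_matrix
      by (simp add: G_def flip: matrix_vector_mul_assoc)
    then show ?thesis by (simp add: int_vectors_def matrix_vector_mult_basis column_def)
  qed
  have "det M * det N = 1" using det_mul[of M N] MN(1) by simp
  then have "det G \<noteq> 0" by (auto simp: G_def det_mul det_transpose)
  obtain D :: int where D: "det G = of_int D" using det_Ints[of G] Gint by (auto elim: Ints_cases)
  define l where "l = nat \<bar>D\<bar>"
  have "l > 0" using \<open>det G \<noteq> 0\<close> D by (simp add: l_def)
  have "real l *\<^sub>R x \<in> L" if x: "x \<in> dual_lattice L" for x
  proof -
    define z where "z = x v* M"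
    have z: "z \<in> int_vectors" using x by (simp add: z_def M mem_dual_lattice_matrix)
    define y where "y = N *v x"
    have y: "M *v y = x" by (simp add: y_def MN matrix_vector_mul_assoc)
    have "G *v y = z" by (simp add: G_def z_def y flip: matrix_vector_mul_assoc)
    then have "y = (\<chi> k. det (\<chi> i j. if j = k then z $ i else G $ i $ j) / det G)"
      using cramer[OF \<open>det G \<noteq> 0\<close>] by blast
    then have "y $ k = det (\<chi> i j. if j = k then z $ i else G $ i $ j) / det G" for k
      by (simp only: vec_eq_iff vec_lambda_beta)
    then have "det G * y $ k = det (\<chi> i j. if j = k then z $ i else G $ i $ j)" for k
      using \<open>det G \<noteq> 0\<close> by simp
    moreover have "det (\<chi> i j. if j = k then z $ i else G $ i $ j) \<in> \<int>" for k
      using z Gint by (intro det_Ints) (simp add: int_vectors_def)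
    ultimately have "det G * y $ k \<in> \<int>" for k by simp
    then have "det G *\<^sub>R y \<in> int_vectors" by (simp add: int_vectors_def)
    then have "det G *\<^sub>R x \<in> L"
      unfolding M using y by (metis matrix_vector_mult_scaleR rev_image_eqI)
    then have "real l *\<^sub>R x \<in> L \<or> - real l *\<^sub>R x \<in> L" by (auto simp: l_def D abs_if)
    then show ?thesis using is_ZmoduleD(4)[OF Zmodule_lattice[OF lat], of "- real l *\<^sub>R x"] by auto
  qed
  then have ex: "l > 0 \<and> (\<lambda>x. real l *\<^sub>R x) ` dual_lattice L \<subseteq> L" using \<open>l > 0\<close> by blast
  have "lattice_level L > 0 \<and> (\<lambda>x. real (lattice_level L) *\<^sub>R x) ` dual_lattice L \<subseteq> L"
    unfolding lattice_level_def by (rule LeastI[of _ l]) (rule ex)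
  then show "lattice_level L > 0" "x \<in> dual_lattice L \<Longrightarrow> real (lattice_level L) *\<^sub>R x \<in> L" for x by blast+
qed

lemma finite_bounded_int_vectors: "finite {z \<in> int_vectors :: (real ^ 'n) set. \<forall>i. \<bar>z $ i\<bar> \<le> K}"
proof -
  define N where "N = \<lceil>K\<rceil>"
  have "{z \<in> int_vectors :: (real ^ 'n) set. \<forall>i. \<bar>z $ i\<bar> \<le> K}
      \<subseteq> (\<lambda>f. \<chi> i. of_int (f i)) ` (PiE UNIV (\<lambda>_. {- N..N}))"
  proof
    fix z :: "real ^ 'n" assume z: "z \<in> {z \<in> int_vectors. \<forall>i. \<bar>z $ i\<bar> \<le> K}"
    have "\<bar>\<lfloor>z $ i\<rfloor>\<bar> \<le> N" for i
    proof -
      have eq: "of_int \<lfloor>z $ i\<rfloor> = z $ i" using z by (simp add: int_vectors_def)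
      have "\<bar>z $ i\<bar> \<le> of_int N" using z unfolding N_def
        by (intro order.trans[OF _ le_of_int_ceiling]) simp
      then have "real_of_int \<bar>\<lfloor>z $ i\<rfloor>\<bar> \<le> of_int N" by (simp only: of_int_abs eq)
      then show ?thesis by linarith
    qed
    then have "(\<lambda>i. \<lfloor>z $ i\<rfloor>) \<in> PiE UNIV (\<lambda>_. {- N..N})" by (auto simp: abs_le_iff minus_le_iff)
    moreover have "z = (\<lambda>f. \<chi> i. of_int (f i)) (\<lambda>i. \<lfloor>z $ i\<rfloor>)" using z by (simp add: vec_eq_iff int_vectors_def)
    ultimately show "z \<in> (\<lambda>f. \<chi> i. of_int (f i)) ` (PiE UNIV (\<lambda>_. {- N..N}))"
      by (intro image_eqI[where x = "\<lambda>i. \<lfloor>z $ i\<rfloor>"]) auto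
  qed
  then show ?thesis by (rule finite_subset) (intro finite_imageI finite_PiE, auto)
qed

lemma finite_bounded_lattice:
  assumes "lattice_in (L :: (real ^ 'n) set)"
  shows "finite {x \<in> L. norm x \<le> R}"
proof -
  obtain M N :: "real ^ 'n ^ 'n" where MN: "M ** N = mat 1" "N ** M = mat 1" and M: "L = (*v) M ` int_vectors"
    by (rule lattice_in_matrix[OF assms])
  define K where "K = onorm ((*v) N) * R"
  have "{x \<in> L. norm x \<le> R} \<subseteq> (*v) M ` {z \<in> int_vectors. \<forall>i. \<bar>z $ i\<bar> \<le> K}"
  proof
    fix x assume x: "x \<in> {x \<in> L. norm x \<le> R}"
    then obtain z where z: "x = M *v z" "z \<in> int_vectors" using M by blast
    have "z = N *v x" using z by (simp add: MN matrix_vector_mul_assoc)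
    then have "norm z \<le> onorm ((*v) N) * norm x" using onorm[OF matrix_vector_mul_bounded_linear, of N x] by simp
    also have "\<dots> \<le> K" unfolding K_def using x
      by (intro mult_left_mono onorm_pos_le matrix_vector_mul_bounded_linear) auto
    finally have "\<bar>z $ i\<bar> \<le> K" for i using component_le_norm_cart[of z i] by linarith
    then show "x \<in> (*v) M ` {z \<in> int_vectors. \<forall>i. \<bar>z $ i\<bar> \<le> K}" using z by blast
  qed
  then show ?thesis by (rule finite_subset) (intro finite_imageI finite_bounded_int_vectors)
qed

section \<open>Unitary divisors and modularities\<close>

definition udiv :: "nat \<Rightarrow> nat set" where
  "udiv l = {m. m dvd l \<and> coprime m (l div m)}"

definition umult :: "nat \<Rightarrow> nat \<Rightarrow> nat" where
  "umult m m' = (m * m') div (gcd m m')\<^sup>2"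

lemma W_group_simps: "carrier (W_group l) = udiv l" "m \<otimes>\<^bsub>W_group l\<^esub> m' = umult m m'" "\<one>\<^bsub>W_group l\<^esub> = 1"
  by (simp_all add: W_group_def udiv_def umult_def)

lemma umult_commute: "umult m m' = umult m' m"
  by (simp add: umult_def mult.commute gcd.commute)

text \<open>Two unitary divisors cut \<open>l\<close> into four pairwise coprime factors: the common
  part \<open>g\<close>, the private parts \<open>a\<close> and \<open>b\<close>, and the rest
  \<open>t\<close>. The group product retains the private parts, like a symmetric
  difference.\<close>

lemma udiv_parts:
  assumes l: "l > 0" and m: "m \<in> udiv l" and m': "m' \<in> udiv l"
  obtains g a b t where "m = g * a" "m' = g * b" "g = gcd m m'" "l = g * a * b * t" "g > 0" "a > 0" "b > 0"
    "coprime a b" "coprime g a" "coprime g b" "coprime g t" "coprime a t" "coprime b t" "umult m m' = a * b"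
proof -
  have m0: "m > 0" "m' > 0" using l m m' by (auto simp: udiv_def intro: gr0I)
  define g where "g = gcd m m'"
  have "gcd m m' \<noteq> 0" using m0 by simp
  from gcd_coprime_exists[OF this] obtain a b where "m = a * g" "m' = b * g" "coprime a b"
    unfolding g_def by blast
  then have ab: "m = g * a" "m' = g * b" "coprime a b" by simp_all
  have pos: "g > 0" "a > 0" "b > 0" using m0 ab by (auto intro: gr0I)
  have "lcm m m' = g * a * b"
    using ab(3) by (simp add: ab(1,2) lcm_mult_left lcm_coprime mult.assoc)
  moreover have "lcm m m' dvd l" using m m' by (intro lcm_least) (auto simp: udiv_def)
  ultimately have "g * a * b dvd l" by simp
  then obtain t where t: "l = g * a * b * t" by blast
  have "l div m = b * t" using ab(1) pos by (simp add: t mult.assoc)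
  then have 1: "coprime (g * a) (b * t)" using m ab(1) by (simp add: udiv_def)
  have "l = m' * (a * t)" by (simp add: ab(2) t mult_ac)
  then have "l div m' = a * t" using m0 by simp
  then have 2: "coprime (g * b) (a * t)" using m' ab(2) by (simp add: udiv_def)
  have "m * m' = a * b * g\<^sup>2" by (simp add: ab(1,2) power2_eq_square mult_ac)
  then have "umult m m' = a * b"
    using pos by (simp add: umult_def flip: g_def)
  then show thesis using that[OF ab(1,2) g_def t pos ab(3)] 1 2 by (simp add: coprime_commute)
qed

lemma udiv_umult:
  assumes "l > 0" "m \<in> udiv l" "m' \<in> udiv l"
  shows "umult m m' \<in> udiv l"
proof -
  obtain g a b t where *: "l = g * a * b * t" "g > 0" "a > 0" "b > 0"
    "coprime a b" "coprime g a" "coprime g b" "coprime g t" "coprime a t" "coprime b t" "umult m m' = a * b"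
    by (rule udiv_parts[OF assms])
  have "l = (a * b) * (g * t)" by (simp add: * mult_ac)
  then have "l div (a * b) = g * t" "a * b dvd l" using * by auto
  then show ?thesis using * by (simp add: udiv_def coprime_commute)
qed

lemma one_udiv: "1 \<in> udiv l"
  by (simp add: udiv_def)

lemma umult_one: "umult m 1 = m" "umult 1 m = m"
  by (simp_all add: umult_def)

lemma umult_self: "m > 0 \<Longrightarrow> umult m m = 1"
  by (simp add: umult_def power2_eq_square)

lemma udiv_pos: "l > 0 \<Longrightarrow> m \<in> udiv l \<Longrightarrow> m > 0"
  by (auto simp: udiv_def intro: gr0I)

lemma finite_udiv: "l > 0 \<Longrightarrow> finite (udiv l)"
  by (rule finite_subset[of _ "{..l}"]) (auto simp: udiv_def dvd_imp_le)

text \<open>A unitary divisor takes each prime power of \<open>l\<close> entirely or not at all, so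
  its primes determine it. With \<open>prime_dvd_umult\<close>, associativity of
  \<open>umult\<close> becomes that of exclusive or.\<close>

lemma udiv_eqI:
  assumes l: "l > 0" and m: "m \<in> udiv l" and m': "m' \<in> udiv l" and eq: "\<And>p. Factorial_Ring.prime p \<Longrightarrow> p dvd m \<longleftrightarrow> p dvd m'"
  shows "m = m'"
proof -
  have "x dvd y" if x: "x \<in> udiv l" and y: "y \<in> udiv l" and xy: "\<And>p. Factorial_Ring.prime p \<Longrightarrow> p dvd x \<Longrightarrow> p dvd y" for x y
  proof -
    have "coprime x (l div y)"
    proof (rule ccontr)
      assume "\<not> coprime x (l div y)"
      then have "gcd x (l div y) \<noteq> 1" using coprime_iff_gcd_eq_1 by blast
      from prime_factor_nat[OF this] obtain p where p: "Factorial_Ring.prime p" "p dvd gcd x (l div y)" by blast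
      have "p dvd y" by (rule xy[OF p(1) dvd_gcdD1[OF p(2)]])
      moreover have "coprime y (l div y)" using y by (simp add: udiv_def)
      ultimately have "is_unit p" using dvd_gcdD2[OF p(2)] coprime_common_divisor by blast
      then show False using p(1) not_prime_unit by auto
    qed
    moreover have "x dvd y * (l div y)" using x y by (simp add: udiv_def)
    ultimately show ?thesis by (simp add: coprime_dvd_mult_left_iff)
  qed
  then show ?thesis using m m' eq by (intro dvd_antisym) auto
qed

lemma prime_dvd_umult:
  assumes "l > 0" "m \<in> udiv l" "m' \<in> udiv l" "Factorial_Ring.prime p"
  shows "p dvd umult m m' \<longleftrightarrow> (p dvd m) \<noteq> (p dvd m')"
proof -
  obtain g a b t where *: "m = g * a" "m' = g * b" "coprime a b" "coprime g a" "coprime g b" "umult m m' = a * b"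
    by (rule udiv_parts[OF assms(1-3)])
  have "\<not> (p dvd a \<and> p dvd b)" "\<not> (p dvd g \<and> p dvd a)" "\<not> (p dvd g \<and> p dvd b)"
    using *(3-5) assms(4) by (metis coprime_common_divisor not_prime_unit)+
  moreover have "p dvd umult m m' \<longleftrightarrow> p dvd a \<or> p dvd b" "p dvd m \<longleftrightarrow> p dvd g \<or> p dvd a" "p dvd m' \<longleftrightarrow> p dvd g \<or> p dvd b"
    using assms(4) by (simp only: *(6) prime_dvd_mult_iff, simp only: *(1) prime_dvd_mult_iff, simp only: *(2) prime_dvd_mult_iff)
  ultimately show ?thesis by blast
qed

lemma umult_assoc:
  assumes "l > 0" "x \<in> udiv l" "y \<in> udiv l" "z \<in> udiv l"
  shows "umult (umult x y) z = umult x (umult y z)"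
  using assms by (intro udiv_eqI[of l] udiv_umult) (auto simp: prime_dvd_umult udiv_umult)

lemma W_group_comm: "l > 0 \<Longrightarrow> comm_group (W_group l)"
  by (rule comm_groupI)
    (auto simp: W_group_simps udiv_umult one_udiv[unfolded One_nat_def] umult_one[unfolded One_nat_def] umult_assoc
      intro: umult_commute umult_self[OF udiv_pos, unfolded One_nat_def])

text \<open>Both sides of the first equation are the least common multiple of \<open>m\<close> and
  \<open>m'\<close>. The second yields the factor \<open>gcd m m'\<close> by which the composite of
  two scaled similarities exceeds the scaled similarity for \<open>umult m m'\<close>.\<close>

lemma udiv_lcm:
  assumes "l > 0" "m \<in> udiv l" "m' \<in> udiv l"
  shows "gcd l (m * m') = gcd m m' * umult m m'" "gcd m m' * umult m m' * gcd m m' = m * m'"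
proof -
  obtain g a b t where *: "m = g * a" "m' = g * b" "g = gcd m m'" "l = g * a * b * t" "coprime g t" "umult m m' = a * b"
    by (rule udiv_parts[OF assms])
  have "l = (g * a * b) * t" "m * m' = (g * a * b) * g" by (simp_all add: *(1,2,4) mult_ac)
  then have "gcd l (m * m') = g * a * b * gcd t g" by (simp only: gcd_mult_left normalize_nat_def id_apply)
  then show "gcd l (m * m') = gcd m m' * umult m m'"
    unfolding *(3)[symmetric] *(6) using *(5) by (simp add: gcd.commute mult.assoc)
  show "gcd m m' * umult m m' * gcd m m' = m * m'"
    unfolding *(3)[symmetric] *(6) by (simp add: *(1,2) mult_ac)
qed

text \<open>
  For \<open>m > 0\<close> this is \<open>L\<^sup>* \<inter> m\<^sup>-\<^sup>1 L\<close>, the partial dual without the scaling by \<open>\<surd>m\<close>.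
\<close>

definition pdual :: "nat \<Rightarrow> (real ^ 'n) set \<Rightarrow> (real ^ 'n) set" where
  "pdual m L = {x \<in> dual_lattice L. real m *\<^sub>R x \<in> L}"

lemma partial_dual_eq: "m > 0 \<Longrightarrow> partial_dual m L = (\<lambda>x. sqrt (real m) *\<^sub>R x) ` pdual m L"
proof -
  assume m: "m > 0"
  have "x \<in> (\<lambda>x. inverse (real m) *\<^sub>R x) ` L \<longleftrightarrow> real m *\<^sub>R x \<in> L" for x
    using m by (auto intro!: image_eqI[of _ _ "real m *\<^sub>R x"])
  then show ?thesis unfolding partial_dual_def pdual_def by (auto intro!: arg_cong[where f = "\<lambda>S. _ ` S"])
qed

text \<open>The factor \<open>m\<close> is kept beside \<open>A\<close>, so that the first
  projection is the map onto the modularities. The equivalence, demanded for all \<open>x\<close>,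
  expresses without images that \<open>A\<close> carries the partial dual onto
  \<open>L\<close>.\<close>

definition simil :: "(real ^ 'n) set \<Rightarrow> (nat \<times> (real ^ 'n ^ 'n)) set" where
  "simil L = {(m, A). m \<in> udiv (lattice_level L) \<and> orthogonal_matrix A \<and>
     (\<forall>x. sqrt (real m) *\<^sub>R (A *v x) \<in> L \<longleftrightarrow> x \<in> pdual m L)}"

lemma I_set_eq:
  assumes "integral_lattice (L :: (real ^ 'n) set)"
  shows "I_set L = fst ` simil L"
proof -
  have l: "lattice_level L > 0" using lattice_level[OF assms] by blast
  have iff: "(\<exists>\<sigma>. orthogonal_transformation \<sigma> \<and> L = \<sigma> ` partial_dual m L) \<longleftrightarrow> (\<exists>A. (m, A) \<in> simil L)"
    if m: "m \<in> udiv (lattice_level L)" for m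
  proof
    have m0: "m > 0" by (rule udiv_pos[OF l m])
    assume "\<exists>\<sigma>. orthogonal_transformation \<sigma> \<and> L = \<sigma> ` partial_dual m L"
    then obtain \<sigma> where \<sigma>: "orthogonal_transformation \<sigma>" "L = \<sigma> ` partial_dual m L" by blast
    let ?A = "matrix \<sigma>"
    have A: "orthogonal_matrix ?A" and lin: "linear \<sigma>" using \<sigma>(1) by (simp_all add: orthogonal_transformation_matrix)
    have Ax: "?A *v x = \<sigma> x" for x using lin by (simp add: matrix_works)
    have inj: "inj \<sigma>" using \<sigma>(1) by (rule orthogonal_transformation_inj)
    have "sqrt (real m) *\<^sub>R (?A *v x) \<in> L \<longleftrightarrow> x \<in> pdual m L" for x
    proof -
      have "sqrt (real m) *\<^sub>R (?A *v x) = \<sigma> (sqrt (real m) *\<^sub>R x)" by (simp add: Ax linear_cmul[OF lin])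
      then have "sqrt (real m) *\<^sub>R (?A *v x) \<in> L \<longleftrightarrow> sqrt (real m) *\<^sub>R x \<in> partial_dual m L"
        using \<sigma>(2) inj by (metis inj_image_mem_iff)
      also have "\<dots> \<longleftrightarrow> x \<in> pdual m L" using m0 by (auto simp: partial_dual_eq)
      finally show ?thesis .
    qed
    then show "\<exists>A. (m, A) \<in> simil L" using A m by (auto simp: simil_def)
  next
    have m0: "m > 0" by (rule udiv_pos[OF l m])
    assume "\<exists>A. (m, A) \<in> simil L"
    then obtain A :: "real ^ 'n ^ 'n" where A: "orthogonal_matrix A"
      "\<And>x. sqrt (real m) *\<^sub>R (A *v x) \<in> L \<longleftrightarrow> x \<in> pdual m L" by (auto simp: simil_def)
    have "orthogonal_transformation ((*v) A)" using A(1) by (simp add: orthogonal_transformation_matrix)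
    moreover have "L = (*v) A ` partial_dual m L"
    proof (intro equalityI subsetI)
      fix y assume y: "y \<in> L"
      define x where "x = (1 / sqrt (real m)) *\<^sub>R (transpose A *v y)"
      have "sqrt (real m) *\<^sub>R (A *v x) = (A ** transpose A) *v y"
        using m0 by (simp only: x_def matrix_vector_mult_scaleR scaleR_scaleR matrix_vector_mul_assoc) simp
      then have *: "sqrt (real m) *\<^sub>R (A *v x) = y" using A(1) by (simp add: orthogonal_matrix_def)
      then have "x \<in> pdual m L" using A(2) y by metis
      then show "y \<in> (*v) A ` partial_dual m L" using * m0
        by (auto simp: partial_dual_eq image_image matrix_vector_mult_scaleR intro!: image_eqI[of _ _ x])
    qed (use A(2) m0 in \<open>auto simp: partial_dual_eq matrix_vector_mult_scaleR\<close>)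
    ultimately show "\<exists>\<sigma>. orthogonal_transformation \<sigma> \<and> L = \<sigma> ` partial_dual m L" by blast
  qed
  have udiv: "m \<in> udiv (lattice_level L)" if "(m, A) \<in> simil L" for m A using that by (simp add: simil_def)
  show ?thesis
  proof (rule Set.set_eqI)
    fix m
    have "m \<in> I_set L \<longleftrightarrow> m \<in> udiv (lattice_level L) \<and> (\<exists>\<sigma>. orthogonal_transformation \<sigma> \<and> L = \<sigma> ` partial_dual m L)"
      unfolding I_set_def W_group_simps by blast
    also have "\<dots> \<longleftrightarrow> (\<exists>A. (m, A) \<in> simil L)" using iff[of m] udiv[of m] by meson
    also have "\<dots> \<longleftrightarrow> m \<in> fst ` simil L" by force
    finally show "m \<in> I_set L \<longleftrightarrow> m \<in> fst ` simil L" .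
  qed
qed

lemma orthogonal_matrix_inner: "orthogonal_matrix (A :: real ^ 'n ^ 'n) \<Longrightarrow> (A *v x) \<bullet> (A *v y) = x \<bullet> y"
  using orthogonal_transformation_matrix[of "(*v) A"] by (simp add: orthogonal_transformation_def)

text \<open>This is what singles out \<open>B_set\<close>: it consists of the modularities whose
  square root is rational.\<close>

lemma sqrt_nat_rat_iff:
  assumes "m > 0"
  shows "sqrt (real m) \<in> \<rat> \<longleftrightarrow> (\<exists>k\<ge>1. m = k\<^sup>2)"
proof
  assume "sqrt (real m) \<in> \<rat>"
  then obtain a b :: nat where ab: "b \<noteq> 0" "\<bar>sqrt (real m)\<bar> = real a / real b" "coprime a b"
    by (rule Rats_abs_nat_div_natE)
  then have "real m = (real a / real b)\<^sup>2" by (metis abs_of_nonneg of_nat_0_le_iff real_sqrt_ge_zero real_sqrt_pow2)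
  then have "real (m * b\<^sup>2) = real (a\<^sup>2)" using ab(1) by (simp add: power_divide)
  then have eq: "m * b\<^sup>2 = a\<^sup>2" using of_nat_eq_iff by blast
  then have "b\<^sup>2 dvd a\<^sup>2" by (metis dvd_triv_right)
  moreover have "coprime (a\<^sup>2) (b\<^sup>2)" using ab(3) by simp
  ultimately have "is_unit (b\<^sup>2)" by (metis coprime_common_divisor dvd_refl)
  then have "b\<^sup>2 = 1" by simp
  then have "m = a\<^sup>2" using eq by simp
  moreover have "a \<ge> 1" using assms \<open>m = a\<^sup>2\<close> by (cases a) auto
  ultimately show "\<exists>k\<ge>1. m = k\<^sup>2" by blast
qed auto

section \<open>Passage from a finite group to a Sylow 2-subgroup\<close>

lemma is_subfield_Rats: "is_subfield (of_real ` \<rat>)"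
  unfolding is_subfield_def
  by (auto simp flip: of_real_diff of_real_mult of_real_inverse intro!: imageI)

text \<open>\<theta> is multiplicative only up to factors in \<open>F\<close>, which suffices
  here.\<close>

lemma (in matrix_rep) theta_subgroup:
  assumes tl: "trace_lines G \<rho> F \<theta>"
  shows "subgroup {g \<in> carrier G. \<theta> g \<in> F} G"
proof -
  note tlD = trace_linesD[OF tl]
  note Fc = is_subfieldD[OF tlD(1)]
  have q: "\<theta> g * \<theta> h \<in> F" if "\<theta> (g \<otimes> h) \<in> F" "g \<in> carrier G" "h \<in> carrier G" for g h
  proof -
    have "\<theta> g * \<theta> h = \<theta> (g \<otimes> h) / (\<theta> (g \<otimes> h) / (\<theta> g * \<theta> h))" using that tlD(2) by simp
    then show ?thesis using Fc(6)[OF that(1) tlD(5)[OF that(2,3)]] by simp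
  qed
  have one: "\<theta> \<one> \<in> F"
  proof -
    have "\<theta> (\<one> \<otimes> \<one>) / (\<theta> \<one> * \<theta> \<one>) \<in> F" by (rule tlD(5)) simp_all
    then have "1 / \<theta> \<one> \<in> F" using tlD(2)[of \<one>] by simp
    then have "1 / (1 / \<theta> \<one>) \<in> F" by (rule Fc(6)[OF Fc(2)])
    then show ?thesis by simp
  qed
  show ?thesis
  proof (rule subgroupI)
    fix a assume a: "a \<in> {g \<in> carrier G. \<theta> g \<in> F}"
    then have "\<theta> (inv a) * \<theta> a \<in> F" using one by (intro q) auto
    then have "\<theta> (inv a) * \<theta> a / \<theta> a \<in> F" using a by (intro Fc(6)) auto
    then show "inv a \<in> {g \<in> carrier G. \<theta> g \<in> F}" using a tlD(2)[of a] by simp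
  next
    fix a b assume "a \<in> {g \<in> carrier G. \<theta> g \<in> F}" "b \<in> {g \<in> carrier G. \<theta> g \<in> F}"
    then show "a \<otimes> b \<in> {g \<in> carrier G. \<theta> g \<in> F}" using theta_mult[OF tl, of a b] Fc(5) by auto
  qed (use one in auto)
qed

text \<open>A Sylow 2-subgroup \<open>S\<close> meets the subgroup \<open>?K\<close> in a 2-group
  whose order divides that of \<open>?K\<close>. Cancelling the odd part of the order of
  \<open>G\<close> shows that at least \<open>2 ^ d\<close> classes survive in \<open>S\<close>; the
  real field allows the start with \<open>e = 1\<close>.\<close>

lemma (in matrix_rep) degree_bound:
  assumes fin: "finite (carrier G)" and tl: "trace_lines G \<rho> F \<theta>"
    and real: "F \<subseteq> \<real>" "\<theta> ` carrier G \<subseteq> \<real>" and r: "trace (\<rho> \<one>) = of_nat r"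
    and card: "order G = 2 ^ d * card {g \<in> carrier G. \<theta> g \<in> F}"
  shows "2 ^ ((d + 1) div 2) dvd r"
proof -
  let ?K = "{g \<in> carrier G. \<theta> g \<in> F}"
  have K: "subgroup ?K G" by (rule theta_subgroup[OF tl])
  have G0: "order G > 0" using fin order_gt_0_iff_finite by blast
  define k where "k = multiplicity 2 (order G)"
  obtain q where q: "order G = 2 ^ k * q" "odd q"
    using multiplicity_decompose'[of "order G" 2] G0 by (auto simp: k_def)
  obtain S where S: "subgroup S G" "card S = 2 ^ k"
    using sylow_thm[OF two_is_prime_nat is_group q(1) fin] by blast
  interpret S: group "G\<lparr>carrier := S\<rparr>" using S(1) by (rule subgroup_imp_group)
  have SG: "S \<subseteq> carrier G" by (rule subgroup.subset[OF S(1)])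
  have rep: "matrix_rep (G\<lparr>carrier := S\<rparr>) \<rho>"
    by unfold_locales (use SG in \<open>auto simp: rep_mult subset_iff\<close>)
  have tlS: "trace_lines (G\<lparr>carrier := S\<rparr>) \<rho> F \<theta>" using tl SG by (auto simp: trace_lines_def subset_iff)
  have SK: "{g \<in> carrier (G\<lparr>carrier := S\<rparr>). \<theta> g \<in> F} = S \<inter> ?K" using SG by auto
  have sub: "subgroup (S \<inter> ?K) G" using subgroups_Inter_pair[OF S(1) K] .
  have "card (S \<inter> ?K) dvd card S"
  proof -
    have "subgroup (S \<inter> ?K) (G\<lparr>carrier := S\<rparr>)" by (rule subgroup_incl[OF sub S(1)]) simp
    have "card (S \<inter> ?K) dvd order (G\<lparr>carrier := S\<rparr>)"
      unfolding S.lagrange[OF \<open>subgroup (S \<inter> ?K) (G\<lparr>carrier := S\<rparr>)\<close>, symmetric] by (rule dvd_triv_right)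
    then show ?thesis by (simp add: order_def)
  qed
  then obtain j where j: "card (S \<inter> ?K) = 2 ^ j" unfolding S(2)
    using divides_primepow_nat[OF two_is_prime_nat] by blast
  have "card (S \<inter> ?K) dvd card ?K"
  proof -
    interpret K: group "G\<lparr>carrier := ?K\<rparr>" using K by (rule subgroup_imp_group)
    have "subgroup (S \<inter> ?K) (G\<lparr>carrier := ?K\<rparr>)" by (rule subgroup_incl[OF sub K]) simp
    have "card (S \<inter> ?K) dvd order (G\<lparr>carrier := ?K\<rparr>)"
      unfolding K.lagrange[OF \<open>subgroup (S \<inter> ?K) (G\<lparr>carrier := ?K\<rparr>)\<close>, symmetric] by (rule dvd_triv_right)
    then show ?thesis by (simp add: order_def)
  qed
  then have "2 ^ d * 2 ^ j dvd order G" unfolding j card by (rule mult_dvd_mono[OF dvd_refl])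
  then have "2 ^ d * 2 ^ j dvd 2 ^ k * q" unfolding q(1) .
  then have "2 ^ (d + j) dvd (2 ^ k :: nat)" using q(2)
    by (metis coprime_dvd_mult_left_iff coprime_power_left_iff coprime_left_2_iff_odd power_add)
  then have "2 ^ d * card {g \<in> carrier (G\<lparr>carrier := S\<rparr>). \<theta> g \<in> F} \<le> order (G\<lparr>carrier := S\<rparr>)"
    unfolding SK using j S(2) by (simp add: order_def power_add dvd_imp_le)
  then show ?thesis
    by (intro two_group_degree[OF rep _ tlS, where k = k and d = d and e = 1]) (use S r real SG in \<open>auto simp: order_def\<close>)
qed

definition simil_group :: "(real ^ 'n) set \<Rightarrow> (nat \<times> (real ^ 'n ^ 'n)) monoid" where
  "simil_group L = \<lparr>carrier = simil L,
     monoid.mult = (\<lambda>(m, A) (m', A'). (umult m m', A ** A')), one = (1, mat 1)\<rparr>"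

definition cmatrix :: "real ^ 'n ^ 'm \<Rightarrow> complex ^ 'n ^ 'm" where
  "cmatrix A = (\<chi> i j. of_real (A $ i $ j))"

lemma cmatrix_mult: "cmatrix (A ** B) = cmatrix A ** cmatrix B"
  by (simp add: cmatrix_def matrix_matrix_mult_def)

lemma trace_cmatrix: "trace (cmatrix A) = of_real (trace A)"
  by (simp add: cmatrix_def trace_def)

section \<open>Dimensions over the field with two elements as counts\<close>

lemma (in vectorspace) card_carrier_dim:
  assumes fin: "finite (carrier V)"
  shows "card (carrier V) = card (carrier K) ^ dim"
proof -
  have "gen_set (carrier V)" using in_own_span[of "carrier V"] span_is_subset2[of "carrier V"] by auto
  then have "fin_dim" unfolding fin_dim_def using fin by blast
  then obtain A where A: "finite A" "basis A" using finite_basis_exists by blast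
  have AV: "A \<subseteq> carrier V" using A(2) by (simp add: basis_def)
  have crit: "\<exists>!a. a \<in> A \<rightarrow>\<^sub>E carrier K \<and> lincomb a A = v" if "v \<in> carrier V" for v
    using basis_criterion[OF A(1) AV] A(2) that by blast
  have "bij_betw (\<lambda>a. lincomb a A) (A \<rightarrow>\<^sub>E carrier K) (carrier V)"
    unfolding bij_betw_def
  proof (intro conjI inj_onI equalityI subsetI)
    have closed: "lincomb a A \<in> carrier V" if "a \<in> A \<rightarrow>\<^sub>E carrier K" for a
      using that AV by (intro lincomb_closed) auto
    show "a = b" if "a \<in> A \<rightarrow>\<^sub>E carrier K" "b \<in> A \<rightarrow>\<^sub>E carrier K" "lincomb a A = lincomb b A" for a b
      using crit[OF closed[OF that(1)]] that by metis
    show "v \<in> carrier V" if "v \<in> (\<lambda>a. lincomb a A) ` (A \<rightarrow>\<^sub>E carrier K)" for v using that closed by blast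
    show "v \<in> (\<lambda>a. lincomb a A) ` (A \<rightarrow>\<^sub>E carrier K)" if "v \<in> carrier V" for v using crit[OF that] by blast
  qed
  then have "card (carrier V) = card (A \<rightarrow>\<^sub>E carrier K)" by (rule bij_betw_same_card[symmetric])
  then show ?thesis using A by (simp add: card_PiE dim_basis)
qed

text \<open>The group arguments deal with orders alone; the dimension enters through this
  count.\<close>

lemma card_eq_two_power_F2_dim:
  assumes "comm_group A" "\<And>a. a \<in> carrier A \<Longrightarrow> a \<otimes>\<^bsub>A\<^esub> a = \<one>\<^bsub>A\<^esub>" "finite (carrier A)"
  shows "card (carrier A) = 2 ^ F2_dim A"
proof -
  interpret V: vectorspace "residue_ring 2" "F2_space A" using assms by (intro vectorspace_F2_space)
  have "carrier (residue_ring 2) = {0..1}" by (simp add: residue_ring_def)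
  moreover have "carrier (F2_space A) = carrier A" by (simp add: F2_space_def)
  ultimately show ?thesis using V.card_carrier_dim assms(3) by (simp add: F2_dim_def)
qed

lemma udiv_squarefree:
  assumes "squarefree k"
  shows "udiv k = {m. m dvd k}"
proof (intro equalityI subsetI)
  fix m assume "m \<in> {m. m dvd k}"
  then obtain c where c: "k = m * c" by auto
  have "k \<noteq> 0" using assms by (metis not_squarefree_0)
  then have "m > 0" using c by (auto intro: gr0I)
  then have "k div m = c" by (simp add: c)
  moreover have "coprime m c"
  proof -
    have "(gcd m c)\<^sup>2 dvd k" unfolding c power2_eq_square by (intro mult_dvd_mono) auto
    then have "is_unit (gcd m c)" using assms unfolding squarefree_def by blast
    then show ?thesis by (simp only: is_unit_gcd)
  qed
  ultimately show "m \<in> udiv k" by (simp add: udiv_def c)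
qed (simp add: udiv_def)

lemma size_prime_factorization_squarefree:
  assumes "squarefree (k :: nat)"
  shows "size (prime_factorization k) = card (prime_factors k)"
proof -
  have "size (prime_factorization k) = (\<Sum>p\<in>prime_factors k. count (prime_factorization k) p)"
    by (simp add: size_multiset_overloaded_eq)
  also have "\<dots> = (\<Sum>p\<in>prime_factors k. 1)"
    using assms by (intro sum.cong) (auto simp: count_prime_factorization_prime in_prime_factors_iff squarefree_factorial_semiring')
  finally show ?thesis by simp
qed

lemma card_divisors_squarefree:
  assumes "squarefree (k :: nat)"
  shows "card (udiv k) = 2 ^ card (prime_factors k)"
proof -
  have k0: "k > 0" using assms by (metis gr0I not_squarefree_0)
  have pf: "Factorial_Ring.prime p \<Longrightarrow> p \<in> prime_factors m \<longleftrightarrow> p dvd m" if "m \<in> udiv k" for p m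
    using udiv_pos[OF k0 that] by (auto simp: in_prime_factors_iff)
  have "bij_betw prime_factors (udiv k) (Pow (prime_factors k))"
    unfolding bij_betw_def
  proof (intro conjI inj_onI equalityI subsetI)
    show "a = b" if "a \<in> udiv k" "b \<in> udiv k" "prime_factors a = prime_factors b" for a b
      using that pf by (intro udiv_eqI[OF k0]) metis+
    show "S \<in> Pow (prime_factors k)" if "S \<in> prime_factors ` udiv k" for S
      using that k0 by (auto simp: udiv_def in_prime_factors_iff)
    show "S \<in> prime_factors ` udiv k" if S: "S \<in> Pow (prime_factors k)" for S
    proof (rule image_eqI)
      have fin: "finite S" using S finite_subset by blast
      have pr: "\<forall>p\<in>S. Factorial_Ring.prime p" using S by (auto simp: in_prime_factors_iff)
      have "(\<Prod>p\<in>S. p) dvd (\<Prod>p\<in>prime_factors k. p)" using S by (intro prod_dvd_prod_subset) auto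
      also have "\<dots> dvd (\<Prod>p\<in>prime_factors k. p ^ multiplicity p k)"
        by (intro prod_dvd_prod dvd_power) (auto simp: in_prime_factors_iff prime_multiplicity_gt_zero_iff)
      also have "\<dots> = k" using k0 by (simp add: prod_prime_factors)
      finally show "(\<Prod>p\<in>S. p) \<in> udiv k" using udiv_squarefree[OF assms] by simp
      show "S = prime_factors (\<Prod>p\<in>S. p)"
      proof -
        have "prime_factors (prod (\<lambda>p. p) S) = \<Union>((prime_factors \<circ> (\<lambda>p. p)) ` S)"
          by (rule prime_factors_prod) (use fin pr in auto)
        also have "\<dots> = S" using pr by (simp add: prime_prime_factors)
        finally show ?thesis by simp
      qed
    qed
  qed
  then show ?thesis using bij_betw_same_card by (metis card_Pow finite_set_mset)
qed

section \<open>The group of similarities of an integral lattice\<close>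

context
  fixes L :: "(real ^ 'n) set" and l :: nat
  assumes int: "integral_lattice L"
  defines "l \<equiv> lattice_level L"
begin

lemma integral_lattice_in: "lattice_in L" and integral_subset_dual: "L \<subseteq> dual_lattice L"
  using int by (auto simp: integral_lattice_def)

lemma level_pos: "l > 0" and level_dual: "x \<in> dual_lattice L \<Longrightarrow> real l *\<^sub>R x \<in> L"
  using lattice_level[OF int] by (auto simp: l_def)

lemma Zmodule_integral: "is_Zmodule L" and Zmodule_dual_integral: "is_Zmodule (dual_lattice L)"
  using integral_lattice_in by (simp_all add: Zmodule_lattice Zmodule_dual)

text \<open>The partial duals for \<open>m\<close> and \<open>l div m\<close> are dual to each
  other. One direction tests \<open>y\<close> against \<open>L\<close> and against
  \<open>l div m\<close> times the dual lattice, both contained in \<open>pdual m L\<close>; the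
  other combines two integrality statements by coprimality of \<open>m\<close> and
  \<open>l div m\<close>.\<close>

lemma dual_pdual:
  assumes m: "m \<in> udiv l"
  shows "(\<forall>z\<in>pdual m L. y \<bullet> z \<in> \<int>) \<longleftrightarrow> y \<in> pdual (l div m) L"
proof
  have ml: "m * (l div m) = l" "coprime m (l div m)" using m by (simp_all add: udiv_def)
  assume *: "\<forall>z\<in>pdual m L. y \<bullet> z \<in> \<int>"
  have "L \<subseteq> pdual m L" using integral_subset_dual is_ZmoduleD(5)[OF Zmodule_integral, of _ "real m"] by (auto simp: pdual_def)
  then have "y \<in> dual_lattice L" using * by (auto simp: dual_lattice_def)
  moreover have "real (l div m) *\<^sub>R y \<in> dual_lattice (dual_lattice L)"
    unfolding dual_lattice_def[of "dual_lattice L"]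
  proof (intro CollectI ballI)
    fix u assume u: "u \<in> dual_lattice L"
    have "real (l div m) *\<^sub>R u \<in> pdual m L"
      using u is_ZmoduleD(5)[OF Zmodule_dual_integral u, of "real (l div m)"] level_dual[OF u] ml(1) by (simp add: pdual_def flip: of_nat_mult)
    then show "real (l div m) *\<^sub>R y \<bullet> u \<in> \<int>" using * by auto
  qed
  ultimately show "y \<in> pdual (l div m) L" by (simp add: pdual_def dual_dual_lattice[OF integral_lattice_in])
next
  have ml: "m * (l div m) = l" "coprime m (l div m)" using m by (simp_all add: udiv_def)
  assume y: "y \<in> pdual (l div m) L"
  show "\<forall>z\<in>pdual m L. y \<bullet> z \<in> \<int>"
  proof
    fix z assume z: "z \<in> pdual m L"
    have Z: "is_Zmodule {c. y \<bullet> c \<in> \<int>}" by (simp add: is_Zmodule_def inner_diff_right)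
    have yz: "y \<in> dual_lattice L" "real (l div m) *\<^sub>R y \<in> L" "z \<in> dual_lattice L" "real m *\<^sub>R z \<in> L"
      using y z by (simp_all add: pdual_def)
    have "y \<bullet> (real m *\<^sub>R z) \<in> \<int>" using yz(1,4) unfolding dual_lattice_def by blast
    moreover have "z \<bullet> (real (l div m) *\<^sub>R y) \<in> \<int>" using yz(2,3) unfolding dual_lattice_def by blast
    then have "y \<bullet> (real (l div m) *\<^sub>R z) \<in> \<int>" by (simp add: inner_commute)
    ultimately have "real (gcd m (l div m)) *\<^sub>R z \<in> {c. y \<bullet> c \<in> \<int>}"
      by (intro Zmodule_gcd[OF Z] CollectI)
    then show "y \<bullet> z \<in> \<int>" using ml(2) by simp
  qed
qed

text \<open>The scaled map \<open>?T\<close> carries \<open>pdual m L\<close> onto \<open>L\<close>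
  and multiplies inner products by \<open>m\<close>. So \<open>?T x\<close> lies in the dual lattice
  exactly when \<open>m\<close> times \<open>x\<close> is integral on \<open>pdual m L\<close>, and
  \<open>dual_pdual\<close> describes this.\<close>

lemma simil_dual:
  assumes "(m, A) \<in> simil L"
  shows "sqrt (real m) *\<^sub>R (A *v x) \<in> dual_lattice L \<longleftrightarrow> real m *\<^sub>R x \<in> dual_lattice L \<and> real l *\<^sub>R x \<in> L"
proof -
  have A: "m \<in> udiv l" "orthogonal_matrix A" "\<And>x. sqrt (real m) *\<^sub>R (A *v x) \<in> L \<longleftrightarrow> x \<in> pdual m L"
    using assms by (simp_all add: simil_def l_def)
  let ?T = "\<lambda>x. sqrt (real m) *\<^sub>R (A *v x)"
  have m0: "m > 0" by (rule udiv_pos[OF level_pos A(1)])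
  have ml: "m * (l div m) = l" using A(1) by (simp add: udiv_def)
  have surj: "\<exists>z. y = ?T z" for y
  proof
    have "?T ((1 / sqrt (real m)) *\<^sub>R (transpose A *v y)) = (A ** transpose A) *v y"
      using m0 by (simp only: matrix_vector_mult_scaleR scaleR_scaleR matrix_vector_mul_assoc) simp
    then show "y = ?T ((1 / sqrt (real m)) *\<^sub>R (transpose A *v y))" using A(2) by (simp add: orthogonal_matrix_def)
  qed
  have inner: "?T x \<bullet> ?T z = (real m *\<^sub>R x) \<bullet> z" for z
    by (simp add: orthogonal_matrix_inner[OF A(2)] flip: mult.assoc)
  have "?T x \<in> dual_lattice L \<longleftrightarrow> (\<forall>z\<in>pdual m L. (real m *\<^sub>R x) \<bullet> z \<in> \<int>)"
  proof (intro iffI ballI)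
    fix z assume "?T x \<in> dual_lattice L" "z \<in> pdual m L"
    then have "?T x \<bullet> ?T z \<in> \<int>" unfolding dual_lattice_def A(3)[symmetric] by blast
    then show "(real m *\<^sub>R x) \<bullet> z \<in> \<int>" by (simp only: inner)
  next
    assume *: "\<forall>z\<in>pdual m L. (real m *\<^sub>R x) \<bullet> z \<in> \<int>"
    show "?T x \<in> dual_lattice L"
      unfolding dual_lattice_def
    proof (intro CollectI ballI)
      fix y assume "y \<in> L"
      moreover obtain z where "y = ?T z" using surj by blast
      ultimately show "?T x \<bullet> y \<in> \<int>" using * A(3) inner by metis
    qed
  qed
  also have "\<dots> \<longleftrightarrow> real m *\<^sub>R x \<in> pdual (l div m) L" by (rule dual_pdual[OF A(1)])
  also have "\<dots> \<longleftrightarrow> real m *\<^sub>R x \<in> dual_lattice L \<and> real l *\<^sub>R x \<in> L"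
    using ml by (simp add: pdual_def mult.commute flip: of_nat_mult)
  finally show ?thesis .
qed

text \<open>The composite of the two scaled maps is \<open>gcd m m'\<close> times the scaled map for
  \<open>umult m m'\<close>. Pulling membership in \<open>L\<close> back through both gives four
  conditions that merge pairwise: two on the dual lattice through \<open>gcd m m'\<close>, two on
  \<open>L\<close> through \<open>udiv_lcm\<close>.\<close>

lemma simil_mult:
  assumes 1: "(m, A) \<in> simil L" and 2: "(m', A') \<in> simil L"
  shows "(umult m m', A ** A') \<in> simil L"
proof -
  have A: "m \<in> udiv l" "orthogonal_matrix A" "\<And>x. sqrt (real m) *\<^sub>R (A *v x) \<in> L \<longleftrightarrow> x \<in> pdual m L"
    using 1 by (simp_all add: simil_def l_def)
  have A': "m' \<in> udiv l" "orthogonal_matrix A'" "\<And>x. sqrt (real m') *\<^sub>R (A' *v x) \<in> L \<longleftrightarrow> x \<in> pdual m' L"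
    using 2 by (simp_all add: simil_def l_def)
  let ?g = "gcd m m'" and ?u = "umult m m'"
  note U = udiv_lcm[OF level_pos A(1) A'(1)]
  have g0: "?g > 0" using udiv_pos[OF level_pos A(1)] by simp
  have sq: "sqrt (real m) * sqrt (real m') = sqrt (real ?u) * real ?g"
  proof -
    have "sqrt (real m) * sqrt (real m') = sqrt (real (?g * ?u * ?g))" unfolding U(2) by (simp add: real_sqrt_mult)
    also have "real (?g * ?u * ?g) = real ?u * (real ?g)\<^sup>2" by (simp add: power2_eq_square)
    finally show ?thesis by (simp add: real_sqrt_mult)
  qed
  have "sqrt (real ?u) *\<^sub>R ((A ** A') *v y) \<in> L \<longleftrightarrow> y \<in> pdual ?u L" for y
  proof -
    \<comment> \<open>Division by the gcd absorbs the extra factor of the composite.\<close>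
    define x where "x = (1 / real ?g) *\<^sub>R y"
    have "real ?g \<noteq> 0" using g0 by linarith
    then have y: "y = real ?g *\<^sub>R x" unfolding x_def by (simp del: gcd_eq_0_iff of_nat_eq_0_iff)
    have "sqrt (real ?u) *\<^sub>R ((A ** A') *v y) = sqrt (real m) *\<^sub>R (A *v (sqrt (real m') *\<^sub>R (A' *v x)))"
      by (simp only: y matrix_vector_mult_scaleR scaleR_scaleR sq matrix_vector_mul_assoc)
    then have "sqrt (real ?u) *\<^sub>R ((A ** A') *v y) \<in> L \<longleftrightarrow> sqrt (real m') *\<^sub>R (A' *v x) \<in> pdual m L"
      using A(3) by simp
    also have "\<dots> \<longleftrightarrow> sqrt (real m') *\<^sub>R (A' *v x) \<in> dual_lattice L \<and> sqrt (real m') *\<^sub>R (A' *v (real m *\<^sub>R x)) \<in> L"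
      by (simp add: pdual_def matrix_vector_mult_scaleR mult.commute)
    also have "\<dots> \<longleftrightarrow> (real m' *\<^sub>R x \<in> dual_lattice L \<and> real l *\<^sub>R x \<in> L)
        \<and> (real m *\<^sub>R x \<in> dual_lattice L \<and> real (m * m') *\<^sub>R x \<in> L)"
      unfolding simil_dual[OF 2] A'(3) by (simp add: pdual_def mult.commute)
    also have "\<dots> \<longleftrightarrow> real ?g *\<^sub>R x \<in> dual_lattice L \<and> real (?g * ?u) *\<^sub>R x \<in> L"
    proof (intro iffI conjI; (elim conjE)?)
      assume "real m' *\<^sub>R x \<in> dual_lattice L" "real m *\<^sub>R x \<in> dual_lattice L"
      then show "real ?g *\<^sub>R x \<in> dual_lattice L" using Zmodule_gcd[OF Zmodule_dual_integral] by blast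
    next
      assume "real l *\<^sub>R x \<in> L" "real (m * m') *\<^sub>R x \<in> L"
      then have "real (gcd l (m * m')) *\<^sub>R x \<in> L" by (rule Zmodule_gcd[OF Zmodule_integral])
      then show "real (?g * ?u) *\<^sub>R x \<in> L" by (simp only: U(1))
    next
      assume "real ?g *\<^sub>R x \<in> dual_lattice L"
      then show "real m' *\<^sub>R x \<in> dual_lattice L" "real m *\<^sub>R x \<in> dual_lattice L"
        using Zmodule_dvd[OF Zmodule_dual_integral] by blast+
    next
      assume *: "real (?g * ?u) *\<^sub>R x \<in> L"
      have "?g * ?u dvd l" "?g * ?u dvd m * m'" unfolding U(1)[symmetric] by simp_all
      then show "real l *\<^sub>R x \<in> L" "real (m * m') *\<^sub>R x \<in> L" using Zmodule_dvd[OF Zmodule_integral *] by blast+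
    qed
    also have "\<dots> \<longleftrightarrow> y \<in> pdual ?u L" by (simp add: y pdual_def mult.commute)
    finally show ?thesis .
  qed
  then show ?thesis using udiv_umult[OF level_pos A(1) A'(1)] orthogonal_matrix_mul[OF A(2) A'(2)]
    by (simp add: simil_def l_def)
qed

lemma simil_one: "(1, mat 1) \<in> simil L"
  using integral_subset_dual by (auto simp: simil_def one_udiv[unfolded One_nat_def] pdual_def orthogonal_matrix_id)

text \<open>Each \<open>m\<close> is its own inverse in \<open>W_group\<close>, so the inverse
  similarity carries the same factor. The conditions merge as in \<open>simil_mult\<close>, now with
  \<open>gcd l (m * m) = m\<close>.\<close>

lemma simil_inv:
  assumes 1: "(m, A) \<in> simil L"
  shows "(m, transpose A) \<in> simil L"
proof -
  have A: "m \<in> udiv l" "orthogonal_matrix A" "\<And>x. sqrt (real m) *\<^sub>R (A *v x) \<in> L \<longleftrightarrow> x \<in> pdual m L"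
    using 1 by (simp_all add: simil_def l_def)
  have m0: "m > 0" by (rule udiv_pos[OF level_pos A(1)])
  have "umult m m = 1" by (rule umult_self[OF m0])
  then have U: "gcd l (m * m) = m" using udiv_lcm(1)[OF level_pos A(1) A(1)] by simp
  have "sqrt (real m) *\<^sub>R (transpose A *v x) \<in> L \<longleftrightarrow> x \<in> pdual m L" for x
  proof -
    define y where "y = (1 / sqrt (real m)) *\<^sub>R (transpose A *v x)"
    have "sqrt (real m) *\<^sub>R (A *v y) = (A ** transpose A) *v x"
      using m0 by (simp only: y_def matrix_vector_mult_scaleR scaleR_scaleR matrix_vector_mul_assoc) simp
    then have x: "x = sqrt (real m) *\<^sub>R (A *v y)" using A(2) by (simp add: orthogonal_matrix_def)
    have "sqrt (real m) *\<^sub>R (transpose A *v x) = real m *\<^sub>R y" using m0 by (simp add: y_def real_div_sqrt)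
    moreover have "x \<in> pdual m L \<longleftrightarrow> (real m *\<^sub>R y \<in> dual_lattice L \<and> real l *\<^sub>R y \<in> L)
        \<and> (real m *\<^sub>R y \<in> dual_lattice L \<and> real (m * m) *\<^sub>R y \<in> L)"
    proof -
      have "real m *\<^sub>R x = sqrt (real m) *\<^sub>R (A *v (real m *\<^sub>R y))"
        by (simp add: x matrix_vector_mult_scaleR mult.commute)
      then have "x \<in> pdual m L \<longleftrightarrow> x \<in> dual_lattice L \<and> real m *\<^sub>R y \<in> pdual m L"
        by (simp add: pdual_def[of m L] A(3)[unfolded pdual_def])
      also have "x \<in> dual_lattice L \<longleftrightarrow> real m *\<^sub>R y \<in> dual_lattice L \<and> real l *\<^sub>R y \<in> L"
        unfolding x by (rule simil_dual[OF 1])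
      finally show ?thesis by (simp add: pdual_def)
    qed
    moreover have "real m *\<^sub>R y \<in> L" if "real l *\<^sub>R y \<in> L" "real (m * m) *\<^sub>R y \<in> L"
      using Zmodule_gcd[OF Zmodule_integral that] by (simp only: U)
    moreover have "real l *\<^sub>R y \<in> L" "real (m * m) *\<^sub>R y \<in> L" if "real m *\<^sub>R y \<in> L"
      using Zmodule_dvd[OF Zmodule_integral that, of l] Zmodule_dvd[OF Zmodule_integral that, of "m * m"] A(1) by (simp_all add: udiv_def)
    ultimately show ?thesis using integral_subset_dual by auto
  qed
  then show ?thesis using A by (simp add: simil_def l_def)
qed

lemma simil_preserves:
  assumes "(m, A) \<in> simil L" "x \<in> L"
  shows "sqrt (real m) *\<^sub>R (A *v x) \<in> L"
proof -
  have "x \<in> pdual m L" using assms(2) integral_subset_dual is_ZmoduleD(5)[OF Zmodule_integral assms(2), of "real m"] by (auto simp: pdual_def)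
  then show ?thesis using assms by (simp add: simil_def)
qed

lemma simil_trace:
  assumes "(m, A) \<in> simil L"
  shows "sqrt (real m) * trace A \<in> \<int>"
proof -
  obtain M N :: "real ^ 'n ^ 'n" where MN: "M ** N = mat 1" "N ** M = mat 1" and M: "L = (*v) M ` int_vectors"
    by (rule lattice_in_matrix[OF integral_lattice_in])
  define R where "R = N ** (sqrt (real m) *\<^sub>R A) ** M"
  have "R $ i $ j \<in> \<int>" for i j
  proof -
    have "axis j 1 \<in> int_vectors" by (simp add: int_vectors_def axis_def)
    then have "M *v axis j 1 \<in> L" using M by blast
    then have "sqrt (real m) *\<^sub>R (A *v (M *v axis j 1)) \<in> L" by (rule simil_preserves[OF assms])
    then obtain z where z: "z \<in> int_vectors" "sqrt (real m) *\<^sub>R (A *v (M *v axis j 1)) = M *v z" using M by blast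
    have "R *v axis j 1 = N *v (sqrt (real m) *\<^sub>R (A *v (M *v axis j 1)))"
      by (simp add: R_def scaleR_matrix_vector_assoc flip: matrix_vector_mul_assoc)
    also have "\<dots> = N *v (M *v z)" by (simp only: z(2))
    also have "\<dots> = z" by (simp add: matrix_vector_mul_assoc MN)
    finally show ?thesis using z(1) by (simp add: int_vectors_def matrix_vector_mult_basis column_def vec_eq_iff)
  qed
  then have "trace R \<in> \<int>" by (simp add: trace_def Ints_sum)
  moreover have "trace R = trace (sqrt (real m) *\<^sub>R A)"
    by (simp add: R_def trace_mul_sym[of _ M] matrix_mul_assoc MN)
  ultimately show ?thesis by (simp add: trace_def sum_distrib_left)
qed

text \<open>A similarity is determined by the images of a lattice basis, and these are lattice
  vectors of bounded length.\<close>

lemma finite_simil: "finite (simil L)"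
proof -
  obtain M N :: "real ^ 'n ^ 'n" where MN: "M ** N = mat 1" "N ** M = mat 1" and M: "L = (*v) M ` int_vectors"
    by (rule lattice_in_matrix[OF integral_lattice_in])
  define b where "b j = M *v axis j 1" for j
  define K where "K = (\<Sum>j\<in>UNIV. norm (b j))"
  define BL where "BL = {x \<in> L. norm x \<le> sqrt (real l) * K}"
  define f where "f = (\<lambda>(m, A :: real ^ 'n ^ 'n). (m, \<lambda>j. sqrt (real m) *\<^sub>R (A *v b j)))"
  have "f ` simil L \<subseteq> udiv l \<times> PiE UNIV (\<lambda>_. BL)"
  proof (rule image_subsetI)
    fix g assume "g \<in> simil L"
    then obtain m A where g: "g = (m, A)" and mA: "(m, A) \<in> simil L" by (cases g) auto
    have A: "m \<in> udiv l" "orthogonal_matrix A" using mA by (simp_all add: simil_def l_def)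
    have "sqrt (real m) *\<^sub>R (A *v b j) \<in> BL" for j
    proof -
      have "axis j 1 \<in> int_vectors" by (simp add: int_vectors_def axis_def)
      then have "b j \<in> L" using M by (auto simp: b_def)
      then have "sqrt (real m) *\<^sub>R (A *v b j) \<in> L" by (rule simil_preserves[OF mA])
      moreover have "norm (A *v b j) = norm (b j)" by (simp add: norm_eq_sqrt_inner orthogonal_matrix_inner[OF A(2)])
      moreover have "norm (b j) \<le> K" unfolding K_def by (rule member_le_sum) auto
      moreover have "m \<le> l" using A(1) level_pos by (auto simp: udiv_def dvd_imp_le)
      ultimately show ?thesis by (auto simp: BL_def intro!: mult_mono)
    qed
    then show "f g \<in> udiv l \<times> PiE UNIV (\<lambda>_. BL)" using A by (auto simp: f_def g PiE_def extensional_def)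
  qed
  moreover have "finite (udiv l \<times> PiE UNIV (\<lambda>_ :: 'n. BL))"
    using finite_bounded_lattice[OF integral_lattice_in] level_pos by (intro finite_cartesian_product finite_udiv finite_PiE) (auto simp: BL_def)
  moreover have "inj_on f (simil L)"
  proof (rule inj_onI, clarify)
    fix m A m' A' assume A: "(m, A) \<in> simil L" and "(m', A') \<in> simil L" and eq: "f (m, A) = f (m', A')"
    have m0: "m > 0" using A udiv_pos[OF level_pos] by (auto simp: simil_def l_def)
    have "m = m'" "\<And>j. sqrt (real m) *\<^sub>R (A *v b j) = sqrt (real m') *\<^sub>R (A' *v b j)"
      using eq by (auto simp: f_def dest: fun_cong)
    then have "(A ** M) *v axis j 1 = (A' ** M) *v axis j 1" for j
      using m0 by (simp add: b_def flip: matrix_vector_mul_assoc)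
    then have "A ** M = A' ** M" by (simp add: matrix_vector_mult_basis column_def vec_eq_iff)
    then have "A ** M ** N = A' ** M ** N" by simp
    then have "A = A'" by (simp add: MN flip: matrix_mul_assoc)
    then show "m = m' \<and> A = A'" using \<open>m = m'\<close> by simp
  qed
  ultimately show ?thesis by (metis finite_imageD finite_subset)
qed

lemma group_simil: "group (simil_group L)"
proof (rule groupI)
  note l0 = level_pos
  have mem: "fst g \<in> udiv l \<and> orthogonal_matrix (snd g)" if "g \<in> carrier (simil_group L)" for g
    using that by (auto simp: simil_group_def simil_def l_def)
  show "x \<otimes>\<^bsub>simil_group L\<^esub> y \<in> carrier (simil_group L)"
    if "x \<in> carrier (simil_group L)" "y \<in> carrier (simil_group L)" for x y
    using that simil_mult by (cases x; cases y) (auto simp: simil_group_def)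
  show "\<one>\<^bsub>simil_group L\<^esub> \<in> carrier (simil_group L)" using simil_one by (simp add: simil_group_def)
  show "x \<otimes>\<^bsub>simil_group L\<^esub> y \<otimes>\<^bsub>simil_group L\<^esub> z = x \<otimes>\<^bsub>simil_group L\<^esub> (y \<otimes>\<^bsub>simil_group L\<^esub> z)"
    if "x \<in> carrier (simil_group L)" "y \<in> carrier (simil_group L)" "z \<in> carrier (simil_group L)" for x y z
    using umult_assoc[OF l0, of "fst x" "fst y" "fst z"] mem[OF that(1)] mem[OF that(2)] mem[OF that(3)]
    by (simp add: simil_group_def split_beta matrix_mul_assoc)
  show "\<one>\<^bsub>simil_group L\<^esub> \<otimes>\<^bsub>simil_group L\<^esub> x = x" for x
    using umult_one(2)[of "fst x"] by (simp add: simil_group_def split_beta)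
  show "\<exists>y\<in>carrier (simil_group L). y \<otimes>\<^bsub>simil_group L\<^esub> x = \<one>\<^bsub>simil_group L\<^esub>"
    if x: "x \<in> carrier (simil_group L)" for x
  proof
    show "(fst x, transpose (snd x)) \<in> carrier (simil_group L)"
      using x simil_inv[of "fst x" "snd x"] by (simp add: simil_group_def)
    show "(fst x, transpose (snd x)) \<otimes>\<^bsub>simil_group L\<^esub> x = \<one>\<^bsub>simil_group L\<^esub>"
      using mem[OF x] umult_self[OF udiv_pos[OF l0, of "fst x"]]
      by (simp add: simil_group_def split_beta orthogonal_matrix_def)
  qed
qed

text \<open>The elements over a given \<open>m\<close> form a coset of those over 1. Taken for
  \<open>I_set\<close> and for \<open>B_set\<close>, this transfers the ratio of their cardinalities
  to the group of similarities.\<close>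

lemma card_simil: "Q \<subseteq> I_set L \<Longrightarrow> card {g \<in> simil L. fst g \<in> Q} = card {g \<in> simil L. fst g = 1} * card Q"
proof -
  interpret group "simil_group L" by (rule group_simil)
  assume Q: "Q \<subseteq> I_set L"
  note l0 = level_pos
  have fin: "finite (simil L)" by (rule finite_simil)
  have car: "carrier (simil_group L) = simil L" by (simp add: simil_group_def)
  have fst_mult: "fst (x \<otimes>\<^bsub>simil_group L\<^esub> y) = umult (fst x) (fst y)" for x y
    by (simp add: simil_group_def split_beta)
  have udiv: "fst g \<in> udiv l" if "g \<in> simil L" for g using that by (auto simp: simil_def l_def)
  have "card {g \<in> simil L. fst g = m} = card {g \<in> simil L. fst g = 1}" if m: "m \<in> Q" for m
  proof -
    obtain h where h: "h \<in> simil L" "fst h = m" using m Q by (auto simp: I_set_eq[OF int])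
    have m1: "umult m m = 1" using umult_self[OF udiv_pos[OF l0 udiv[OF h(1)]]] h(2) by simp
    have "bij_betw (\<lambda>g. h \<otimes>\<^bsub>simil_group L\<^esub> g) {g \<in> simil L. fst g = 1} {g \<in> simil L. fst g = m}"
    proof (rule bij_betwI')
      fix y assume y: "y \<in> {g \<in> simil L. fst g = m}"
      let ?x = "inv\<^bsub>simil_group L\<^esub> h \<otimes>\<^bsub>simil_group L\<^esub> y"
      have xc: "?x \<in> simil L" using h(1) y car by (metis (lifting) inv_closed m_closed mem_Collect_eq)
      have hx: "h \<otimes>\<^bsub>simil_group L\<^esub> ?x = y"
      proof -
        have "h \<in> carrier (simil_group L)" "y \<in> carrier (simil_group L)" using h(1) y car by auto
        then show ?thesis by (simp add: m_assoc[symmetric])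
      qed
      have "umult m (fst ?x) = m" using hx y fst_mult[of h ?x] h(2) by simp
      then have "umult m (umult m (fst ?x)) = 1" using m1 by simp
      then have "fst ?x = 1" using umult_assoc[OF l0 udiv[OF h(1)] udiv[OF h(1)] udiv[OF xc]] h(2) m1 umult_one(2)
        by simp
      then show "\<exists>x\<in>{g \<in> simil L. fst g = 1}. y = h \<otimes>\<^bsub>simil_group L\<^esub> x" using xc hx by (intro bexI[of _ ?x]) auto
    qed (use h in \<open>auto simp: car[symmetric] fst_mult umult_one[unfolded One_nat_def]\<close>)
    then show ?thesis by (rule bij_betw_same_card[symmetric])
  qed
  moreover have "finite Q" using Q fin by (auto simp: I_set_eq[OF int] intro: finite_subset)
  moreover have "card (\<Union>m\<in>Q. {g \<in> simil L. fst g = m}) = (\<Sum>m\<in>Q. card {g \<in> simil L. fst g = m})"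
    using fin \<open>finite Q\<close> by (intro card_UN_disjoint) auto
  moreover have "{g \<in> simil L. fst g \<in> Q} = (\<Union>m\<in>Q. {g \<in> simil L. fst g = m})" by auto
  ultimately show ?thesis by simp
qed

text \<open>This is \<open>degree_bound\<close> over the rationals for the complexified matrices.
  The premise is an equation between cardinalities, so that one proof serves both the quotient by
  \<open>B_set\<close> and squarefree levels.\<close>

theorem modularity_bound:
  assumes d: "card (I_set L) = 2 ^ d * card (B_set L)"
  shows "2 ^ ((d + 1) div 2) dvd CARD('n)"
proof -
  define \<rho> where "\<rho> g = cmatrix (snd g)" for g :: "nat \<times> (real ^ 'n ^ 'n)"
  define \<theta> where "\<theta> g = complex_of_real (sqrt (real (fst g)))" for g :: "nat \<times> (real ^ 'n ^ 'n)"
  define F :: "complex set" where "F = of_real ` \<rat>"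
  note l0 = level_pos
  interpret G: group "simil_group L" by (rule group_simil)
  have car: "carrier (simil_group L) = simil L" by (simp add: simil_group_def)
  interpret R: matrix_rep "simil_group L" \<rho>
    by unfold_locales (simp add: \<rho>_def cmatrix_mult simil_group_def split_beta)
  have fin: "finite (carrier (simil_group L))" using finite_simil car by simp
  have memF: "of_real x \<in> F \<longleftrightarrow> x \<in> \<rat>" for x by (auto simp: F_def)
  have pos: "fst g > 0" "fst g \<in> udiv l" if "g \<in> simil L" for g
  proof -
    show "fst g \<in> udiv l" using that by (auto simp: simil_def l_def)
    then show "fst g > 0" by (rule udiv_pos[OF l0])
  qed
  have tl: "trace_lines (simil_group L) \<rho> F \<theta>"
    unfolding trace_lines_def car
  proof (intro conjI ballI)
    show "is_subfield F" unfolding F_def by (rule is_subfield_Rats)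
    fix g assume g: "g \<in> simil L"
    show "\<theta> g \<noteq> 0" using pos(1)[OF g] by (simp add: \<theta>_def)
    have "(\<theta> g)\<^sup>2 = of_real (real (fst g))" by (simp add: \<theta>_def flip: of_real_power)
    then show "(\<theta> g)\<^sup>2 \<in> F" by (simp only: memF) simp
    \<comment> \<open>Extending the fraction by the square root of the factor leaves an integer over
      \<open>fst g\<close>.\<close>
    have "trace (\<rho> g) / \<theta> g = of_real (sqrt (real (fst g)) * trace (snd g) / real (fst g))"
      using pos(1)[OF g] by (simp add: \<rho>_def \<theta>_def trace_cmatrix field_simps flip: of_real_mult of_real_divide)
    moreover have "sqrt (real (fst g)) * trace (snd g) \<in> \<rat>"
      using simil_trace[of "fst g" "snd g"] g Ints_subset_Rats by auto
    ultimately show "trace (\<rho> g) / \<theta> g \<in> F" by (simp only: memF) (simp add: Rats_divide)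
    fix h assume h: "h \<in> simil L"
    let ?g = "gcd (fst g) (fst h)" and ?u = "umult (fst g) (fst h)"
    have u: "?g * ?u * ?g = fst g * fst h" by (rule udiv_lcm(2)[OF l0 pos(2)[OF g] pos(2)[OF h]])
    have gpos: "?g > 0" using pos(1)[OF g] by simp
    have "\<theta> (g \<otimes>\<^bsub>simil_group L\<^esub> h) / (\<theta> g * \<theta> h) = of_real (sqrt (real ?u) / sqrt (real (fst g * fst h)))"
      by (simp add: \<theta>_def simil_group_def split_beta real_sqrt_mult)
    also have "real (fst g * fst h) = real ?u * (real ?g)\<^sup>2" unfolding u[symmetric] by (simp add: power2_eq_square)
    also have "sqrt (real ?u) / sqrt (real ?u * (real ?g)\<^sup>2) = 1 / real ?g"
    proof -
      have "?u > 0" using u pos(1)[OF g] pos(1)[OF h] by (metis gr0I mult_0 mult_0_right nat_0_less_mult_iff)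
      then show ?thesis using gpos by (simp add: real_sqrt_mult del: gcd_pos_nat)
    qed
    finally show "\<theta> (g \<otimes>\<^bsub>simil_group L\<^esub> h) / (\<theta> g * \<theta> h) \<in> F" by (simp only: memF) simp
  qed
  have K: "{g \<in> carrier (simil_group L). \<theta> g \<in> F} = {g \<in> simil L. fst g \<in> B_set L}"
  proof -
    have "\<theta> g \<in> F \<longleftrightarrow> fst g \<in> B_set L" if g: "g \<in> simil L" for g
      using g sqrt_nat_rat_iff[OF pos(1)[OF g]] by (auto simp: \<theta>_def memF B_set_def I_set_eq[OF int])
    then show ?thesis by (auto simp: car)
  qed
  have BI: "B_set L \<subseteq> I_set L" by (auto simp: B_set_def)
  have "order (simil_group L) = 2 ^ d * card {g \<in> carrier (simil_group L). \<theta> g \<in> F}"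
  proof -
    have "simil L = {g \<in> simil L. fst g \<in> I_set L}" by (auto simp: I_set_eq[OF int])
    then have "order (simil_group L) = card {g \<in> simil L. fst g = 1} * card (I_set L)"
      using card_simil[of "I_set L"] by (simp add: order_def car)
    then show ?thesis unfolding K card_simil[OF BI] d by simp
  qed
  moreover have "trace (\<rho> \<one>\<^bsub>simil_group L\<^esub>) = of_nat CARD('n)"
    by (simp add: \<rho>_def simil_group_def trace_cmatrix trace_I)
  ultimately show ?thesis
    by (intro R.degree_bound[OF fin tl]) (auto simp: F_def \<theta>_def)
qed

section \<open>The bound on the quotient of modularities\<close>

lemma I_set_subgroup: "subgroup (I_set L) (W_group l)"
proof -
  note l0 = level_pos
  interpret W: comm_group "W_group l" by (rule W_group_comm[OF l0])
  have sub: "I_set L \<subseteq> udiv l" by (auto simp: I_set_def W_group_simps l_def)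
  show ?thesis
  proof (rule W.subgroupI)
    show "I_set L \<subseteq> carrier (W_group l)" using sub by (simp add: W_group_simps)
    show "I_set L \<noteq> {}" using simil_one unfolding I_set_eq[OF int] by blast
    show "inv\<^bsub>W_group l\<^esub> m \<in> I_set L" if "m \<in> I_set L" for m
    proof -
      have m: "m \<in> udiv l" using that sub by blast
      have "inv\<^bsub>W_group l\<^esub> m = m"
        by (rule W.inv_equality) (use m umult_self[OF udiv_pos[OF l0 m]] in \<open>simp_all add: W_group_simps\<close>)
      then show ?thesis using that by simp
    qed
    show "a \<otimes>\<^bsub>W_group l\<^esub> b \<in> I_set L" if "a \<in> I_set L" "b \<in> I_set L" for a b
    proof -
      obtain A B where "(a, A) \<in> simil L" "(b, B) \<in> simil L" using \<open>a \<in> I_set L\<close> \<open>b \<in> I_set L\<close>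
        by (auto simp: I_set_eq[OF int])
      then have "(umult a b, A ** B) \<in> simil L" by (rule simil_mult)
      then show ?thesis unfolding W_group_simps I_set_eq[OF int] by force
    qed
  qed
qed

lemma I_group_comm: "comm_group (I_group L)"
proof -
  interpret W: comm_group "W_group l" by (rule W_group_comm[OF level_pos])
  interpret I: group "(W_group l)\<lparr>carrier := I_set L\<rparr>" by (rule W.subgroup_imp_group[OF I_set_subgroup])
  have "comm_group ((W_group l)\<lparr>carrier := I_set L\<rparr>)"
    by (rule I.group_comm_groupI) (use W.m_comm subgroup.mem_carrier[OF I_set_subgroup] in simp)
  then show ?thesis by (simp add: I_group_def l_def)
qed

lemma I_group_simps: "carrier (I_group L) = I_set L" "m \<otimes>\<^bsub>I_group L\<^esub> m' = umult m m'" "\<one>\<^bsub>I_group L\<^esub> = 1"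
  by (simp_all add: I_group_def W_group_simps)

text \<open>With \<open>g\<close> the gcd of the two squares, \<open>g\<^sup>2\<close> times their
  group product is \<open>(i * j)\<^sup>2\<close>; hence \<open>g\<close> divides
  \<open>i * j\<close>, and the group product is the square of the quotient.\<close>

lemma umult_square:
  assumes "i \<ge> 1" "j \<ge> 1" "i\<^sup>2 \<in> udiv l" "j\<^sup>2 \<in> udiv l"
  shows "\<exists>k\<ge>1. umult (i\<^sup>2) (j\<^sup>2) = k\<^sup>2"
proof -
  note l0 = level_pos
  define g where "g = gcd (i\<^sup>2) (j\<^sup>2)"
  have eq: "g\<^sup>2 * umult (i\<^sup>2) (j\<^sup>2) = (i * j)\<^sup>2"
    using udiv_lcm(2)[OF l0 assms(3,4)] by (simp add: g_def power2_eq_square mult_ac)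
  then have "g\<^sup>2 dvd (i * j)\<^sup>2" by (metis dvd_triv_left)
  then have "g dvd i * j" by simp
  then obtain c where c: "i * j = g * c" by blast
  have "g > 0" using assms(1) by (simp add: g_def)
  then have "umult (i\<^sup>2) (j\<^sup>2) = c\<^sup>2" using eq c by (simp add: power_mult_distrib)
  moreover have "c \<ge> 1" using c assms(1,2) by (cases c) auto
  ultimately show ?thesis by blast
qed

lemma B_set_subgroup: "subgroup (B_set L) (I_group L)"
proof -
  note l0 = level_pos
  interpret I: comm_group "I_group L" by (rule I_group_comm)
  have sub: "I_set L \<subseteq> udiv l" by (auto simp: I_set_def W_group_simps l_def)
  show ?thesis
  proof (rule I.subgroupI)
    show "B_set L \<subseteq> carrier (I_group L)" by (auto simp: B_set_def I_group_simps)
    have "1 \<in> I_set L" using I.one_closed by (simp only: I_group_simps)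
    then have "1 \<in> B_set L" by (auto simp: B_set_def intro!: exI[of _ 1])
    then show "B_set L \<noteq> {}" by blast
    show "inv\<^bsub>I_group L\<^esub> m \<in> B_set L" if "m \<in> B_set L" for m
    proof -
      have mI: "m \<in> I_set L" using that by (simp add: B_set_def)
      then have m: "m \<in> udiv l" using sub by blast
      have "inv\<^bsub>I_group L\<^esub> m = m"
        by (rule I.inv_equality) (use m mI umult_self[OF udiv_pos[OF l0 m]] in \<open>simp_all add: I_group_simps\<close>)
      then show ?thesis using that by simp
    qed
    show "a \<otimes>\<^bsub>I_group L\<^esub> b \<in> B_set L" if ab: "a \<in> B_set L" "b \<in> B_set L" for a b
    proof -
      obtain i j where ij: "a = i\<^sup>2" "b = j\<^sup>2" "i \<ge> 1" "j \<ge> 1" "a \<in> I_set L" "b \<in> I_set L"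
        using ab by (auto simp: B_set_def)
      have "umult a b \<in> I_set L" using I.m_closed[of a b] ij by (simp add: I_group_simps)
      moreover have "\<exists>k\<ge>1. umult a b = k\<^sup>2" using umult_square[of i j] ij sub by blast
      ultimately show ?thesis by (auto simp: B_set_def I_group_simps)
    qed
  qed
qed

lemma card_I_set: "card (I_set L) = 2 ^ F2_dim (I_group L Mod B_set L) * card (B_set L)"
proof -
  note l0 = level_pos
  interpret I: comm_group "I_group L" by (rule I_group_comm)
  have sub: "I_set L \<subseteq> udiv l" by (auto simp: I_set_def W_group_simps l_def)
  have finI: "finite (I_set L)" using finite_udiv[OF l0] sub by (rule finite_subset[rotated])
  have nor: "B_set L \<lhd> I_group L" using I.subgroup_imp_normal[OF B_set_subgroup] .
  interpret N: normal "B_set L" "I_group L" by (rule nor)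
  have Q: "comm_group (I_group L Mod B_set L)" using I.abelian_FactGroup[OF B_set_subgroup] .
  have "card (carrier (I_group L Mod B_set L)) = 2 ^ F2_dim (I_group L Mod B_set L)"
  proof (rule card_eq_two_power_F2_dim[OF Q])
    fix c assume "c \<in> carrier (I_group L Mod B_set L)"
    then obtain m where m: "m \<in> I_set L" "c = B_set L #>\<^bsub>I_group L\<^esub> m"
      by (auto simp: carrier_FactGroup I_group_simps)
    have "umult m m = 1" using umult_self[OF udiv_pos[OF l0]] m(1) sub by blast
    then have "B_set L #>\<^bsub>I_group L\<^esub> (m \<otimes>\<^bsub>I_group L\<^esub> m) = B_set L #>\<^bsub>I_group L\<^esub> \<one>\<^bsub>I_group L\<^esub>"
      by (simp only: I_group_simps)
    then show "c \<otimes>\<^bsub>I_group L Mod B_set L\<^esub> c = \<one>\<^bsub>I_group L Mod B_set L\<^esub>"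
      using m N.rcos_sum[of m m] N.subset by (simp add: I_group_simps)
        (metis I.coset_mult_one I_group_simps(3) N.subset One_nat_def)
  next
    show "finite (carrier (I_group L Mod B_set L))" using finI by (simp add: carrier_FactGroup I_group_simps)
  qed
  moreover have "card (carrier (I_group L Mod B_set L)) * card (B_set L) = card (I_set L)"
    using I.lagrange[OF B_set_subgroup] by (simp add: FactGroup_def order_def I_group_simps)
  ultimately show ?thesis by simp
qed

theorem F2_dim_bound: "F2_dim (I_group L Mod B_set L) \<le> 2 * multiplicity 2 CARD('n)"
proof -
  let ?D = "F2_dim (I_group L Mod B_set L)"
  have "2 ^ ((?D + 1) div 2) dvd CARD('n)" by (rule modularity_bound[OF card_I_set])
  then have "(?D + 1) div 2 \<le> multiplicity 2 CARD('n)" by (intro multiplicity_geI) auto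
  then show ?thesis by linarith
qed

text \<open>For squarefree level \<open>B_set\<close> is trivial, and the group of all divisors
  needs as many generators as there are primes.\<close>

theorem strongly_modular_bound:
  assumes sm: "strongly_modular L" and sq: "squarefree l"
  shows "size (prime_factorization l) \<le> 2 * multiplicity 2 CARD('n)"
proof -
  have I: "I_set L = udiv l" using sm by (simp add: strongly_modular_def W_group_simps l_def)
  have "B_set L = {1}"
  proof (intro equalityI subsetI)
    fix m assume "m \<in> B_set L"
    then obtain i where i: "m = i\<^sup>2" "m dvd l" by (auto simp: B_set_def I udiv_def)
    then have "is_unit i" using sq by (auto simp: squarefree_def)
    then show "m \<in> {1}" using i by simp
  qed (auto simp: B_set_def I one_udiv[unfolded One_nat_def] intro!: exI[of _ 1])
  then have "card (I_set L) = 2 ^ size (prime_factorization l) * card (B_set L)"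
    using card_divisors_squarefree[OF sq] size_prime_factorization_squarefree[OF sq] by (simp add: I)
  then have "2 ^ ((size (prime_factorization l) + 1) div 2) dvd CARD('n)" by (rule modularity_bound)
  then have "(size (prime_factorization l) + 1) div 2 \<le> multiplicity 2 CARD('n)" by (intro multiplicity_geI) auto
  then show ?thesis by linarith
qed

end

section \<open>Legendre's equation\<close>

text \<open>A prime factor of \<open>x\<^sup>2 + 1\<close>, where \<open>x\<close> is twice a
  factorial, is odd, exceeds \<open>N\<close> and has -1 as a quadratic residue; Fermat's little
  theorem then excludes 3 modulo 4.\<close>

lemma prime_one_mod_four_unbounded: "\<exists>p::nat. Factorial_Ring.prime p \<and> p > N \<and> p mod 4 = 1"
proof -
  define x :: nat where "x = 2 * fact N"
  have "x\<^sup>2 + 1 \<noteq> (1::nat)" by (simp add: x_def)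
  then obtain p where p: "Factorial_Ring.prime p" "p dvd x\<^sup>2 + 1" using prime_factor_nat by metis
  have np: "\<not> p dvd x"
  proof
    assume "p dvd x"
    then have "p dvd x\<^sup>2" by (simp add: power2_eq_square)
    then have "p dvd (x\<^sup>2 + 1) - x\<^sup>2" by (rule dvd_diff_nat[OF p(2)])
    then show False using p(1) by simp
  qed
  have "p > N"
  proof (rule ccontr)
    assume "\<not> p > N"
    then have "p dvd fact N" using p(1) prime_gt_0_nat by (intro dvd_fact) (auto simp: Suc_le_eq)
    then show False using np by (simp add: x_def)
  qed
  have "p \<noteq> 2" using np by (auto simp: x_def)
  then have odd: "odd p" using p(1) prime_odd_nat prime_ge_2_nat by (metis le_neq_implies_less)
  have "p mod 4 = 1"
  proof (rule ccontr)
    assume "p mod 4 \<noteq> 1"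
    then have "p mod 4 = 3" using odd by presburger
    then have o: "odd ((p - 1) div 2)" "2 * ((p - 1) div 2) = p - 1" by presburger+
    have "[int x ^ (p - 1) = 1] (mod int p)"
      using fermat_theorem[OF p(1) np] by (metis cong_int_iff of_nat_1 of_nat_power)
    moreover have "[(int x)\<^sup>2 = - 1] (mod int p)"
    proof -
      have "int p dvd int (x\<^sup>2 + 1)" using p(2) by (simp only: of_nat_dvd_iff)
      then show ?thesis by (simp add: cong_iff_dvd_diff add.commute)
    qed
    then have "[((int x)\<^sup>2) ^ ((p - 1) div 2) = (- 1) ^ ((p - 1) div 2)] (mod int p)" by (rule cong_pow)
    then have "[int x ^ (p - 1) = - 1] (mod int p)" using o by (simp flip: power_mult)
    ultimately have "[1 = - 1] (mod int p)" by (metis cong_sym cong_trans)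
    then have "int p dvd 2" by (simp add: cong_iff_dvd_diff)
    then have "p dvd 2" by (metis of_nat_dvd_iff of_nat_numeral)
    then show False using \<open>p \<noteq> 2\<close> p(1) by (metis primes_dvd_imp_eq two_is_prime_nat)
  qed
  then show ?thesis using p \<open>p > N\<close> by blast
qed

text \<open>With \<open>p mod 4 = 1\<close>, take for \<open>q\<close> a prime factor of
  \<open>p * M\<^sup>2 - 1\<close>: then \<open>p * M\<close> is a square root of \<open>p\<close>
  modulo \<open>q\<close>, and quadratic reciprocity supplies the other residue. No theorem on
  primes in progressions enters. The bound \<open>N\<close> serves to avoid primes already
  used.\<close>

lemma prime_pair_residues:
  "\<exists>p q::nat. Factorial_Ring.prime p \<and> Factorial_Ring.prime q \<and> p > N \<and> q > N \<and> p \<noteq> q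
     \<and> (\<exists>\<alpha>. [\<alpha>\<^sup>2 = int p] (mod int q)) \<and> (\<exists>\<beta>. [\<beta>\<^sup>2 = int q] (mod int p))"
proof -
  obtain p :: nat where p: "Factorial_Ring.prime p" "p > N" "p mod 4 = 1" using prime_one_mod_four_unbounded by blast
  \<comment> \<open>The factor 2 makes \<open>q\<close> odd, and the factorial makes it exceed
    \<open>N\<close>.\<close>
  define M :: nat where "M = 2 * fact N"
  define Q where "Q = p * M\<^sup>2 - 1"
  have "M \<ge> 2" using fact_ge_1[of N, where 'a = nat] by (simp add: M_def)
  then have M1: "M\<^sup>2 \<ge> 2" using mult_le_mono[of 2 M 1 M] by (simp add: power2_eq_square)
  have p2: "p \<ge> 2" using p(1) prime_ge_2_nat by blast
  have "p * M\<^sup>2 > 0" using M1 p2 by (intro mult_pos_pos) linarith+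
  then have pM: "p * M\<^sup>2 = Q + 1" unfolding Q_def by linarith
  have "Q \<noteq> 1"
  proof
    assume "Q = 1"
    then have "p * M\<^sup>2 = 2" using pM by simp
    moreover have "p * M\<^sup>2 \<ge> 2 * 2" using p2 M1 by (rule mult_le_mono)
    ultimately show False by simp
  qed
  then obtain q where q: "Factorial_Ring.prime q" "q dvd Q" using prime_factor_nat by blast
  have nq: "\<not> q dvd p * M\<^sup>2"
  proof
    assume "q dvd p * M\<^sup>2"
    then have "q dvd (Q + 1) - Q" unfolding pM using q(2) by (rule dvd_diff_nat)
    then show False using q(1) by simp
  qed
  have "q \<noteq> p" using nq by auto
  have nqM: "\<not> q dvd M" using nq by (auto simp: power2_eq_square)
  have qN: "q > N"
  proof (rule ccontr)
    assume "\<not> q > N"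
    then have "q dvd fact N" using q(1) prime_gt_0_nat by (intro dvd_fact) (auto simp: Suc_le_eq)
    then show False using nqM by (simp add: M_def)
  qed
  have "q \<noteq> 2" using nqM by (auto simp: M_def)
  then have q2: "q > 2" using q(1) prime_ge_2_nat by (metis le_neq_implies_less)
  have p2': "p > 2" using p2 p(3) by (cases "p = 2") auto
  have \<alpha>: "[(int (p * M))\<^sup>2 = int p] (mod int q)"
  proof -
    have "(int (p * M))\<^sup>2 - int p = int p * int Q"
    proof -
      have "(int (p * M))\<^sup>2 = int p * int (p * M\<^sup>2)" by (simp add: power2_eq_square)
      then show ?thesis unfolding pM by (simp add: algebra_simps)
    qed
    then show ?thesis using q(2) by (simp add: cong_iff_dvd_diff)
  qed
  then have "QuadRes (int q) (int p)" by (auto simp: QuadRes_def)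
  moreover have "\<not> [int p = 0] (mod int q)" using q(1) p(1) \<open>q \<noteq> p\<close>
    by (simp add: cong_0_iff primes_dvd_imp_eq) (metis primes_dvd_imp_eq)
  ultimately have L1: "Legendre (int p) (int q) = 1" by (simp add: Legendre_def)
  have "even ((p - 1) div 2)" using p(3) by presburger
  then have "Legendre (int p) (int q) * Legendre (int q) (int p) = 1"
    using Quadratic_Reciprocity[OF p(1) p2' q(1) q2] \<open>q \<noteq> p\<close> by (simp add: power_mult)
  then have "Legendre (int q) (int p) = 1" using L1 by simp
  then have "QuadRes (int p) (int q)" by (auto simp: Legendre_def split: if_splits)
  then show ?thesis using p q qN \<open>q \<noteq> p\<close> \<alpha> by (auto simp: QuadRes_def)
qed

lemma nat_sqrt_exists: "\<exists>a::nat. a\<^sup>2 \<le> n \<and> n < (a + 1)\<^sup>2"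
proof (induction n)
  case (Suc n)
  then obtain a where a: "a\<^sup>2 \<le> n" "n < (a + 1)\<^sup>2" by blast
  show ?case
  proof (cases "Suc n < (a + 1)\<^sup>2")
    case True
    then show ?thesis using a by (intro exI[of _ a]) simp
  next
    case False
    then have "Suc n = (a + 1)\<^sup>2" using a by simp
    then show ?thesis by (intro exI[of _ "a + 1"]) (simp add: power2_eq_square)
  qed
qed (auto intro: exI[of _ 0])

lemma prime_not_square: "Factorial_Ring.prime (p::nat) \<Longrightarrow> p \<noteq> a\<^sup>2"
  using prime_power_iff[of a 2] by auto

lemma prime_prod_not_square:
  assumes "Factorial_Ring.prime (p::nat)" "Factorial_Ring.prime q" "p \<noteq> q"
  shows "p * q \<noteq> a\<^sup>2"
proof
  assume eq: "p * q = a\<^sup>2"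
  then have "p dvd a\<^sup>2" by (metis dvd_triv_left)
  then have "p dvd a" using assms(1) prime_dvd_power by blast
  then have "p * p dvd p * q" unfolding eq power2_eq_square by (rule mult_dvd_mono[OF _ \<open>p dvd a\<close>])
  then have "p dvd q" using assms(1) by (simp add: prime_gt_0_nat)
  then show False using assms primes_dvd_imp_eq by blast
qed

text \<open>Pigeonhole in a box with sides about the square roots of \<open>q\<close>,
  \<open>p\<close> and \<open>p * q\<close>: it has more than \<open>p * q\<close> points, so two of
  them agree under both congruences, and their difference makes
  \<open>D = z\<^sup>2 - p x\<^sup>2 - q y\<^sup>2\<close> divisible by \<open>p * q\<close>. The
  size of the box leaves only \<open>D = 0\<close> and \<open>D = - p q\<close>.\<close>

lemma legendre_equation:
  fixes p q :: nat
  assumes pq: "Factorial_Ring.prime p" "Factorial_Ring.prime q" "p \<noteq> q"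
    and \<alpha>: "[\<alpha>\<^sup>2 = int p] (mod int q)" and \<beta>: "[\<beta>\<^sup>2 = int q] (mod int p)"
  shows "\<exists>x y z::int. z\<^sup>2 = int p * x\<^sup>2 + int q * y\<^sup>2 \<and> (x \<noteq> 0 \<or> y \<noteq> 0)"
proof -
  obtain a where a: "a\<^sup>2 \<le> q" "q < (a + 1)\<^sup>2" using nat_sqrt_exists by blast
  obtain b where b: "b\<^sup>2 \<le> p" "p < (b + 1)\<^sup>2" using nat_sqrt_exists by blast
  obtain c where c: "c\<^sup>2 \<le> p * q" "p * q < (c + 1)\<^sup>2" using nat_sqrt_exists by blast
  \<comment> \<open>Strictness, due to \<open>p\<close>, \<open>q\<close> and \<open>p * q\<close>
    not being squares, excludes the boundary values of \<open>D\<close>.\<close>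
  have lt: "a\<^sup>2 < q" "b\<^sup>2 < p" "c\<^sup>2 < p * q"
    using a b c prime_not_square[OF pq(2), of a] prime_not_square[OF pq(1), of b] prime_prod_not_square[OF pq, of c]
    by (simp_all add: order_less_le)
  define S where "S = {0..int a} \<times> {0..int b} \<times> {0..int c}"
  define f where "f = (\<lambda>(x, y, z). ((z - \<alpha> * x) mod int q, (z - \<beta> * y) mod int p))"
  have p0: "p > 0" "q > 0" using pq by (simp_all add: prime_gt_0_nat)
  have "f ` S \<subseteq> {0..<int q} \<times> {0..<int p}" using p0 by (auto simp: f_def)
  then have "card (f ` S) \<le> card ({0..<int q} \<times> {0..<int p})" by (intro card_mono) auto
  also have "\<dots> = p * q" by (simp add: card_cartesian_product)
  also have "p * q < card S"
  proof -
    have "(p * q)\<^sup>2 = q * (p * (p * q))" by (simp add: power2_eq_square)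
    also have "\<dots> < (a + 1)\<^sup>2 * ((b + 1)\<^sup>2 * (c + 1)\<^sup>2)"
      using a(2) b(2) c(2) by (intro mult_strict_mono) auto
    also have "\<dots> = ((a + 1) * ((b + 1) * (c + 1)))\<^sup>2" by (simp only: power_mult_distrib)
    finally have "p * q < (a + 1) * ((b + 1) * (c + 1))" by (rule power_less_imp_less_base) simp
    then show ?thesis by (simp add: S_def card_cartesian_product nat_add_distrib)
  qed
  finally have "\<not> inj_on f S" using card_image[of f S] by auto
  then obtain s t where st: "s \<in> S" "t \<in> S" "s \<noteq> t" "f s = f t" unfolding inj_on_def by blast
  obtain x1 y1 z1 x2 y2 z2 where s: "s = (x1, y1, z1)" "t = (x2, y2, z2)" by (cases s; cases t)
  define x y z where "x = x1 - x2" and "y = y1 - y2" and "z = z1 - z2"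
  have nz: "x \<noteq> 0 \<or> y \<noteq> 0 \<or> z \<noteq> 0" using st s by (auto simp: x_def y_def z_def)
  have "\<bar>x\<bar> \<le> int a" "\<bar>y\<bar> \<le> int b" "\<bar>z\<bar> \<le> int c"
    using st s by (auto simp: S_def x_def y_def z_def)
  then have "x\<^sup>2 \<le> (int a)\<^sup>2" "y\<^sup>2 \<le> (int b)\<^sup>2" "z\<^sup>2 \<le> (int c)\<^sup>2"
    by (simp_all flip: abs_le_square_iff)
  then have x2: "x\<^sup>2 < int q" "y\<^sup>2 < int p" "z\<^sup>2 < int p * int q"
    using lt by (simp_all flip: of_nat_power of_nat_mult)
  have "[z1 - \<alpha> * x1 = z2 - \<alpha> * x2] (mod int q)" "[z1 - \<beta> * y1 = z2 - \<beta> * y2] (mod int p)"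
    using st(4) by (simp_all add: s f_def cong_def)
  then have "int q dvd z - \<alpha> * x" "int p dvd z - \<beta> * y"
    by (simp_all add: cong_iff_dvd_diff x_def y_def z_def algebra_simps)
  then have d1: "int q dvd (z - \<alpha> * x) * (z + \<alpha> * x)" "int p dvd (z - \<beta> * y) * (z + \<beta> * y)" by simp_all
  have d2: "int q dvd \<alpha>\<^sup>2 - int p" "int p dvd \<beta>\<^sup>2 - int q" using \<alpha> \<beta> by (simp_all add: cong_iff_dvd_diff)
  define D where "D = z\<^sup>2 - int p * x\<^sup>2 - int q * y\<^sup>2"
  have "D = (z - \<alpha> * x) * (z + \<alpha> * x) + (\<alpha>\<^sup>2 - int p) * x\<^sup>2 - int q * y\<^sup>2"
    by (simp add: D_def algebra_simps power2_eq_square)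
  then have "int q dvd D" using d1(1) d2(1) by (metis dvd_add dvd_diff dvd_mult2 dvd_triv_left)
  moreover have "D = (z - \<beta> * y) * (z + \<beta> * y) + (\<beta>\<^sup>2 - int q) * y\<^sup>2 - int p * x\<^sup>2"
    by (simp add: D_def algebra_simps power2_eq_square)
  then have "int p dvd D" using d1(2) d2(2) by (metis dvd_add dvd_diff dvd_mult2 dvd_triv_left)
  moreover have "coprime (int p) (int q)" using pq by (simp add: primes_coprime)
  ultimately have "int p * int q dvd D" by (simp add: divides_mult)
  then obtain u where u: "D = int p * int q * u" by blast
  have pq0: "int p * int q > 0" using p0 by simp
  have "int p * x\<^sup>2 < int p * int q" "int q * y\<^sup>2 < int q * int p" using x2 p0 by simp_all
  moreover have "int q * int p = int p * int q" by simp
  moreover have "0 \<le> int p * x\<^sup>2" "0 \<le> int q * y\<^sup>2" "0 \<le> z\<^sup>2" by simp_all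
  ultimately have "D < int p * int q" "D > - 2 * (int p * int q)" using x2(3) unfolding D_def by linarith+
  then have "int p * int q * u < int p * int q * 1" "int p * int q * (- 2) < int p * int q * u"
    by (simp_all add: u mult.commute)
  then have "u < 1" "- 2 < u" using pq0 by (simp_all only: mult_less_cancel_left_pos)
  then consider "u = 0" | "u = - 1" by linarith
  then show ?thesis
  proof cases
    case 1
    then have eq: "z\<^sup>2 = int p * x\<^sup>2 + int q * y\<^sup>2" using u by (simp add: D_def)
    moreover have "x \<noteq> 0 \<or> y \<noteq> 0" using nz eq by auto
    ultimately show ?thesis by blast
  next
    text \<open>Composing the solution of \<open>p x\<^sup>2 + q y\<^sup>2 = z\<^sup>2 + p q\<close> with itself removes the term \<open>p q\<close>.\<close>
    case 2
    then have eq: "int p * x\<^sup>2 + int q * y\<^sup>2 = z\<^sup>2 + int p * int q" using u by (simp add: D_def)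
    define x' y' where "x' = x * z + int q * y" and "y' = y * z - int p * x"
    have "int p * x'\<^sup>2 + int q * y'\<^sup>2 = (int p * x\<^sup>2 + int q * y\<^sup>2) * (z\<^sup>2 + int p * int q)"
      by (simp add: x'_def y'_def algebra_simps power2_eq_square)
    then have eq': "(z\<^sup>2 + int p * int q)\<^sup>2 = int p * x'\<^sup>2 + int q * y'\<^sup>2"
      unfolding eq by (simp add: power2_eq_square)
    have "z\<^sup>2 + int p * int q > 0" using pq0 by (simp add: add_nonneg_pos)
    then have "(z\<^sup>2 + int p * int q)\<^sup>2 > 0" by simp
    then have "x' \<noteq> 0 \<or> y' \<noteq> 0" unfolding eq' by auto
    then show ?thesis using eq' by blast
  qed
qed

text \<open>Divides a solution by the gcd of \<open>x\<close> and \<open>y\<close>. Neither of them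
  can vanish, since the other would then be 1 or -1 and a prime would be a square.\<close>

lemma legendre_equation_coprime:
  fixes p q :: nat
  assumes pq: "Factorial_Ring.prime p" "Factorial_Ring.prime q" "p \<noteq> q"
    and "[\<alpha>\<^sup>2 = int p] (mod int q)" "[\<beta>\<^sup>2 = int q] (mod int p)"
  shows "\<exists>x y z::int. z\<^sup>2 = int p * x\<^sup>2 + int q * y\<^sup>2 \<and> coprime x y \<and> x \<noteq> 0 \<and> y \<noteq> 0 \<and> z > 0"
proof -
  obtain x y z :: int where xyz: "z\<^sup>2 = int p * x\<^sup>2 + int q * y\<^sup>2" "x \<noteq> 0 \<or> y \<noteq> 0"
    using legendre_equation[OF assms] by blast
  define g where "g = gcd x y"
  have g0: "g \<noteq> 0" using xyz(2) by (simp add: g_def)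
  from gcd_coprime_exists[OF g0[unfolded g_def]] obtain x' y' where x': "x = x' * g" "y = y' * g" "coprime x' y'"
    unfolding g_def by blast
  have z2: "z\<^sup>2 = g\<^sup>2 * (int p * x'\<^sup>2 + int q * y'\<^sup>2)" unfolding xyz(1) x'(1,2) by (simp add: algebra_simps power2_eq_square)
  then have "g\<^sup>2 dvd z\<^sup>2" by simp
  then have "g dvd z" by simp
  then obtain z' where z': "z = g * z'" by blast
  have eq: "z'\<^sup>2 = int p * x'\<^sup>2 + int q * y'\<^sup>2" using z2 g0 by (simp add: z' power_mult_distrib)
  have "x' \<noteq> 0"
  proof
    assume "x' = 0"
    then have "\<bar>y'\<bar> = 1" using x'(3) by simp
    then have "y'\<^sup>2 = 1" by (metis power2_abs one_power2)
    then have "int q = int ((nat \<bar>z'\<bar>)\<^sup>2)" using eq \<open>x' = 0\<close> by simp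
    then show False using prime_not_square[OF pq(2)] of_nat_eq_iff by metis
  qed
  moreover have "y' \<noteq> 0"
  proof
    assume "y' = 0"
    then have "\<bar>x'\<bar> = 1" using x'(3) by simp
    then have "x'\<^sup>2 = 1" by (metis power2_abs one_power2)
    then have "int p = int ((nat \<bar>z'\<bar>)\<^sup>2)" using eq \<open>y' = 0\<close> by simp
    then show False using prime_not_square[OF pq(1)] of_nat_eq_iff by metis
  qed
  moreover have "z' \<noteq> 0"
  proof
    assume "z' = 0"
    have "int p * x'\<^sup>2 > 0" using \<open>x' \<noteq> 0\<close> pq by (simp add: prime_gt_0_nat)
    moreover have "int q * y'\<^sup>2 \<ge> 0" by simp
    moreover have "z'\<^sup>2 = 0" using \<open>z' = 0\<close> by simp
    ultimately show False using eq by linarith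
  qed
  ultimately show ?thesis using eq x'(3) by (intro exI[of _ x'] exI[of _ y'] exI[of _ "\<bar>z'\<bar>"]) simp
qed

text \<open>The numbers are the entries of two traceless matrices, with rows \<open>(a, b)\<close>,
  \<open>(- y, - a)\<close> and \<open>(r, s)\<close>, \<open>(x, - r)\<close>, whose squares are
  \<open>p\<close> and \<open>q\<close>. The last equation says that their product has trace zero,
  that is, that they anticommute; \<open>- z\<close> is an entry of the product.\<close>

lemma anticommuting_matrices:
  fixes p q x y z :: int
  assumes eq: "z\<^sup>2 = p * x\<^sup>2 + q * y\<^sup>2" and cop: "coprime x y" and nz: "x \<noteq> 0" "y \<noteq> 0"
  shows "\<exists>a b r s. a\<^sup>2 - y * b = p \<and> r\<^sup>2 + x * s = q \<and> x * a + y * r = z \<and> 2 * a * r + b * x - y * s = 0"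
proof -
  obtain u v where uv: "u * x + v * y = 1" using cop bezout_int[of x y] by (metis coprime_imp_gcd_eq_1)
  \<comment> \<open>Bezout's identity gives an integral solution of
    \<open>x * a + y * r = z\<close>; Legendre's equation then makes \<open>b\<close> and
    \<open>s\<close> integral.\<close>
  define a r where "a = z * u" and "r = z * v"
  have z: "x * a + y * r = z"
  proof -
    have "x * a + y * r = z * (u * x + v * y)" by (simp add: a_def r_def algebra_simps)
    then show ?thesis by (simp add: uv)
  qed
  have "x\<^sup>2 * (a\<^sup>2 - p) = y * (q * y - 2 * r * z + y * r\<^sup>2)"
  proof -
    have "x\<^sup>2 * (a\<^sup>2 - p) = (z - y * r)\<^sup>2 - p * x\<^sup>2" unfolding z[symmetric] by (simp add: algebra_simps power2_eq_square)
    also have "\<dots> = z\<^sup>2 - p * x\<^sup>2 + y * (y * r\<^sup>2 - 2 * r * z)" by (simp add: algebra_simps power2_eq_square)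
    finally show ?thesis unfolding eq by (simp add: algebra_simps power2_eq_square)
  qed
  then have "y dvd x\<^sup>2 * (a\<^sup>2 - p)" by simp
  then have "y dvd a\<^sup>2 - p" using cop by (simp add: coprime_dvd_mult_right_iff coprime_commute)
  then obtain b where b: "a\<^sup>2 - p = y * b" by blast
  have "y\<^sup>2 * (q - r\<^sup>2) = x * (2 * a * z - x * a\<^sup>2 - p * x)"
  proof -
    have "y\<^sup>2 * (q - r\<^sup>2) = q * y\<^sup>2 - (z - x * a)\<^sup>2" unfolding z[symmetric] by (simp add: algebra_simps power2_eq_square)
    also have "\<dots> = q * y\<^sup>2 - z\<^sup>2 + x * (2 * a * z - x * a\<^sup>2)" by (simp add: algebra_simps power2_eq_square)
    finally show ?thesis unfolding eq by (simp add: algebra_simps power2_eq_square)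
  qed
  then have "x dvd y\<^sup>2 * (q - r\<^sup>2)" by simp
  then have "x dvd q - r\<^sup>2" using cop by (simp add: coprime_dvd_mult_right_iff)
  then obtain s where s: "q - r\<^sup>2 = x * s" by blast
  \<comment> \<open>Multiplied by \<open>x * y\<close>, the anticommutation condition becomes
    Legendre's equation again.\<close>
  have "x * y * (2 * a * r + b * x - y * s) = 2 * a * r * x * y + x\<^sup>2 * (y * b) - y\<^sup>2 * (x * s)"
    by (simp add: algebra_simps power2_eq_square)
  also have "\<dots> = (x * a + y * r)\<^sup>2 - p * x\<^sup>2 - q * y\<^sup>2"
    unfolding b[symmetric] s[symmetric] by (simp add: algebra_simps power2_eq_square)
  also have "\<dots> = 0" using eq z by simp
  finally have "2 * a * r + b * x - y * s = 0" using nz by simp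
  moreover have "a\<^sup>2 - y * b = p" "r\<^sup>2 + x * s = q" using b s by simp_all
  ultimately show ?thesis using z by blast
qed

section \<open>Tensor products of planes\<close>

definition int_matrix :: "real ^ bool ^ bool \<Rightarrow> bool" where
  "int_matrix M \<longleftrightarrow> (\<forall>i j. M $ i $ j \<in> \<int>)"

text \<open>
  A system of \<open>v\<close> independent binary coordinates on the index type makes \<open>real ^ 'n\<close> a
  tensor product of \<open>v\<close> planes with a further factor; \<open>act k M\<close> is the matrix \<open>M\<close> acting on the
  \<open>k\<close>-th plane.
\<close>

locale binary_coordinates =
  fixes bit :: "'n::finite \<Rightarrow> nat \<Rightarrow> bool" and setb :: "nat \<Rightarrow> bool \<Rightarrow> 'n \<Rightarrow> 'n" and v :: nat
  assumes bit_set: "k < v \<Longrightarrow> bit (setb k b i) k = b"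
    and bit_set_other: "k < v \<Longrightarrow> j < v \<Longrightarrow> j \<noteq> k \<Longrightarrow> bit (setb k b i) j = bit i j"
    and set_set: "k < v \<Longrightarrow> setb k b (setb k c i) = setb k b i"
    and set_bit: "k < v \<Longrightarrow> setb k (bit i k) i = i"
    and set_commute: "k < v \<Longrightarrow> j < v \<Longrightarrow> j \<noteq> k \<Longrightarrow> setb k b (setb j c i) = setb j c (setb k b i)"
begin

definition act :: "nat \<Rightarrow> real ^ bool ^ bool \<Rightarrow> real ^ 'n \<Rightarrow> real ^ 'n" where
  "act k M x = (\<chi> i. \<Sum>b\<in>UNIV. M $ bit i k $ b * x $ setb k b i)"

lemma act_mult: "k < v \<Longrightarrow> act k M (act k N x) = act k (M ** N) x"
  by (simp add: act_def vec_eq_iff bit_set set_set matrix_matrix_mult_def sum_distrib_left sum_distrib_right mult.assoc)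
    (subst sum.swap, simp)

lemma act_one: "k < v \<Longrightarrow> act k (mat 1) x = x"
  by (simp add: act_def vec_eq_iff mat_def set_bit if_distrib[of "\<lambda>c. c * _"] cong: if_cong)

lemma act_commute:
  assumes "k < v" "j < v" "j \<noteq> k"
  shows "act k M (act j N x) = act j N (act k M x)"
proof -
  have "(\<Sum>b\<in>UNIV. M $ bit i k $ b * (\<Sum>c\<in>UNIV. N $ bit i j $ c * x $ setb j c (setb k b i)))
    = (\<Sum>c\<in>UNIV. N $ bit i j $ c * (\<Sum>b\<in>UNIV. M $ bit i k $ b * x $ setb j c (setb k b i)))" for i
    unfolding sum_distrib_left by (subst sum.swap) (simp add: mult.left_commute)
  then show ?thesis using assms
    by (simp add: act_def vec_eq_iff bit_set_other set_commute[of k j])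
qed

lemma act_linear: "linear (act k M)"
  by (rule linearI) (simp_all add: act_def vec_eq_iff algebra_simps sum.distrib sum_distrib_left)

lemma act_scale: "act k M (c *\<^sub>R x) = c *\<^sub>R act k M x"
  by (rule linear_cmul[OF act_linear])

lemma act_scale_matrix: "act k (c *\<^sub>R M) x = c *\<^sub>R act k M x"
  by (simp add: act_def vec_eq_iff sum_distrib_left mult.assoc)

lemma act_adjoint:
  assumes "k < v"
  shows "act k M x \<bullet> y = x \<bullet> act k (transpose M) y"
proof -
  \<comment> \<open>Exchanges the summation variable with the \<open>k\<close>-th bit of the index.
    Being an involution, it reindexes the double sum and transposes \<open>M\<close>.\<close>
  define f where "f = (\<lambda>(i, b). (setb k b i, bit i k))"
  have ff: "f (f z) = z" for z using assms by (simp add: f_def split_beta bit_set set_set set_bit)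
  have bij: "bij f" by (rule o_bij[of f]) (simp_all add: fun_eq_iff ff)
  define g where "g = (\<lambda>(i, b). M $ bit i k $ b * x $ setb k b i * y $ i)"
  have "act k M x \<bullet> y = (\<Sum>i\<in>UNIV. \<Sum>b\<in>UNIV. g (i, b))"
    by (simp add: act_def inner_vec_def g_def sum_distrib_right)
  also have "\<dots> = (\<Sum>z\<in>UNIV. g z)" by (simp add: sum.cartesian_product)
  also have "\<dots> = (\<Sum>z\<in>UNIV. g (f z))" by (rule sum.reindex_bij_betw[OF bij, symmetric])
  also have "\<dots> = (\<Sum>i\<in>UNIV. \<Sum>b\<in>UNIV. g (f (i, b)))" by (simp add: sum.cartesian_product)
  also have "\<dots> = x \<bullet> act k (transpose M) y"
    using assms by (simp add: act_def inner_vec_def g_def f_def sum_distrib_left bit_set set_set set_bit transpose_def mult_ac)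
  finally show ?thesis .
qed

lemma act_int_vectors: "int_matrix M \<Longrightarrow> x \<in> int_vectors \<Longrightarrow> act k M x \<in> int_vectors"
  by (simp add: int_matrix_def int_vectors_def act_def Ints_sum)

end

section \<open>A criterion for strong modularity\<close>

lemma lattice_in_int_vectors: "lattice_in (int_vectors :: (real ^ 'n) set)"
  unfolding lattice_in_def
proof (intro exI conjI)
  show "independent (Basis :: (real ^ 'n) set)" by (rule independent_Basis)
  show "span Basis = (UNIV :: (real ^ 'n) set)" by (rule span_Basis)
  have B: "(Basis :: (real ^ 'n) set) = range (\<lambda>i. axis i 1)" by (auto simp: Basis_vec_def)
  have inj: "inj (\<lambda>i :: 'n. axis i (1 :: real))" by (rule injI) (simp add: axis_eq_axis)
  have sum: "(\<Sum>b\<in>Basis. of_int (c b) *\<^sub>R b) = (\<chi> i. of_int (c (axis i 1)))" for c :: "real ^ 'n \<Rightarrow> int"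
    unfolding B sum.reindex[OF inj] by (simp add: vec_eq_iff axis_def if_distrib cong: if_cong)
  show "int_vectors = {\<Sum>b\<in>Basis. of_int (c b) *\<^sub>R b | c :: real ^ 'n \<Rightarrow> int. True}"
  proof (intro equalityI subsetI)
    fix x :: "real ^ 'n" assume x: "x \<in> int_vectors"
    define c where "c b = \<lfloor>x \<bullet> b\<rfloor>" for b
    have "x = (\<Sum>b\<in>Basis. of_int (c b) *\<^sub>R b)"
      using x by (simp add: sum c_def inner_axis vec_eq_iff int_vectors_def)
    then show "x \<in> {\<Sum>b\<in>Basis. of_int (c b) *\<^sub>R b | c :: real ^ 'n \<Rightarrow> int. True}" by blast
  qed (auto simp: sum int_vectors_def)
qed

lemma lattice_in_image:
  fixes f :: "real ^ 'n \<Rightarrow> real ^ 'n"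
  assumes L: "lattice_in L" and f: "linear f" "inj f"
  shows "lattice_in (f ` L)"
proof -
  obtain B where B: "independent B" "span B = UNIV"
    and LB: "L = {\<Sum>b\<in>B. of_int (c b) *\<^sub>R b | c :: real ^ 'n \<Rightarrow> int. True}"
    using L unfolding lattice_in_def by blast
  have inj: "inj_on f B" using f(2) by (rule inj_on_subset) simp
  have 1: "independent (f ` B)" using linear_independent_injective_image[OF f(1) B(1)] f(2) B(2) by simp
  have 2: "span (f ` B) = UNIV"
    using linear_span_image[OF f(1), of B] B(2) linear_injective_imp_surjective[OF f] by simp
  define S where "S c = (\<Sum>b\<in>B. of_int (c b) *\<^sub>R b)" for c :: "real ^ 'n \<Rightarrow> int"
  define S' where "S' c = (\<Sum>b\<in>f ` B. of_int (c b) *\<^sub>R b)" for c :: "real ^ 'n \<Rightarrow> int"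
  have S': "S' c = f (S (\<lambda>b. c (f b)))" for c
    unfolding S_def S'_def by (simp add: linear_sum[OF f(1)] linear_cmul[OF f(1)] sum.reindex[OF inj])
  have S: "f (S c) = S' (\<lambda>b. c (inv_into UNIV f b))" for c
    by (simp only: S' inv_f_f[OF f(2)])
  have "f ` range S = range S'"
  proof (intro equalityI image_subsetI)
    fix y assume "y \<in> range S"
    then obtain c where "y = S c" by blast
    then have "f y = S' (\<lambda>b. c (inv_into UNIV f b))" by (simp only: S)
    then show "f y \<in> range S'" by blast
  next
    fix c show "S' c \<in> f ` range S" unfolding S' by (intro imageI rangeI)
  qed
  moreover have "L = range S" unfolding LB S_def by blast
  ultimately have "f ` L = {\<Sum>b\<in>f ` B. of_int (c b) *\<^sub>R b | c :: real ^ 'n \<Rightarrow> int. True}"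
    unfolding S'_def by blast
  then show ?thesis using 1 2 unfolding lattice_in_def by blast
qed

text \<open>
  When \<open>l\<close> is the level of \<open>L\<close> and \<open>m\<close> is coprime to \<open>l div m\<close>,
  such a \<open>T\<close> maps \<open>L\<^sup>* \<inter> m\<^sup>-\<^sup>1 L\<close> onto \<open>L\<close>, which exhibits the modularity at \<open>m\<close>.
\<close>

definition modular_map :: "nat \<Rightarrow> nat \<Rightarrow> (real ^ 'n) set \<Rightarrow> (real ^ 'n \<Rightarrow> real ^ 'n) \<Rightarrow> bool" where
  "modular_map l m L T \<longleftrightarrow> linear T \<and>
     (\<exists>s. (s = 1 \<or> s = - 1) \<and> (\<forall>x y. T x \<bullet> y = s * (x \<bullet> T y))) \<and>
     (\<forall>x y. T x \<bullet> T y = real m * (x \<bullet> y)) \<and>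
     (\<forall>x\<in>L. T x \<in> L) \<and> (\<forall>x\<in>L. \<exists>w\<in>dual_lattice L. T x = real m *\<^sub>R w) \<and>
     (\<forall>x\<in>dual_lattice L. (real l / real m) *\<^sub>R T x \<in> L)"

text \<open>The adjoint of \<open>T\<close> is \<open>s\<close> times \<open>T\<close>, so the
  similarity condition determines the square of \<open>T\<close>.\<close>

lemma modular_map_square:
  assumes "modular_map l m L T"
  obtains s :: real where "s = 1 \<or> s = - 1" "\<And>x. T (T x) = (s * real m) *\<^sub>R x"
proof -
  obtain s where s: "s = 1 \<or> s = - 1" "\<And>x y. T x \<bullet> y = s * (x \<bullet> T y)"
    and norm: "\<And>x y. T x \<bullet> T y = real m * (x \<bullet> y)" using assms unfolding modular_map_def by blast
  have "T (T x) = (s * real m) *\<^sub>R x" for x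
    by (rule vector_eq_rdot[THEN iffD1]) (simp add: s(2)[of "T x"] norm)
  then show thesis using that s(1) by blast
qed

lemma sign_mem:
  assumes "is_Zmodule L" "s = 1 \<or> s = - 1"
  shows "s *\<^sub>R x \<in> L \<longleftrightarrow> x \<in> L"
  using assms(2) is_ZmoduleD(4)[OF assms(1), of x] is_ZmoduleD(4)[OF assms(1), of "- x"] by auto

lemma squarefree_dvd_square:
  assumes "squarefree (l :: nat)" "l dvd k\<^sup>2"
  shows "l dvd k"
proof -
  have l0: "l \<noteq> 0" using assms(1) by (metis not_squarefree_0)
  define g where "g = gcd l k"
  have g0: "g > 0" using l0 by (simp add: g_def)
  then have "gcd l k \<noteq> 0" by (simp add: g_def)
  from gcd_coprime_exists[OF this] obtain c d where cd: "l = c * g" "k = d * g" "coprime c d"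
    unfolding g_def[symmetric] by blast
  have "c * g dvd (d * g)\<^sup>2" using assms(2) by (simp only: cd(1,2))
  then have "c * g dvd (d\<^sup>2 * g) * g" by (simp add: power2_eq_square mult_ac)
  then have "c dvd d\<^sup>2 * g" using g0 by simp
  then have "c dvd g" using cd(3) by (simp add: coprime_dvd_mult_right_iff)
  then have "c\<^sup>2 dvd l" unfolding power2_eq_square cd(1) by (rule mult_dvd_mono[OF dvd_refl])
  then have "is_unit c" using assms(1) unfolding squarefree_def by blast
  then have "c = 1" by simp
  then show ?thesis by (simp add: cd(1,2))
qed

text \<open>The map for \<open>m = 1\<close> carries \<open>l\<close> times the dual lattice into
  \<open>L\<close>. If \<open>k\<close> has the defining property of the level, then the map for
  \<open>m = l\<close> scaled by \<open>k / l\<close> preserves \<open>L\<close>; its square is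
  \<open>k\<^sup>2 / l\<close> up to sign, so \<open>l\<close> divides \<open>k\<^sup>2\<close> and
  therefore \<open>k\<close>. The isometry for \<open>m\<close> is \<open>T\<close> divided by the
  square root of \<open>m\<close>.\<close>

theorem strongly_modular_criterion:
  assumes L: "integral_lattice (L :: (real ^ 'n) set)" and sq: "squarefree l"
    and T: "\<And>m. m dvd l \<Longrightarrow> \<exists>T. modular_map l m L T"
  shows "lattice_level L = l" "strongly_modular L"
proof -
  have lat: "lattice_in L" and sub: "L \<subseteq> dual_lattice L" using L by (simp_all add: integral_lattice_def)
  note Z = Zmodule_lattice[OF lat]
  have l0: "l > 0" using sq by (metis gr0I not_squarefree_0)
  have lev: "real l *\<^sub>R x \<in> L" if x: "x \<in> dual_lattice L" for x
  proof -
    obtain T where T1: "modular_map l 1 L T" using T[of 1] by auto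
    obtain s where s: "s = 1 \<or> s = - 1" "\<And>x. T (T x) = (s * real 1) *\<^sub>R x" using modular_map_square[OF T1] by blast
    have lin: "linear T" and TL: "\<And>x. x \<in> L \<Longrightarrow> T x \<in> L" and TD: "\<And>x. x \<in> dual_lattice L \<Longrightarrow> (real l / real 1) *\<^sub>R T x \<in> L"
      using T1 unfolding modular_map_def by blast+
    have "T (real l *\<^sub>R T x) \<in> L" using TL TD[OF x] by simp
    also have "T (real l *\<^sub>R T x) = s *\<^sub>R (real l *\<^sub>R x)" by (simp add: linear_cmul[OF lin] s(2))
    finally show ?thesis using sign_mem[OF Z s(1)] by blast
  qed
  show level: "lattice_level L = l"
    unfolding lattice_level_def
  proof (rule Least_equality)
    show "l > 0 \<and> (\<lambda>x. real l *\<^sub>R x) ` dual_lattice L \<subseteq> L" using l0 lev by auto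
    fix k assume k: "k > 0 \<and> (\<lambda>x. real k *\<^sub>R x) ` dual_lattice L \<subseteq> L"
    obtain T where Tl: "modular_map l l L T" using T[of l] by auto
    obtain s where s: "s = 1 \<or> s = - 1" "\<And>x. T (T x) = (s * real l) *\<^sub>R x" using modular_map_square[OF Tl] by blast
    have lin: "linear T" and TD: "\<And>x. x \<in> L \<Longrightarrow> \<exists>w\<in>dual_lattice L. T x = real l *\<^sub>R w"
      using Tl unfolding modular_map_def by blast+
    have S: "(real k / real l) *\<^sub>R T x \<in> L" if x: "x \<in> L" for x
    proof -
      obtain w where w: "w \<in> dual_lattice L" "T x = real l *\<^sub>R w" using TD[OF x] by blast
      have "real k *\<^sub>R w \<in> L" using k w(1) by blast
      then show ?thesis using l0 by (simp add: w(2))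
    qed
    have "(real (k\<^sup>2) / real l) *\<^sub>R x \<in> L" if x: "x \<in> L" for x
    proof -
      have eq: "(real k / real l) *\<^sub>R T ((real k / real l) *\<^sub>R T x) = s *\<^sub>R ((real (k\<^sup>2) / real l) *\<^sub>R x)"
        using l0 by (simp add: linear_cmul[OF lin] s(2) power2_eq_square mult_ac)
      show ?thesis using S[OF S[OF x]] unfolding eq sign_mem[OF Z s(1)] .
    qed
    moreover obtain M N :: "real ^ 'n ^ 'n" where MN: "M ** N = mat 1" "N ** M = mat 1" and M: "L = (*v) M ` int_vectors"
      by (rule lattice_in_matrix[OF lat])
    obtain i :: 'n where True by blast
    have "axis i 1 \<in> int_vectors" by (simp add: int_vectors_def axis_def)
    then have "M *v axis i 1 \<in> L" using M by blast
    ultimately have "(real (k\<^sup>2) / real l) *\<^sub>R (M *v axis i 1) \<in> L" by blast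
    then obtain z where z: "z \<in> int_vectors" "(real (k\<^sup>2) / real l) *\<^sub>R (M *v axis i 1) = M *v z" using M by blast
    have "z = N *v ((real (k\<^sup>2) / real l) *\<^sub>R (M *v axis i 1))" unfolding z(2) by (simp add: matrix_vector_mul_assoc MN)
    also have "\<dots> = (real (k\<^sup>2) / real l) *\<^sub>R axis i 1"
      by (simp only: matrix_vector_mult_scaleR matrix_vector_mul_assoc MN matrix_vector_mul_lid)
    finally have "z $ i = real (k\<^sup>2) / real l" by (simp add: axis_def)
    then have "real (k\<^sup>2) / real l \<in> \<int>" using z(1) unfolding int_vectors_def by (metis mem_Collect_eq)
    then obtain c :: int where "real (k\<^sup>2) / real l = of_int c" by (auto elim: Ints_cases)
    then have "real (k\<^sup>2) = of_int c * real l" using l0 by (simp add: field_simps)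
    then have "of_int (int (k\<^sup>2)) = (of_int (c * int l) :: real)" by simp
    then have "int (k\<^sup>2) = c * int l" by (simp only: of_int_eq_iff)
    then have "int l dvd int (k\<^sup>2)" by simp
    then have "l dvd k\<^sup>2" by (simp only: of_nat_dvd_iff)
    then have "l dvd k" by (rule squarefree_dvd_square[OF sq])
    then show "l \<le> k" using k by (intro dvd_imp_le) auto
  qed
  have "m \<in> fst ` simil L" if m: "m \<in> udiv l" for m
  proof -
    have m0: "m > 0" by (rule udiv_pos[OF l0 m])
    have ml: "m dvd l" "coprime m (l div m)" using m by (simp_all add: udiv_def)
    obtain T where Tm: "modular_map l m L T" using T[OF ml(1)] by blast
    obtain s where s: "s = 1 \<or> s = - 1" "\<And>x. T (T x) = (s * real m) *\<^sub>R x" using modular_map_square[OF Tm] by blast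
    have lin: "linear T" and norm: "\<And>x y. T x \<bullet> T y = real m * (x \<bullet> y)" and TL: "\<And>x. x \<in> L \<Longrightarrow> T x \<in> L"
      and TD: "\<And>x. x \<in> L \<Longrightarrow> \<exists>w\<in>dual_lattice L. T x = real m *\<^sub>R w"
      and TD': "\<And>x. x \<in> dual_lattice L \<Longrightarrow> (real l / real m) *\<^sub>R T x \<in> L"
      using Tm unfolding modular_map_def by blast+
    define \<sigma> where "\<sigma> x = (1 / sqrt (real m)) *\<^sub>R T x" for x
    have lin\<sigma>: "linear \<sigma>" unfolding \<sigma>_def using lin by (simp add: linear_compose_scale_right)
    have "\<sigma> x \<bullet> \<sigma> y = x \<bullet> y" for x y using m0 by (simp add: \<sigma>_def norm flip: mult.assoc)
    then have orth: "orthogonal_transformation \<sigma>" using lin\<sigma> by (simp add: orthogonal_transformation_def)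
    have T\<sigma>: "sqrt (real m) *\<^sub>R (matrix \<sigma> *v x) = T x" for x using m0 lin\<sigma> by (simp add: matrix_works \<sigma>_def)
    have "T x \<in> L \<longleftrightarrow> x \<in> pdual m L" for x
    proof
      assume x: "T x \<in> L"
      have "s *\<^sub>R (real m *\<^sub>R x) \<in> L" using TL[OF x] by (simp add: s(2))
      then have "real m *\<^sub>R x \<in> L" using sign_mem[OF Z s(1)] by blast
      moreover obtain w where w: "w \<in> dual_lattice L" "T (T x) = real m *\<^sub>R w" using TD[OF x] by blast
      have "real m *\<^sub>R (s *\<^sub>R x) = real m *\<^sub>R w" using w(2) by (simp add: s(2) mult.commute)
      then have "s *\<^sub>R x = w" using m0 by (simp del: scaleR_scaleR)
      then have "s *\<^sub>R x \<in> dual_lattice L" using w(1) by simp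
      then have "x \<in> dual_lattice L" using sign_mem[OF Zmodule_dual s(1)] by blast
      ultimately show "x \<in> pdual m L" by (simp add: pdual_def)
    next
      assume "x \<in> pdual m L"
      then have x: "x \<in> dual_lattice L" "real m *\<^sub>R x \<in> L" by (simp_all add: pdual_def)
      have "real m *\<^sub>R T x \<in> L" using TL[OF x(2)] by (simp add: linear_cmul[OF lin])
      moreover have "real (l div m) *\<^sub>R T x \<in> L" using TD'[OF x(1)] ml(1) by (simp add: real_of_nat_div)
      ultimately have "real (gcd m (l div m)) *\<^sub>R T x \<in> L" by (rule Zmodule_gcd[OF Z])
      then show "T x \<in> L" using ml(2) by simp
    qed
    then have "\<forall>x. sqrt (real m) *\<^sub>R (matrix \<sigma> *v x) \<in> L \<longleftrightarrow> x \<in> pdual m L" by (simp only: T\<sigma>) simp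
    moreover have "orthogonal_matrix (matrix \<sigma>)" using orth by (simp add: orthogonal_transformation_matrix)
    ultimately have "(m, matrix \<sigma>) \<in> simil L" using m unfolding simil_def level by blast
    then show ?thesis by force
  qed
  then have "udiv l \<subseteq> I_set L" unfolding I_set_eq[OF L] by blast
  moreover have "I_set L \<subseteq> udiv l" by (auto simp: I_set_def W_group_simps level)
  ultimately show "strongly_modular L" by (simp add: strongly_modular_def W_group_simps level)
qed

text \<open>The columns of \<open>A\<close> are a basis of a binary lattice with Gram matrix
  \<open>G = transpose A ** A\<close>, and \<open>T\<close> is a similarity of factor
  \<open>e\<close> written in that basis. Integrality of \<open>H\<close>, which is
  \<open>G ** T\<close> divided by \<open>e\<close>, puts the image of the lattice into
  \<open>e\<close> times its dual; integrality of \<open>N\<close> puts \<open>d / e\<close> times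
  the image of the dual into the lattice. The sign condition on \<open>H\<close> makes the
  similarity symmetric or skew, and \<open>transpose H ** T = G\<close> fixes its factor.\<close>

definition plane_block :: "nat \<Rightarrow> real ^ bool ^ bool \<Rightarrow> real ^ bool ^ bool \<Rightarrow> bool" where
  "plane_block d A Ai \<longleftrightarrow> A ** Ai = mat 1 \<and> Ai ** A = mat 1 \<and> int_matrix (transpose A ** A) \<and>
     (\<forall>e. e dvd d \<longrightarrow> (\<exists>T H N. int_matrix T \<and> int_matrix H \<and> int_matrix N \<and>
        (\<exists>s. (s = 1 \<or> s = - 1) \<and> transpose H = s *\<^sub>R H) \<and>
        transpose H ** T = transpose A ** A \<and>
        (transpose A ** A) ** T = real e *\<^sub>R H \<and> real d *\<^sub>R T = real e *\<^sub>R (N ** (transpose A ** A))))"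

lemmas scaleR_matrix_mult = scalar_matrix_assoc[symmetric] matrix_scalar_ac

lemma matrix_mult_uminus: "(- A) ** B = - (A ** B)" "A ** (- B) = - (A ** B)" for A B :: "real ^ 'n ^ 'n"
  by (simp_all add: matrix_matrix_mult_def vec_eq_iff sum_negf)

lemma transpose_scaleR: "transpose (c *\<^sub>R (M :: real ^ 'n ^ 'm)) = c *\<^sub>R transpose M"
  by (simp add: transpose_def vec_eq_iff)

lemma int_matrix_transpose: "int_matrix M \<Longrightarrow> int_matrix (transpose M)"
  by (simp add: int_matrix_def transpose_def)

section \<open>Tensoring a lattice with one more plane\<close>

context binary_coordinates
begin

text \<open>The planes below \<open>k\<close> have been used. The conditions for \<open>j\<close>
  from \<open>k\<close> on keep the others free: integral matrices acting there preserve
  \<open>L\<close> and commute with the modular maps, which is what allows the next tensor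
  factor.\<close>

definition tower :: "nat \<Rightarrow> nat \<Rightarrow> (real ^ 'n) set \<Rightarrow> bool" where
  "tower k l L \<longleftrightarrow> integral_lattice L \<and>
     (\<forall>j M x. k \<le> j \<longrightarrow> j < v \<longrightarrow> int_matrix M \<longrightarrow> x \<in> L \<longrightarrow> act j M x \<in> L) \<and>
     (\<forall>m. m dvd l \<longrightarrow> (\<exists>T. modular_map l m L T \<and>
        (\<forall>j M x. k \<le> j \<longrightarrow> j < v \<longrightarrow> T (act j M x) = act j M (T x))))"

lemma tower_zero: "tower 0 1 int_vectors"
  unfolding tower_def
proof (intro conjI allI impI)
  have dual: "dual_lattice int_vectors = (int_vectors :: (real ^ 'n) set)"
    using int_vectors_dual unfolding dual_lattice_def by blast
  then show "integral_lattice (int_vectors :: (real ^ 'n) set)"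
    by (simp add: integral_lattice_def lattice_in_int_vectors)
  show "act j M x \<in> int_vectors" if "int_matrix M" "x \<in> int_vectors" for j M and x :: "real ^ 'n"
    by (rule act_int_vectors[OF that])
  fix m :: nat assume "m dvd 1"
  then have "modular_map 1 m (int_vectors :: (real ^ 'n) set) (\<lambda>x. x)"
    by (auto simp: modular_map_def dual linear_id[unfolded id_def])
  then show "\<exists>T. modular_map 1 m int_vectors T \<and>
        (\<forall>j M x. 0 \<le> j \<longrightarrow> j < v \<longrightarrow> T (act j M x) = act j M (T x))"
    by (intro exI[of _ "\<lambda>x. x"]) simp
qed

lemma dual_act:
  assumes k: "k < v" and inv: "\<And>M x. int_matrix M \<Longrightarrow> x \<in> L \<Longrightarrow> act k M x \<in> L"
    and N: "int_matrix N" and z: "z \<in> dual_lattice L"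
  shows "act k N z \<in> dual_lattice L"
  unfolding dual_lattice_def
proof (intro CollectI ballI)
  fix y assume "y \<in> L"
  then have "act k (transpose N) y \<in> L" using inv N int_matrix_transpose by blast
  then have "z \<bullet> act k (transpose N) y \<in> \<int>" using z unfolding dual_lattice_def by blast
  then show "act k N z \<bullet> y \<in> \<int>" by (simp add: act_adjoint[OF k])
qed

lemma mem_dual_act_image:
  assumes "k < v"
  shows "y \<in> dual_lattice (act k A ` L) \<longleftrightarrow> act k (transpose A) y \<in> dual_lattice L"
proof -
  have "act k (transpose A) y \<bullet> x = y \<bullet> act k A x" for x by (simp add: act_adjoint[OF assms] transpose_transpose)
  then show ?thesis by (simp add: dual_lattice_def)
qed

text \<open>The lattice is tensored with the block. A divisor of \<open>l * d\<close> factors as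
  \<open>m * e\<close>, and its modular map is the old map for \<open>m\<close> tensored with the
  block's similarity of factor \<open>e\<close>; signs and factors multiply.\<close>

lemma tower_step:
  assumes k: "k < v" and tow: "tower k l L" and blk: "plane_block d A Ai" and l: "l > 0" and d: "d > 0"
  shows "tower (Suc k) (l * d) (act k A ` L)"
proof -
  define G where "G = transpose A ** A"
  have A: "A ** Ai = mat 1" "Ai ** A = mat 1" and G: "int_matrix G" using blk by (simp_all add: plane_block_def G_def)
  have A': "transpose Ai ** transpose A = mat 1" "transpose A ** transpose Ai = mat 1"
    using A by (simp_all flip: matrix_transpose_mul)
  have L: "integral_lattice L" and inv: "\<And>j M x. k \<le> j \<Longrightarrow> j < v \<Longrightarrow> int_matrix M \<Longrightarrow> x \<in> L \<Longrightarrow> act j M x \<in> L"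
    using tow unfolding tower_def by blast+
  have invk: "int_matrix M \<Longrightarrow> x \<in> L \<Longrightarrow> act k M x \<in> L" for M x using inv[OF order_refl k] .
  have lat: "lattice_in L" and sub: "L \<subseteq> dual_lattice L" using L by (auto simp: integral_lattice_def)
  note actm = act_mult[OF k]
  have cancel: "act k Ai (act k A x) = x" "act k A (act k Ai x) = x" for x by (simp_all add: actm A act_one[OF k])
  have inj: "inj (act k A)" using cancel(1) by (metis injI)
  have dualk: "act k N z \<in> dual_lattice L" if "int_matrix N" "z \<in> dual_lattice L" for N z
    using dual_act[OF k invk that] .
  note mem_dual = mem_dual_act_image[OF k]
  show ?thesis
    unfolding tower_def
  proof (intro conjI allI impI)
    have "act k A x \<in> dual_lattice (act k A ` L)" if "x \<in> L" for x
      using invk[OF G that] sub by (auto simp: mem_dual actm simp flip: G_def)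
    then show "integral_lattice (act k A ` L)"
      unfolding integral_lattice_def using lattice_in_image[OF lat act_linear inj] by blast
  next
    fix j M y assume j: "Suc k \<le> j" "j < v" "int_matrix M" "y \<in> act k A ` L"
    then obtain x where x: "x \<in> L" "y = act k A x" by blast
    have "act j M y = act k A (act j M x)" unfolding x(2) using j k by (intro act_commute) auto
    then show "act j M y \<in> act k A ` L" using inv[of j M x] j x by auto
  next
    fix m' assume "m' dvd l * d"
    then obtain m e where m': "m' = m * e" "m dvd l" "e dvd d" by (metis division_decomp)
    have pos: "m > 0" "e > 0" using m' l d by (auto intro: gr0I)
    obtain T where T: "modular_map l m L T" and Tact: "\<And>j M x. k \<le> j \<Longrightarrow> j < v \<Longrightarrow> T (act j M x) = act j M (T x)"
      using tow m'(2) unfolding tower_def by blast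
    note Tk = Tact[OF order_refl k]
    obtain s where s: "s = 1 \<or> s = - 1" "\<And>x y. T x \<bullet> y = s * (x \<bullet> T y)"
      and lin: "linear T" and norm: "\<And>x y. T x \<bullet> T y = real m * (x \<bullet> y)" and TL: "\<And>x. x \<in> L \<Longrightarrow> T x \<in> L"
      and TD: "\<And>x. x \<in> L \<Longrightarrow> \<exists>w\<in>dual_lattice L. T x = real m *\<^sub>R w"
      and TD': "\<And>x. x \<in> dual_lattice L \<Longrightarrow> (real l / real m) *\<^sub>R T x \<in> L"
      using T unfolding modular_map_def by blast
    obtain Te H N s' where Te: "int_matrix Te" "int_matrix H" "int_matrix N" and s': "s' = 1 \<or> s' = - 1" "transpose H = s' *\<^sub>R H"
      and HT: "transpose H ** Te = G" and GT: "G ** Te = real e *\<^sub>R H" and dT: "real d *\<^sub>R Te = real e *\<^sub>R (N ** G)"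
      using blk m'(3) unfolding plane_block_def G_def[symmetric] by metis
    have Gs: "transpose G = G" by (simp add: G_def matrix_transpose_mul transpose_transpose)
    have TG: "transpose Te ** G = (s' * real e) *\<^sub>R H"
    proof -
      have "transpose Te ** G = transpose (G ** Te)" by (simp add: matrix_transpose_mul Gs)
      then show ?thesis by (simp add: GT transpose_scaleR s'(2) mult.commute)
    qed
    have TGT: "transpose Te ** G ** Te = real e *\<^sub>R G"
    proof -
      have "s' *\<^sub>R (H ** Te) = G" using HT by (simp add: s'(2) scaleR_matrix_mult)
      moreover have "transpose Te ** G ** Te = real e *\<^sub>R (s' *\<^sub>R (H ** Te))"
        by (simp add: TG scaleR_matrix_mult mult.commute)
      ultimately show ?thesis by (simp only:)
    qed
    \<comment> \<open>The block's similarity moved from the lattice basis to standard coordinates,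
      where its adjoint is the transposed matrix.\<close>
    define R where "R = A ** Te ** Ai"
    have AtR: "transpose Ai ** (transpose Te ** G) = s' *\<^sub>R (transpose Ai ** G ** Te)"
      by (simp add: TG GT scaleR_matrix_mult flip: matrix_mul_assoc)
    have AiG: "transpose Ai ** G = A" by (simp add: G_def matrix_mul_assoc A')
    have GAi: "G ** Ai = transpose A" by (simp add: G_def A flip: matrix_mul_assoc)
    have Rt: "transpose R = s' *\<^sub>R R"
    proof -
      have "transpose R = transpose Ai ** (transpose Te ** G) ** Ai"
        by (simp add: R_def matrix_transpose_mul GAi flip: matrix_mul_assoc)
      also have "\<dots> = s' *\<^sub>R (transpose Ai ** G ** Te ** Ai)" unfolding AtR by (simp add: scaleR_matrix_mult)
      finally show ?thesis by (simp add: AiG R_def)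
    qed
    have RtR: "transpose R ** R = real e *\<^sub>R mat 1"
    proof -
      have "transpose R ** R = transpose Ai ** (transpose Te ** G ** Te) ** Ai"
        by (simp add: R_def G_def matrix_transpose_mul matrix_mul_assoc)
      also have "\<dots> = real e *\<^sub>R (transpose Ai ** G ** Ai)" by (simp add: TGT scaleR_matrix_mult)
      finally show ?thesis by (simp add: AiG A)
    qed
    define T' where "T' x = T (act k R x)" for x
    have RA: "act k R (act k A x) = act k A (act k Te x)" for x
    proof -
      have "R ** A = A ** Te" by (simp add: R_def A flip: matrix_mul_assoc)
      then show ?thesis by (simp add: actm)
    qed
    have "modular_map (l * d) m' (act k A ` L) T'"
      unfolding modular_map_def
    proof (intro conjI ballI)
      show "linear T'" unfolding T'_def using linear_compose[OF act_linear lin, of k R] by (simp add: o_def)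
      show "\<exists>s. (s = 1 \<or> s = - 1) \<and> (\<forall>x y. T' x \<bullet> y = s * (x \<bullet> T' y))"
      proof (intro exI conjI allI)
        show "s * s' = 1 \<or> s * s' = - 1" using s(1) s'(1) by auto
        fix x y
        have "T' x \<bullet> y = s * (x \<bullet> act k (transpose R) (T y))" by (simp add: T'_def s(2) act_adjoint[OF k])
        then show "T' x \<bullet> y = s * s' * (x \<bullet> T' y)" by (simp add: Rt act_scale_matrix T'_def Tk)
      qed
      show "\<forall>x y. T' x \<bullet> T' y = real m' * (x \<bullet> y)"
        by (simp add: T'_def norm act_adjoint[OF k] actm RtR act_scale_matrix act_one[OF k] m'(1))
      fix y assume "y \<in> act k A ` L"
      then obtain x where x: "x \<in> L" "y = act k A x" by blast
      have T'y: "T' y = act k A (T (act k Te x))" by (simp add: T'_def x(2) RA Tk)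
      then show "T' y \<in> act k A ` L" using TL[OF invk[OF Te(1) x(1)]] by blast
      \<comment> \<open>As \<open>G ** Te\<close> is \<open>e\<close> times \<open>H\<close>, the
        block contributes the factor \<open>e\<close>, and the old map applied to
        \<open>act k H x\<close> contributes \<open>m\<close>.\<close>
      obtain w where w: "w \<in> dual_lattice L" "T (act k H x) = real m *\<^sub>R w" using TD[OF invk[OF Te(2) x(1)]] by blast
      have "act k (transpose A) (T' y) = act k G (T (act k Te x))" by (simp add: T'y actm G_def)
      also have "\<dots> = T (act k (G ** Te) x)" by (simp add: Tk[symmetric] actm)
      also have "\<dots> = real m' *\<^sub>R w" by (simp add: GT act_scale_matrix linear_cmul[OF lin] w(2) m'(1) mult.commute)
      finally have eq: "act k (transpose A) (T' y) = real m' *\<^sub>R w" .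
      have "act k (transpose A) ((1 / real m') *\<^sub>R T' y) = w" using pos by (simp add: act_scale eq m'(1))
      then have "(1 / real m') *\<^sub>R T' y \<in> dual_lattice (act k A ` L)" using w(1) by (simp add: mem_dual)
      moreover have "T' y = real m' *\<^sub>R ((1 / real m') *\<^sub>R T' y)" using pos by (simp add: m'(1))
      ultimately show "\<exists>w\<in>dual_lattice (act k A ` L). T' y = real m' *\<^sub>R w" by blast
    next
      fix y assume y: "y \<in> dual_lattice (act k A ` L)"
      define z where "z = act k (transpose A) y"
      have z: "z \<in> dual_lattice L" using y by (simp add: z_def mem_dual)
      have yz: "y = act k (transpose Ai) z" by (simp add: z_def actm A' act_one[OF k])
      \<comment> \<open>\<open>N\<close> is the block's similarity from the dual basis to the
        lattice basis, scaled by \<open>d / e\<close>; being integral, it keeps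
        \<open>act k N z\<close> in the dual of \<open>L\<close>.\<close>
      have NN: "(real d / real e) *\<^sub>R (Te ** Ai ** transpose Ai) = N"
      proof -
        have GG: "G ** (Ai ** transpose Ai) = mat 1" by (simp add: matrix_mul_assoc GAi A')
        have "real d *\<^sub>R (Te ** Ai ** transpose Ai) = (real d *\<^sub>R Te) ** (Ai ** transpose Ai)"
          by (simp add: scaleR_matrix_mult matrix_mul_assoc)
        also have "\<dots> = real e *\<^sub>R (N ** (G ** (Ai ** transpose Ai)))" unfolding dT by (simp add: scaleR_matrix_mult matrix_mul_assoc)
        also have "\<dots> = real e *\<^sub>R N" by (simp add: GG)
        finally have "(1 / real e) *\<^sub>R (real d *\<^sub>R (Te ** Ai ** transpose Ai)) = (1 / real e) *\<^sub>R (real e *\<^sub>R N)" by simp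
        then show ?thesis using pos by simp
      qed
      have "T' y = T (act k A (act k (Te ** Ai ** transpose Ai) z))"
        by (simp add: T'_def yz actm R_def matrix_mul_assoc)
      then have "(real d / real e) *\<^sub>R T' y = T (act k A (act k ((real d / real e) *\<^sub>R (Te ** Ai ** transpose Ai)) z))"
        by (simp add: act_scale_matrix act_scale linear_cmul[OF lin])
      also have "\<dots> = act k A (T (act k N z))" unfolding NN by (rule Tk)
      finally have 1: "(real d / real e) *\<^sub>R T' y = act k A (T (act k N z))" .
      have "(real (l * d) / real m') *\<^sub>R T' y = (real l / real m) *\<^sub>R ((real d / real e) *\<^sub>R T' y)"
        by (simp add: m'(1))
      also have "\<dots> = act k A ((real l / real m) *\<^sub>R T (act k N z))" by (simp only: 1 act_scale)
      finally show "(real (l * d) / real m') *\<^sub>R T' y \<in> act k A ` L"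
        using TD'[OF dualk[OF Te(3) z]] by simp
    qed
    moreover have "T' (act j M x) = act j M (T' x)" if "Suc k \<le> j" "j < v" for j M x
      using that k by (simp add: T'_def act_commute[of k j] Tact)
    ultimately show "\<exists>T. modular_map (l * d) m' (act k A ` L) T \<and>
        (\<forall>j M x. Suc k \<le> j \<longrightarrow> j < v \<longrightarrow> T (act j M x) = act j M (T x))" by blast
  qed
qed

end

section \<open>Two by two matrices and the binary lattice of determinant p q\<close>

definition mat2 :: "real \<Rightarrow> real \<Rightarrow> real \<Rightarrow> real \<Rightarrow> real ^ bool ^ bool" where
  "mat2 a b c d = (\<chi> i j. if i then (if j then d else c) else (if j then b else a))"

lemma bool_matrix_eq_iff: "M = N \<longleftrightarrow> M $ False $ False = N $ False $ False \<and> M $ False $ True = N $ False $ True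
   \<and> M $ True $ False = N $ True $ False \<and> M $ True $ True = (N :: real ^ bool ^ bool) $ True $ True"
  unfolding vec_eq_iff all_bool_eq by argo

lemma mat2_nth [simp]: "mat2 a b c d $ True $ True = d" "mat2 a b c d $ True $ False = c"
  "mat2 a b c d $ False $ True = b" "mat2 a b c d $ False $ False = a"
  by (simp_all add: mat2_def)

lemma mat2_mult:
  "mat2 a b c d ** mat2 a' b' c' d' = mat2 (a * a' + b * c') (a * b' + b * d') (c * a' + d * c') (c * b' + d * d')"
  by (simp add: bool_matrix_eq_iff matrix_matrix_mult_def UNIV_bool)

lemma mat2_eq_iff: "mat2 a b c d = mat2 a' b' c' d' \<longleftrightarrow> a = a' \<and> b = b' \<and> c = c' \<and> d = d'"
  by (simp add: bool_matrix_eq_iff)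

lemma int_matrix_mat2: "int_matrix (mat2 a b c d) \<longleftrightarrow> a \<in> \<int> \<and> b \<in> \<int> \<and> c \<in> \<int> \<and> d \<in> \<int>"
  unfolding int_matrix_def all_bool_eq mat2_nth by blast

lemma mat2_ops:
  "transpose (mat2 a b c d) = mat2 a c b d" "mat 1 = mat2 1 0 0 1"
  "t *\<^sub>R mat2 a b c d = mat2 (t * a) (t * b) (t * c) (t * d)" "- mat2 a b c d = mat2 (- a) (- b) (- c) (- d)"
  by (simp_all add: bool_matrix_eq_iff transpose_def mat_def)

lemmas mat2_simps = mat2_mult mat2_eq_iff int_matrix_mat2 mat2_ops

text \<open>For the symmetric matrix \<open>G = J' ** (T ** U)\<close>, the matrices 1,
  \<open>T\<close>, \<open>U\<close> and \<open>T ** U\<close> are similarities of factors 1,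
  \<open>p\<close>, \<open>q\<close> and \<open>p * q\<close>. It is positive definite because its
  determinant is \<open>p * q\<close> and its corner entry \<open>z\<close> is positive, whence the
  sign chosen in Legendre's equation.\<close>

lemma plane_block_exists:
  assumes pq: "Factorial_Ring.prime (p::nat)" "Factorial_Ring.prime q" "p \<noteq> q"
    and "\<exists>\<alpha>. [\<alpha>\<^sup>2 = int p] (mod int q)" "\<exists>\<beta>. [\<beta>\<^sup>2 = int q] (mod int p)"
  shows "\<exists>A Ai. plane_block (p * q) A Ai"
proof -
  obtain x y z :: int where xyz: "z\<^sup>2 = int p * x\<^sup>2 + int q * y\<^sup>2" "coprime x y" "x \<noteq> 0" "y \<noteq> 0" "z > 0"
  proof -
    from assms(4,5) obtain \<alpha> \<beta> where "[\<alpha>\<^sup>2 = int p] (mod int q)" "[\<beta>\<^sup>2 = int q] (mod int p)" by blast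
    from legendre_equation_coprime[OF pq this] show thesis using that by blast
  qed
  obtain a b r s where abrs: "a\<^sup>2 - y * b = int p" "r\<^sup>2 + x * s = int q" "x * a + y * r = z" "2 * a * r + b * x - y * s = 0"
    using anticommuting_matrices[OF xyz(1-4)] by blast
  define P Q where "P = real p" and "Q = real q"
  define T where "T = mat2 a b (- y) (- a)"
  define U where "U = mat2 r s x (- r)"
  define J where "J = mat2 0 1 (- 1) 0"
  define J' where "J' = mat2 0 (- 1) 1 0"
  define h where "h = y * s - a * r"
  define k where "k = a * s - b * r"
  define G where "G = mat2 z h h k"
  have real_eqs: "real_of_int a * a - y * b = P" "real_of_int r * r + x * s = Q"
    using arg_cong[OF abrs(1), of real_of_int] arg_cong[OF abrs(2), of real_of_int]
    by (simp_all add: P_def Q_def power2_eq_square)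
  have h: "real_of_int h = y * s - a * r" and k: "real_of_int k = a * s - b * r"
    by (simp_all add: h_def k_def)
  have h': "real_of_int h = a * r + b * x"
    using arg_cong[OF abrs(4), of real_of_int] unfolding h by simp
  have z: "real_of_int z = x * a + y * r" using arg_cong[OF abrs(3), of real_of_int] by simp
  have TT: "T ** T = P *\<^sub>R mat 1" and UU: "U ** U = Q *\<^sub>R mat 1"
    using real_eqs by (simp_all add: T_def U_def mat2_simps algebra_simps)
  have TU: "T ** U = mat2 h k (- z) (- h)"
    using h h' z k by (simp add: T_def U_def mat2_simps)
  have UT: "U ** T = - (T ** U)"
    unfolding TU using h h' z k by (simp add: T_def U_def mat2_simps) (simp add: algebra_simps)
  have G: "G = J' ** (T ** U)" by (simp add: TU J'_def mat2_simps G_def)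
  have JJ: "J ** J' = mat 1" by (simp add: J_def J'_def mat2_simps)
  have TUTU: "(T ** U) ** (T ** U) = (- (P * Q)) *\<^sub>R mat 1"
  proof -
    have "(T ** U) ** (T ** U) = T ** (U ** T) ** U" by (simp add: matrix_mul_assoc)
    also have "\<dots> = - ((T ** T) ** (U ** U))" by (simp add: UT matrix_mul_assoc matrix_mult_uminus)
    also have "\<dots> = (- (P * Q)) *\<^sub>R mat 1" by (simp add: TT UU scaleR_matrix_mult)
    finally show ?thesis .
  qed
  \<comment> \<open>A diagonal entry of the preceding matrix equation, read as the determinant of
    \<open>G\<close>.\<close>
  then have det: "real_of_int z * k - h * h = P * Q" unfolding TU by (simp add: mat2_simps algebra_simps)
  have PQ: "P * Q > 0" using pq by (simp add: P_def Q_def prime_gt_0_nat)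
  have z0: "real_of_int z > 0" using xyz(5) by simp
  define \<alpha> \<gamma> where "\<alpha> = sqrt z" and "\<gamma> = sqrt (P * Q / z)"
  have \<alpha>\<gamma>: "\<alpha> > 0" "\<gamma> > 0" "\<alpha> * \<alpha> = z" "\<gamma> * \<gamma> = P * Q / z" using z0 PQ by (simp_all add: \<alpha>_def \<gamma>_def)
  \<comment> \<open>The upper triangular Cholesky factor of \<open>G\<close>; its entries need not
    be rational, only the Gram matrix is integral.\<close>
  define A where "A = mat2 \<alpha> (h / \<alpha>) 0 \<gamma>"
  define Ai where "Ai = mat2 (1 / \<alpha>) (- (h / (\<alpha> * \<alpha> * \<gamma>))) 0 (1 / \<gamma>)"
  have AA: "A ** Ai = mat 1" "Ai ** A = mat 1"
    using \<alpha>\<gamma>(1,2) by (simp_all add: A_def Ai_def mat2_simps field_simps)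
  have AG: "transpose A ** A = G"
  proof -
    have "h / \<alpha> * (h / \<alpha>) + \<gamma> * \<gamma> = (h * h + P * Q) / z" by (simp add: \<alpha>\<gamma>(3,4) add_divide_distrib)
    also have "\<dots> = k" using det z0 by (simp add: field_simps)
    finally show ?thesis using \<alpha>\<gamma>(1,3) by (simp add: A_def G_def mat2_simps)
  qed
  have int: "int_matrix G" "int_matrix T" "int_matrix U" "int_matrix J" "int_matrix J'"
    by (simp_all add: G_def T_def U_def J_def J'_def mat2_simps)
  have int_mult: "int_matrix (M ** N)" if "int_matrix M" "int_matrix N" for M N
    using that by (simp add: int_matrix_def matrix_matrix_mult_def Ints_sum)
  have int_uminus: "int_matrix (- M)" if "int_matrix M" for M using that by (simp add: int_matrix_def)
  have Gs: "transpose G = G" by (simp add: G_def mat2_simps)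
  define good where "good e \<longleftrightarrow> (\<exists>T' H N. int_matrix T' \<and> int_matrix H \<and> int_matrix N \<and>
        (\<exists>s. (s = 1 \<or> s = - 1) \<and> transpose H = s *\<^sub>R H) \<and> transpose H ** T' = G \<and>
        G ** T' = real e *\<^sub>R H \<and> real (p * q) *\<^sub>R T' = real e *\<^sub>R (N ** G))" for e
  have goodI: "good e" if "int_matrix T'" "int_matrix H" "int_matrix N" "transpose H = s *\<^sub>R H" "s = 1 \<or> s = - 1"
    "transpose H ** T' = G" "G ** T' = real e *\<^sub>R H" "real (p * q) *\<^sub>R T' = real e *\<^sub>R (N ** G)" for e T' H N s
    unfolding good_def using that by blast
  have "good e" if e: "e dvd p * q" for e
  proof -
    obtain b c where "e = b * c" "b dvd p" "c dvd q" using e by (metis division_decomp)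
    moreover have "b = 1 \<or> b = p" "c = 1 \<or> c = q" using calculation pq by (simp_all add: prime_nat_iff)
    ultimately have "e = 1 \<or> e = p \<or> e = q \<or> e = p * q" by auto
    moreover have "good e" if "e = 1"
    proof (rule goodI[where T' = "mat 1" and H = "G" and N = "- (T ** U ** J)" and s = 1])
      show "int_matrix (mat 1)" by (simp add: mat2_simps)
      have "- (T ** U ** J) ** G = - ((T ** U) ** (J ** J') ** (T ** U))" by (simp add: G matrix_mult_uminus matrix_mul_assoc)
      then show "real (p * q) *\<^sub>R mat 1 = real e *\<^sub>R (- (T ** U ** J) ** G)" by (simp add: JJ TUTU that P_def Q_def)
    qed (use int int_mult int_uminus Gs that in simp_all)
    moreover have "good e" if "e = p"
    proof (rule goodI[where T' = T and H = "- (J' ** U)" and N = "- (U ** J)" and s = 1])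
      show s: "transpose (- (J' ** U)) = 1 *\<^sub>R - (J' ** U)" by (simp add: J'_def U_def mat2_simps)
      show "transpose (- (J' ** U)) ** T = G" unfolding s
        by (simp add: G matrix_mult_uminus UT flip: matrix_mul_assoc)
      have "G ** T = J' ** T ** (U ** T)" by (simp add: G matrix_mul_assoc)
      also have "\<dots> = - (J' ** (T ** T) ** U)" by (simp add: UT matrix_mult_uminus matrix_mul_assoc)
      finally show "G ** T = real e *\<^sub>R - (J' ** U)" by (simp add: TT scaleR_matrix_mult that P_def)
      have "- (U ** J) ** G = - (U ** (J ** J') ** T ** U)" by (simp add: G matrix_mult_uminus matrix_mul_assoc)
      also have "\<dots> = - ((U ** T) ** U)" by (simp add: JJ)
      also have "\<dots> = T ** (U ** U)" by (simp add: UT matrix_mult_uminus matrix_mul_assoc)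
      finally show "real (p * q) *\<^sub>R T = real e *\<^sub>R (- (U ** J) ** G)" by (simp add: UU scaleR_matrix_mult that P_def Q_def)
    qed (use int int_mult int_uminus in simp_all)
    moreover have "good e" if "e = q"
    proof (rule goodI[where T' = U and H = "J' ** T" and N = "T ** J" and s = 1])
      show s: "transpose (J' ** T) = 1 *\<^sub>R (J' ** T)" by (simp add: J'_def T_def mat2_simps)
      show "transpose (J' ** T) ** U = G" unfolding s by (simp add: G matrix_mul_assoc)
      have "G ** U = J' ** T ** (U ** U)" by (simp add: G matrix_mul_assoc)
      then show "G ** U = real e *\<^sub>R (J' ** T)" by (simp add: UU scaleR_matrix_mult that Q_def)
      have "T ** J ** G = T ** (J ** J') ** T ** U" by (simp add: G matrix_mul_assoc)
      also have "\<dots> = P *\<^sub>R U" by (simp add: JJ TT scaleR_matrix_mult)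
      finally show "real (p * q) *\<^sub>R U = real e *\<^sub>R (T ** J ** G)" by (simp add: that P_def)
    qed (use int int_mult int_uminus in simp_all)
    \<comment> \<open>The product has square \<open>- (p * q)\<close> and is skew with respect to
      \<open>G\<close>, while the other three maps are symmetric. This is the case for which
      \<open>plane_block\<close> and \<open>modular_map\<close> admit a sign.\<close>
    moreover have "good e" if "e = p * q"
    proof (rule goodI[where T' = "T ** U" and H = "- J'" and N = J and s = "- 1"])
      show s: "transpose (- J') = (- 1) *\<^sub>R - J'" by (simp add: J'_def mat2_simps)
      show "transpose (- J') ** (T ** U) = G" unfolding s by (simp add: G)
      have "G ** (T ** U) = J' ** ((T ** U) ** (T ** U))" by (simp add: G matrix_mul_assoc)
      then show "G ** (T ** U) = real e *\<^sub>R - J'" by (simp add: TUTU scaleR_matrix_mult matrix_mult_uminus that P_def Q_def)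
      have "J ** G = T ** U" by (simp add: G JJ matrix_mul_assoc)
      then show "real (p * q) *\<^sub>R (T ** U) = real e *\<^sub>R (J ** G)" by (simp add: that)
    qed (use int int_mult int_uminus in simp_all)
    ultimately show ?thesis by blast
  qed
  then have "plane_block (p * q) A Ai" using AA int(1) unfolding plane_block_def AG good_def by blast
  then show ?thesis by blast
qed

section \<open>The extremal lattices\<close>

context binary_coordinates
begin

text \<open>Choosing both new primes larger than the level reached so far keeps it
  squarefree.\<close>

lemma tower_exists: "k \<le> v \<Longrightarrow> \<exists>l L. tower k l L \<and> squarefree l \<and> size (prime_factorization l) = 2 * k"
proof (induction k)
  case 0
  then show ?case using tower_zero by (intro exI[of _ 1] exI[of _ int_vectors]) simp
next
  case (Suc k)
  then obtain l L where IH: "tower k l L" "squarefree l" "size (prime_factorization l) = 2 * k" by auto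
  have l0: "l > 0" using IH(2) by (metis gr0I not_squarefree_0)
  obtain p q :: nat where pq: "Factorial_Ring.prime p" "Factorial_Ring.prime q" "p > l" "q > l" "p \<noteq> q"
    "\<exists>\<alpha>. [\<alpha>\<^sup>2 = int p] (mod int q)" "\<exists>\<beta>. [\<beta>\<^sup>2 = int q] (mod int p)"
    using prime_pair_residues[of l] by blast
  obtain A Ai where blk: "plane_block (p * q) A Ai" using plane_block_exists[OF pq(1,2,5,6,7)] by blast
  have pq0: "p * q > 0" using pq by (simp add: prime_gt_0_nat)
  have "tower (Suc k) (l * (p * q)) (act k A ` L)"
    using Suc.prems by (intro tower_step[OF _ IH(1) blk l0 pq0]) simp
  moreover have "squarefree (l * (p * q))"
  proof -
    have nd: "\<not> p dvd l" "\<not> q dvd l" using pq l0 by (auto dest: dvd_imp_le)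
    have "coprime p q" using pq by (simp add: primes_coprime)
    then have "squarefree (p * q)" using pq by (intro squarefree_mult_coprime squarefree_prime) auto
    moreover have "coprime p l" "coprime q l" using prime_imp_coprime[OF pq(1) nd(1)] prime_imp_coprime[OF pq(2) nd(2)] .
    then have "coprime l (p * q)" by (simp add: coprime_commute)
    ultimately show ?thesis using squarefree_mult_coprime[OF _ IH(2)] by blast
  qed
  moreover have "size (prime_factorization (l * (p * q))) = 2 * Suc k"
    using l0 pq IH(3) by (simp add: prime_factorization_mult prime_factorization_prime prime_gt_0_nat)
  ultimately show ?case by blast
qed

lemma strongly_modular_exists:
  "\<exists>L :: (real ^ 'n) set. integral_lattice L \<and> strongly_modular L \<and> squarefree (lattice_level L) \<and>
     size (prime_factorization (lattice_level L)) = 2 * v"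
proof -
  obtain l L where L: "tower v l L" "squarefree l" "size (prime_factorization l) = 2 * v" using tower_exists by blast
  have int: "integral_lattice L" and T: "\<And>m. m dvd l \<Longrightarrow> \<exists>T. modular_map l m L T" using L(1) unfolding tower_def by blast+
  show ?thesis using strongly_modular_criterion[OF int L(2) T] int L(2,3) by auto
qed

end

text \<open>The index type is put in bijection with pairs of a subset of \<open>{..<v}\<close> and a
  number below \<open>w\<close>; the bits of an index record membership in the subset.\<close>

lemma binary_coordinates_exist:
  assumes "2 ^ v dvd CARD('n::finite)"
  shows "\<exists>bit setb. binary_coordinates (bit :: 'n \<Rightarrow> nat \<Rightarrow> bool) setb v"
proof -
  obtain w where w: "CARD('n) = 2 ^ v * w" using assms by blast
  let ?X = "Pow {..<v} \<times> {..<w}"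
  have "card ?X = CARD('n)" by (simp add: w card_cartesian_product card_Pow)
  then obtain f :: "'n \<Rightarrow> nat set \<times> nat" where f: "bij_betw f UNIV ?X"
    using finite_same_card_bij[of "UNIV :: 'n set" ?X] by auto
  define g where "g = inv_into UNIV f"
  have fg: "f (g y) = y" if "y \<in> ?X" for y using f that by (simp add: g_def bij_betw_inv_into_right)
  have gf: "g (f i) = i" for i using f by (simp add: g_def bij_betw_inv_into_left)
  have fX: "f i \<in> ?X" for i using f by (auto simp: bij_betw_def)
  define upd where "upd k b S = (if b then insert k S else S - {k})" for k :: nat and b S
  define setb where "setb k b i = g (upd k b (fst (f i)), snd (f i))" for k b i
  have f_set: "f (setb k b i) = (upd k b (fst (f i)), snd (f i))" if "k < v" for k b i
    unfolding setb_def by (rule fg) (use fX[of i] that in \<open>auto simp: upd_def mem_Times_iff\<close>)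
  have inj: "i = j" if "f i = f j" for i j using that gf by metis
  have "binary_coordinates (\<lambda>i k. k \<in> fst (f i)) setb v"
  proof
    show "setb k (k \<in> fst (f i)) i = i" if "k < v" for k i
      by (rule inj) (auto simp: f_set[OF that] upd_def prod_eq_iff)
    show "setb k b (setb j c i) = setb j c (setb k b i)" if "k < v" "j < v" "j \<noteq> k" for k j b c i
      by (rule inj) (use that in \<open>auto simp: f_set upd_def\<close>)
    show "setb k b (setb k c i) = setb k b i" if "k < v" for k b c i
      by (rule inj) (auto simp: f_set[OF that] upd_def)
  qed (auto simp: f_set upd_def)
  then show ?thesis by blast
qed

theorem theorem3p2:
  shows "(\<forall>L :: (real ^ 'n) set. integral_lattice L \<longrightarrow>
            F2_dim (I_group L Mod B_set L) \<le> 2 * multiplicity 2 CARD('n))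
       \<and> (\<forall>L :: (real ^ 'n) set. integral_lattice L \<and> strongly_modular L \<and>
            squarefree (lattice_level L) \<longrightarrow>
            size (prime_factorization (lattice_level L)) \<le> 2 * multiplicity 2 CARD('n))
       \<and> (\<exists>L :: (real ^ 'n) set. integral_lattice L \<and> strongly_modular L \<and>
            squarefree (lattice_level L) \<and>
            size (prime_factorization (lattice_level L)) = 2 * multiplicity 2 CARD('n))"
proof (intro conjI allI impI)
  obtain bit and setb :: "nat \<Rightarrow> bool \<Rightarrow> 'n \<Rightarrow> 'n" where "binary_coordinates bit setb (multiplicity 2 CARD('n))"
    using binary_coordinates_exist[OF multiplicity_dvd] by blast
  then show "\<exists>L :: (real ^ 'n) set. integral_lattice L \<and> strongly_modular L \<and>
            squarefree (lattice_level L) \<and>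
            size (prime_factorization (lattice_level L)) = 2 * multiplicity 2 CARD('n)"
    by (rule binary_coordinates.strongly_modular_exists)
qed (use F2_dim_bound strongly_modular_bound in blast)+

end
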